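(* Let $M$ be a sparse paving matroid that is not Ingleton-compliant. Then $M$ is not ZY-compliant; consequently $M$ is not almost entropic and $M$ is not algebraic (over any field).
   Context: A polymatroid is a pair $(Q,f)$ with $Q$ finite and $f:\mathcal P(Q)\to\mathbb R$ satisfying $f(\emptyset)=0$, $f(X)\le f(Y)$ for $X\subseteq Y$, and $f(X\cap Y)+f(X\cup Y)\le f(X)+f(Y)$. A matroid is a polymatroid $(Q,r)$ with integer values and $r(X)\le |X|$ for all $X$. For $X,Y,Z\subseteq Q$ write $f(Y: Z\mid X)=f(X\cup Y)+f(X\cup Z)-f(X\cup Y\cup Z)-f(X)$ and $f(Y:Z)=f(Y:Z\mid\emptyset)$. A matroid of rank $k$ is paving if every circuit has rank $k$ or $k-1$, and sparse paving if moreover every circuit of rank $k-1$ is a flat (these are the circuit-hyperplanes). A polymatroid $(Q,f)$ is Ingleton-compliant if for all $A_1,A_2,A_3,A_4\subseteq Q$: $f(A_2:A_3)\le f(A_2:A_3\mid A_1)+f(A_2:A_3\mid A_4)+f(A_1:A_4)$. It is ZY-compliant if for all $A_1,\dots,A_4\subseteq Q$: $2f(A_2:A_3)\le f(A_1:A_4)+f(A_1:A_2\cup A_3)+3f(A_2:A_3\mid A_1)+f(A_2:A_3\mid A_4)$. The entropic vector of a finite family $(S_x)_{x\in Q}$ of discrete random variables is $h(X)=H((S_x)_{x\in X})$; a polymatroid is entropic if its rank function is a nonnegative multiple of an entropic vector, and almost entropic if its rank function lies in the closure in $\mathbb R^{\mathcal P(Q)}$ of the set of entropic vectors. A matroid $(Q,r)$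 is algebraic over a field $\mathbb F$ if there are a field extension $\mathbb K/\mathbb F$ and elements $(v_x)_{x\in Q}$ of $\mathbb K$ such that $r(X)$ is the transcendence degree of $\mathbb F(\{v_x\}_{x\in X})/\mathbb F$ for all $X\subseteq Q$. *)

theory Defs
  imports
    "HOL-Algebra.Finite_Extensions"
    "HOL-Algebra.Generated_Fields"
    "HOL-Probability.Probability"
begin

section \<open>Polymatroids and matroids\<close>

locale polymatroid =
  fixes Q :: "'a set" and f :: "'a set \<Rightarrow> real"
  assumes finite_ground: "finite Q"
    and f_empty: "f {} = 0"
    and f_mono: "\<And>A Y. A \<subseteq> Y \<Longrightarrow> Y \<subseteq> Q \<Longrightarrow> f A \<le> f Y"
    and f_submodular: "\<And>A Y. A \<subseteq> Q \<Longrightarrow> Y \<subseteq> Q \<Longrightarrow> f (A \<inter> Y) + f (A \<union> Y) \<le> f A + f Y"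

locale matroid = polymatroid Q r for Q :: "'a set" and r :: "'a set \<Rightarrow> real" +
  assumes r_integer: "\<And>A. A \<subseteq> Q \<Longrightarrow> r A \<in> \<int>"
    and r_le_card: "\<And>A. A \<subseteq> Q \<Longrightarrow> r A \<le> real (card A)"

definition independent_set :: "'a set \<Rightarrow> ('a set \<Rightarrow> real) \<Rightarrow> 'a set \<Rightarrow> bool" where
  "independent_set Q r A \<longleftrightarrow> A \<subseteq> Q \<and> r A = real (card A)"

definition circuit :: "'a set \<Rightarrow> ('a set \<Rightarrow> real) \<Rightarrow> 'a set \<Rightarrow> bool" where
  "circuit Q r C \<longleftrightarrow>
     C \<subseteq> Q \<and> \<not> independent_set Q r C \<and> (\<forall>A. A \<subset> C \<longrightarrow> independent_set Q r A)"

definition flat :: "'a set \<Rightarrow> ('a set \<Rightarrow> real) \<Rightarrow> 'a set \<Rightarrow> bool" where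
  "flat Q r A \<longleftrightarrow> A \<subseteq> Q \<and> (\<forall>x \<in> Q - A. r A < r (insert x A))"

definition paving :: "'a set \<Rightarrow> ('a set \<Rightarrow> real) \<Rightarrow> bool" where
  "paving Q r \<longleftrightarrow> matroid Q r \<and> (\<forall>C. circuit Q r C \<longrightarrow> r C = r Q \<or> r C = r Q - 1)"

definition sparse_paving :: "'a set \<Rightarrow> ('a set \<Rightarrow> real) \<Rightarrow> bool" where
  "sparse_paving Q r \<longleftrightarrow>
     paving Q r \<and> (\<forall>C. circuit Q r C \<and> r C = r Q - 1 \<longrightarrow> flat Q r C)"

section \<open>The Ingleton and Zhang-Yeung inequalities\<close>

text \<open>\<open>cond_info f Y Z A\<close> is written $f(Y : Z \mid A)$, and \<open>info f Y Z\<close> is written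
  $f(Y : Z)$; the conditioning set is the last argument.\<close>

definition cond_info :: "('a set \<Rightarrow> real) \<Rightarrow> 'a set \<Rightarrow> 'a set \<Rightarrow> 'a set \<Rightarrow> real" where
  "cond_info f Y Z A = f (A \<union> Y) + f (A \<union> Z) - f (A \<union> Y \<union> Z) - f A"

definition info :: "('a set \<Rightarrow> real) \<Rightarrow> 'a set \<Rightarrow> 'a set \<Rightarrow> real" where
  "info f Y Z = cond_info f Y Z {}"

definition ingleton_compliant :: "'a set \<Rightarrow> ('a set \<Rightarrow> real) \<Rightarrow> bool" where
  "ingleton_compliant Q f \<longleftrightarrow>
     (\<forall>A1 A2 A3 A4. A1 \<subseteq> Q \<and> A2 \<subseteq> Q \<and> A3 \<subseteq> Q \<and> A4 \<subseteq> Q \<longrightarrow>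
        info f A2 A3 \<le> cond_info f A2 A3 A1 + cond_info f A2 A3 A4 + info f A1 A4)"

definition ZY_compliant :: "'a set \<Rightarrow> ('a set \<Rightarrow> real) \<Rightarrow> bool" where
  "ZY_compliant Q f \<longleftrightarrow>
     (\<forall>A1 A2 A3 A4. A1 \<subseteq> Q \<and> A2 \<subseteq> Q \<and> A3 \<subseteq> Q \<and> A4 \<subseteq> Q \<longrightarrow>
        2 * info f A2 A3 \<le> info f A1 A4 + info f A1 (A2 \<union> A3)
          + 3 * cond_info f A2 A3 A1 + cond_info f A2 A3 A4)"

section \<open>Almost entropic polymatroids\<close>

definition discrete_rv :: "'w measure \<Rightarrow> ('w \<Rightarrow> 'b) \<Rightarrow> bool" where
  "discrete_rv M Y \<longleftrightarrow>
     countable (Y ` space M) \<and> Y \<in> measurable M (count_space (Y ` space M))"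

definition joint_rv :: "('a \<Rightarrow> 'w \<Rightarrow> 'v) \<Rightarrow> 'a set \<Rightarrow> 'w \<Rightarrow> 'a \<Rightarrow> 'v" where
  "joint_rv S A = (\<lambda>\<omega>. \<lambda>x\<in>A. S x \<omega>)"

text \<open>Shannon entropy in bits. The library's entropy is a Bochner integral, which is \<open>0\<close>
  rather than infinite when it diverges; hence \<open>has_finite_entropy\<close> is required below.\<close>

definition shannon_entropy :: "'w measure \<Rightarrow> ('w \<Rightarrow> 'b) \<Rightarrow> real" where
  "shannon_entropy M Y = prob_space.entropy M 2 (count_space (Y ` space M)) Y"

definition has_finite_entropy :: "'w measure \<Rightarrow> ('w \<Rightarrow> 'b) \<Rightarrow> bool" where
  "has_finite_entropy M Y \<longleftrightarrow>
     (\<exists>p. information_space.finite_entropy M 2 (count_space (Y ` space M)) Y p)"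

text \<open>Elements of $\mathbb{R}^{\mathcal{P}(Q)}$ are the functions that are \<open>undefined\<close> outside
  \<open>Pow Q\<close>, as in the carrier of \<open>product_topology\<close>. The type arguments are the types of the
  sample space and of the values of the random variables.\<close>

definition entropic_vectors ::
    "'w itself \<Rightarrow> 'v itself \<Rightarrow> 'a set \<Rightarrow> ('a set \<Rightarrow> real) set" where
  "entropic_vectors _ _ Q =
     {h. \<exists>(M :: 'w measure) (S :: 'a \<Rightarrow> 'w \<Rightarrow> 'v).
           prob_space M \<and> (\<forall>x\<in>Q. discrete_rv M (S x)) \<and>
           (\<forall>A\<in>Pow Q. has_finite_entropy M (joint_rv S A)) \<and>
           h = (\<lambda>A\<in>Pow Q. shannon_entropy M (joint_rv S A))}"

definition almost_entropic ::
    "'w itself \<Rightarrow> 'v itself \<Rightarrow> 'a set \<Rightarrow> ('a set \<Rightarrow> real) \<Rightarrow> bool" where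
  "almost_entropic W V Q f \<longleftrightarrow>
     restrict f (Pow Q) \<in>
       product_topology (\<lambda>_. euclideanreal) (Pow Q) closure_of entropic_vectors W V Q"

section \<open>Algebraic matroids\<close>

text \<open>In the following three definitions \<open>F\<close> is a subfield of the field \<open>K\<close>.
  A multiset \<open>m\<close> over \<open>B\<close> is a monomial, and a pair of \<open>E\<close> and \<open>c\<close> is a polynomial with
  coefficients in \<open>F\<close> whose indeterminates are evaluated at the elements of \<open>B\<close>.\<close>

definition algebraically_independent ::
    "('l, 'm) ring_scheme \<Rightarrow> 'l set \<Rightarrow> 'l set \<Rightarrow> bool" where
  "algebraically_independent K F B \<longleftrightarrow>
     (\<forall>(E :: 'l multiset set) c.
        finite E \<and> (\<forall>m\<in>E. set_mset m \<subseteq> B \<and> c m \<in> F) \<and>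
        (\<Oplus>\<^bsub>K\<^esub>m\<in>E. c m \<otimes>\<^bsub>K\<^esub> (\<Otimes>\<^bsub>K\<^esub>b\<in>set_mset m. b [^]\<^bsub>K\<^esub> count m b)) = \<zero>\<^bsub>K\<^esub>
        \<longrightarrow> (\<forall>m\<in>E. c m = \<zero>\<^bsub>K\<^esub>))"

definition transcendence_basis ::
    "('l, 'm) ring_scheme \<Rightarrow> 'l set \<Rightarrow> 'l set \<Rightarrow> 'l set \<Rightarrow> bool" where
  "transcendence_basis K F L B \<longleftrightarrow>
     B \<subseteq> L \<and> algebraically_independent K F B \<and>
     (\<forall>y\<in>L. ring.algebraic K (generate_field K (F \<union> B)) y)"

definition has_transcendence_degree ::
    "('l, 'm) ring_scheme \<Rightarrow> 'l set \<Rightarrow> 'l set \<Rightarrow> nat \<Rightarrow> bool" where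
  "has_transcendence_degree K F L n \<longleftrightarrow>
     (\<exists>B. transcendence_basis K F L B \<and> finite B \<and> card B = n)"

text \<open>The type argument is the carrier type of the extension field, into which \<open>F\<close> is embedded
  by \<open>\<phi>\<close> (homomorphisms between fields are injective).\<close>

definition algebraic_over ::
    "'l itself \<Rightarrow> 'k ring \<Rightarrow> 'a set \<Rightarrow> ('a set \<Rightarrow> real) \<Rightarrow> bool" where
  "algebraic_over _ F Q r \<longleftrightarrow>
     (\<exists>(K :: 'l ring) \<phi> v.
        field K \<and> \<phi> \<in> ring_hom F K \<and> v \<in> Q \<rightarrow> carrier K \<and>
        (\<forall>A. A \<subseteq> Q \<longrightarrow>
           (\<exists>n. has_transcendence_degree K (\<phi> ` carrier F)
                  (generate_field K (\<phi> ` carrier F \<union> v ` A)) n \<and> r A = real n)))"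

end

theory Submission
  imports Defs "HOL-Algebra.Algebraic_Closure"
begin

text \<open>
  Counting elements by membership pattern shows that an Ingleton violation in a sparse paving matroid
  forces five of the six unions \<open>Ai \<union> Aj\<close> to be circuit-hyperplanes; after replacing \<open>A1\<close> and \<open>A4\<close>
  by their unions with \<open>A2 \<inter> A3\<close> the ranks are those of the Vamos matroid modulo a common set,
  and this pattern violates the Zhang--Yeung inequality.

  Entropic vectors satisfy the Zhang--Yeung inequality by the copy lemma: adjoin a copy of \<open>A1\<close> that is
  conditionally independent of the rest given \<open>A2 \<union> A3\<close>, and combine Shannon inequalities. The
  inequality is closed, so it passes to limits.

  Algebraic matroids are excluded through the Ingleton--Main lemma: lines that are pairwise coplanar
  but not all coplanar share a point of the algebraic closure. In the Vamos pattern this forces the skew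
  lines \<open>A1\<close> and \<open>A4\<close> to meet.
\<close>

section \<open>Ingleton violations in sparse paving matroids\<close>

text \<open>The algebraic case does not pass through entropy: it reuses the rank pattern
  geometrically, and the only geometric input is that two coplanar lines meet when a third line,
  coplanar with each, leaves their plane. The obstacle is to see why algebraic closure has this
  property in every characteristic. Let e be transcendental over L, let k1 and k2 be relatively
  algebraically closed in L, and let f be algebraic over k1(e) and over k2(e). The conjugates of f
  over L(e) are algebraic over k1(e), hence so are the coefficients of its minimal polynomial over
  L(e). Such a coefficient is a fraction in e over L, and comparing leading terms shows that its
  leading coefficient is algebraic over k1, so it lies in k1, and likewise in k2. Stripping leading
  terms and inverting, as in a continued fraction, puts the whole fraction into (k1 \<inter> k2)(e).
  On the entropic side supports may be infinite. Entropies are therefore expected logarithms, and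
  integrability for the largest family of variables controls all smaller ones.\<close>

lemma Ints_ge_nat:
  fixes x :: real
  assumes "x \<in> \<int>" "x > real k - 1"
  shows "x \<ge> real k"
proof -
  obtain z where "x = of_int z"
    using assms(1) by (auto elim: Ints_cases)
  then have "real_of_int (int k - 1) < real_of_int z"
    using assms(2) by simp
  then show ?thesis
    unfolding \<open>x = of_int z\<close> of_int_less_iff by (metis int_one_le_iff_zero_less add.commute diff_less_eq of_int_le_iff of_int_of_nat_eq zless_add1_eq zle_add1_eq_le)
qed

text \<open>A dependent set of rank below k contains a circuit, whose rank must be k - 1. Being a
  flat, this circuit cannot grow without reaching rank k, so it is the whole set; and a circuit has
  one element more than its rank.\<close>

lemma sparse_paving_rank:
  assumes "sparse_paving Q r" and k: "r Q = real k" and A: "A \<subseteq> Q"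
  shows "r A = k \<or> r A = card A \<or> (card A = k \<and> r A = real k - 1)"
proof (rule ccontr)
  assume neg: "\<not> ?thesis"
  interpret matroid Q r
    using assms(1) by (simp add: sparse_paving_def paving_def)
  have fin: "finite B" if "B \<subseteq> Q" for B
    using that finite_ground finite_subset by blast
  have "r A < k"
    using neg f_mono[OF A order_refl] k by force
  have "\<not> independent_set Q r A"
    using neg by (simp add: independent_set_def)
  \<comment> \<open>A dependent subset of least cardinality is a circuit.\<close>
  then obtain C where C: "C \<subseteq> A" "\<not> independent_set Q r C"
      and min: "\<And>B. B \<subseteq> A \<Longrightarrow> \<not> independent_set Q r B \<Longrightarrow> card C \<le> card B"
    using ex_has_least_nat[of "\<lambda>B. B \<subseteq> A \<and> \<not> independent_set Q r B" A card] by blast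
  have CQ: "C \<subseteq> Q" and "finite C"
    using C A fin by auto
  have circ: "circuit Q r C"
    unfolding circuit_def
  proof (intro conjI allI impI CQ C(2))
    fix B assume "B \<subset> C"
    then have "card B < card C"
      using \<open>finite C\<close> psubset_card_mono by blast
    then show "independent_set Q r B"
      using min[of B] \<open>B \<subset> C\<close> C(1) by fastforce
  qed
  have "r C < k"
    using f_mono[OF C(1) A] \<open>r A < k\<close> by linarith
  then have rC: "r C = real k - 1"
    using circ assms(1) k by (auto simp: sparse_paving_def paving_def)
  have "flat Q r C"
    using assms(1) circ rC k by (auto simp: sparse_paving_def)
  have AC: "A = C"
  proof (rule ccontr)
    assume "A \<noteq> C"
    then obtain x where x: "x \<in> A" "x \<notin> C"
      using C(1) by blast
    then have "r C < r (insert x C)"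
      using \<open>flat Q r C\<close> A by (auto simp: flat_def)
    moreover have "r (insert x C) \<in> \<int>"
      using r_integer[of "insert x C"] x A CQ by auto
    ultimately have "r (insert x C) \<ge> k"
      using rC Ints_ge_nat by simp
    moreover have "r (insert x C) \<le> r A"
      using f_mono[of "insert x C" A] x C(1) A by auto
    ultimately show False
      using \<open>r A < k\<close> by linarith
  qed
  have "C \<noteq> {}"
    using C(2) f_empty by (auto simp: independent_set_def)
  then obtain x where x: "x \<in> C"
    by blast
  then have "independent_set Q r (C - {x})"
    using circ by (auto simp: circuit_def)
  moreover have Cpos: "card C > 0"
    using x \<open>finite C\<close> card_gt_0_iff by blast
  ultimately have "r (C - {x}) = real (card C) - 1"
    using x by (simp add: independent_set_def)
  moreover have "r (C - {x}) \<le> r C"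
    using f_mono[of "C - {x}" C] CQ by auto
  moreover have "r C < card C"
    using C(2) CQ r_le_card[OF CQ] by (auto simp: independent_set_def)
  moreover have "r C \<in> \<int>"
    using CQ r_integer by blast
  ultimately have "r C = real (card C) - 1"
    using Ints_ge_nat[of "r C" "card C"] by linarith
  then show False
    using neg rC AC Cpos by auto
qed

text \<open>The union has more than k elements, hence rank k; the intersection has fewer than k,
  hence is independent. Submodularity then leaves at most k - 2 elements for the
  intersection.\<close>

lemma circuit_hyperplanes_union:
  assumes "sparse_paving Q r" and k: "r Q = real k" and "A \<subseteq> Q" "B \<subseteq> Q" "A \<noteq> B"
    and "card A = k" "card B = k" "r A = real k - 1" "r B = real k - 1"
  shows "card (A \<union> B) \<ge> k + 2"
proof -
  interpret matroid Q r
    using assms(1) by (simp add: sparse_paving_def paving_def)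
  have fin: "finite A" "finite B"
    using assms finite_ground finite_subset by blast+
  have "\<not> B \<subseteq> A"
    using assms fin card_subset_eq by metis
  then have "card (A \<union> B) > k" "card (A \<inter> B) < k"
    using psubset_card_mono[of "A \<union> B" A] psubset_card_mono[of B "A \<inter> B"] fin assms by auto
  moreover have "r (A \<union> B) = k"
    using sparse_paving_rank[OF assms(1) k, of "A \<union> B"] assms f_mono[of "A \<union> B" Q] calculation by auto
  moreover have "r (A \<inter> B) = card (A \<inter> B)"
    using sparse_paving_rank[OF assms(1) k, of "A \<inter> B"] r_le_card[of "A \<inter> B"] \<open>A \<subseteq> Q\<close>
      calculation by (simp add: le_infI1)
  moreover have "r (A \<inter> B) + r (A \<union> B) \<le> r A + r B"
    using f_submodular assms by blast
  moreover have "card (A \<union> B) + card (A \<inter> B) = card A + card B"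
    using card_Un_Int fin by metis
  ultimately show ?thesis
    using assms by linarith
qed

text \<open>The rank pattern of the Vamos matroid after contracting \<open>I\<close>: four lines, all pairs of which
  except \<open>A1\<close>, \<open>A4\<close> are coplanar.\<close>

definition vamos_configuration ::
    "'a set \<Rightarrow> ('a set \<Rightarrow> real) \<Rightarrow> nat \<Rightarrow> 'a set \<Rightarrow> 'a set \<Rightarrow> 'a set \<Rightarrow> 'a set \<Rightarrow> 'a set \<Rightarrow> bool" where
  "vamos_configuration Q r m I A1 A2 A3 A4 \<longleftrightarrow>
     A1 \<subseteq> Q \<and> A2 \<subseteq> Q \<and> A3 \<subseteq> Q \<and> A4 \<subseteq> Q \<and> I \<subseteq> A1 \<inter> A2 \<inter> A3 \<inter> A4 \<and> r I = m \<and>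
     r A1 = m + 2 \<and> r A2 = m + 2 \<and> r A3 = m + 2 \<and> r A4 = m + 2 \<and>
     r (A1 \<union> A2) = m + 3 \<and> r (A1 \<union> A3) = m + 3 \<and> r (A2 \<union> A3) = m + 3 \<and>
     r (A2 \<union> A4) = m + 3 \<and> r (A3 \<union> A4) = m + 3 \<and>
     r (A1 \<union> A4) = m + 4 \<and> r (A1 \<union> A2 \<union> A3) = m + 4 \<and> r (A2 \<union> A3 \<union> A4) = m + 4"

text \<open>Both conditional terms vanish on this pattern: the left side is 2(m + 1) and the right
  side m + (m + 1).\<close>

lemma vamos_not_ZY_compliant:
  assumes "vamos_configuration Q r m I A1 A2 A3 A4" and "r {} = 0"
  shows "\<not> ZY_compliant Q r"
proof
  assume "ZY_compliant Q r"
  then have "2 * info r A2 A3 \<le> info r A1 A4 + info r A1 (A2 \<union> A3)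
      + 3 * cond_info r A2 A3 A1 + cond_info r A2 A3 A4"
    using assms by (auto simp: ZY_compliant_def vamos_configuration_def)
  then show False
    using assms
    by (simp add: vamos_configuration_def info_def cond_info_def Un_ac)
qed

text \<open>All cardinalities become linear expressions in the same sixteen Venn cells, so that the
  counting below is linear arithmetic.\<close>

lemma card_four_sets:
  fixes A1 A2 A3 A4 U :: "'a set"
  assumes "finite U"
  defines "n \<equiv> \<lambda>b1 b2 b3 b4. card {x \<in> U. (x \<in> A1) = b1 \<and> (x \<in> A2) = b2 \<and> (x \<in> A3) = b3 \<and> (x \<in> A4) = b4}"
  shows "card {x \<in> U. P (x \<in> A1) (x \<in> A2) (x \<in> A3) (x \<in> A4)} =
    (\<Sum>b1\<in>UNIV. \<Sum>b2\<in>UNIV. \<Sum>b3\<in>UNIV. \<Sum>b4\<in>UNIV. of_bool (P b1 b2 b3 b4) * n b1 b2 b3 b4)"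
proof -
  have split: "card {x \<in> U. R x} = (\<Sum>b\<in>UNIV. card {x \<in> U. R x \<and> (x \<in> A) = b})" for R and A :: "'a set"
  proof -
    have "{x \<in> U. R x} = {x \<in> U. R x \<and> x \<in> A} \<union> {x \<in> U. R x \<and> x \<notin> A}"
      by blast
    also have "card \<dots> = card {x \<in> U. R x \<and> x \<in> A} + card {x \<in> U. R x \<and> x \<notin> A}"
      using assms(1) by (intro card_Un_disjoint) auto
    finally show ?thesis
      by (simp add: UNIV_bool)
  qed
  have "card {x \<in> U. P (x \<in> A1) (x \<in> A2) (x \<in> A3) (x \<in> A4)} =
    (\<Sum>b1\<in>UNIV. \<Sum>b2\<in>UNIV. \<Sum>b3\<in>UNIV. \<Sum>b4\<in>UNIV. card {x \<in> U. (((P (x \<in> A1) (x \<in> A2) (x \<in> A3) (x \<in> A4)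
      \<and> (x \<in> A1) = b1) \<and> (x \<in> A2) = b2) \<and> (x \<in> A3) = b3) \<and> (x \<in> A4) = b4})"
    by (subst split[where A = A1], subst split[where A = A2], subst split[where A = A3],
        subst split[where A = A4]) (rule refl)
  also have "\<dots> = (\<Sum>b1\<in>UNIV. \<Sum>b2\<in>UNIV. \<Sum>b3\<in>UNIV. \<Sum>b4\<in>UNIV. of_bool (P b1 b2 b3 b4) * n b1 b2 b3 b4)"
  proof (intro sum.cong refl)
    fix b1 b2 b3 b4
    show "card {x \<in> U. (((P (x \<in> A1) (x \<in> A2) (x \<in> A3) (x \<in> A4)
      \<and> (x \<in> A1) = b1) \<and> (x \<in> A2) = b2) \<and> (x \<in> A3) = b3) \<and> (x \<in> A4) = b4} = of_bool (P b1 b2 b3 b4) * n b1 b2 b3 b4"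
    proof (cases "P b1 b2 b3 b4")
      case True
      then show ?thesis
        unfolding n_def by (auto intro!: arg_cong[where f = card])
    next
      case False
      then have empty: "{x \<in> U. (((P (x \<in> A1) (x \<in> A2) (x \<in> A3) (x \<in> A4)
        \<and> (x \<in> A1) = b1) \<and> (x \<in> A2) = b2) \<and> (x \<in> A3) = b3) \<and> (x \<in> A4) = b4} = {}"
        by (intro equals0I, elim CollectE conjE) simp
      then show ?thesis
        using False by (simp only: empty) simp
    qed
  qed
  finally show ?thesis .
qed

text \<open>If one of these inequalities were an equality, the Ingleton inequality would follow from
  monotonicity and submodularity. It is symmetric under exchanging A2 with A3 and A1 with A4, so the
  two cases yield all six strict inequalities that are used later.\<close>

lemma ingleton_violation_strict:
  assumes "polymatroid Q f" and sub: "A1 \<subseteq> Q" "A2 \<subseteq> Q" "A3 \<subseteq> Q" "A4 \<subseteq> Q"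
    and viol: "f A2 + f A3 + f (A1 \<union> A4) + f (A1 \<union> A2 \<union> A3) + f (A2 \<union> A3 \<union> A4)
      > f (A2 \<union> A3) + f (A1 \<union> A2) + f (A1 \<union> A3) + f (A2 \<union> A4) + f (A3 \<union> A4)"
  shows "f (A2 \<union> A3) < f (A1 \<union> A2 \<union> A3)" "f (A1 \<union> A2) < f (A1 \<union> A2 \<union> A3)"
proof -
  interpret polymatroid Q f
    by fact
  \<comment> \<open>The sets Ai may overlap, so the intersection can exceed the set \<open>U\<close>
    one wants to name; monotonicity absorbs the difference.\<close>
  have sm: "f U + f (S \<union> T) \<le> f S + f T" if "U \<subseteq> S \<inter> T" "S \<subseteq> Q" "T \<subseteq> Q" for S T U
    using f_submodular[of S T] f_mono[of U "S \<inter> T"] that by fastforce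
  note m = sm[of A2 "A1 \<union> A2" "A2 \<union> A4"] sm[of A3 "A1 \<union> A3" "A3 \<union> A4"]
    sm[of "A1 \<union> A4" "(A1 \<union> A2) \<union> (A2 \<union> A4)" "(A1 \<union> A3) \<union> (A3 \<union> A4)"]
    f_mono[of "A2 \<union> A3 \<union> A4" "((A1 \<union> A2) \<union> (A2 \<union> A4)) \<union> ((A1 \<union> A3) \<union> (A3 \<union> A4))"]
    sm[of A2 "A2 \<union> A3" "A2 \<union> A4"]
    f_mono[of "A1 \<union> A4" "(A1 \<union> A3) \<union> (A3 \<union> A4)"]
    f_mono[of "A2 \<union> A3 \<union> A4" "(A2 \<union> A3) \<union> (A2 \<union> A4)"]
    f_mono[of "A2 \<union> A3" "A1 \<union> A2 \<union> A3"] f_mono[of "A1 \<union> A2" "A1 \<union> A2 \<union> A3"]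
  show "f (A2 \<union> A3) < f (A1 \<union> A2 \<union> A3)"
    using m(1-4,8) sub viol by force
  show "f (A1 \<union> A2) < f (A1 \<union> A2 \<union> A3)"
    using m(2,5-7,9) sub viol by force
qed

lemma sparse_paving_ingleton_violation:
  assumes "sparse_paving Q r" and "\<not> ingleton_compliant Q r"
  obtains m I A1 A2 A3 A4 where "vamos_configuration Q r m I A1 A2 A3 A4"
proof -
  interpret matroid Q r
    using assms(1) by (simp add: sparse_paving_def paving_def)
  have poly: "polymatroid Q r" ..
  have fin: "finite A" if "A \<subseteq> Q" for A
    using that finite_ground finite_subset by blast
  have "r Q \<ge> 0"
    using f_mono[of "{}" Q] f_empty by simp
  then obtain k where k: "r Q = real k"
    using r_integer[of Q] by (metis Ints_cases nonneg_int_cases of_int_0_le_iff of_int_of_nat_eq order_refl)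
  note rank = sparse_paving_rank[OF assms(1) k]
  have rk_le: "r A \<le> k" if "A \<subseteq> Q" for A
    using f_mono[of A Q] that k by simp
  obtain A1 A2 A3 A4 where sub: "A1 \<subseteq> Q" "A2 \<subseteq> Q" "A3 \<subseteq> Q" "A4 \<subseteq> Q"
    and "info r A2 A3 > cond_info r A2 A3 A1 + cond_info r A2 A3 A4 + info r A1 A4"
    using assms(2) by (auto simp: ingleton_compliant_def not_le)
  then have viol: "r A2 + r A3 + r (A1 \<union> A4) + r (A1 \<union> A2 \<union> A3) + r (A2 \<union> A3 \<union> A4)
      > r (A2 \<union> A3) + r (A1 \<union> A2) + r (A1 \<union> A3) + r (A2 \<union> A4) + r (A3 \<union> A4)"
    by (simp add: info_def cond_info_def f_empty Un_ac)
  have strict: "r (A2 \<union> A3) < r (A1 \<union> A2 \<union> A3)" "r (A1 \<union> A2) < r (A1 \<union> A2 \<union> A3)"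
      "r (A1 \<union> A3) < r (A1 \<union> A2 \<union> A3)"
      "r (A2 \<union> A3) < r (A2 \<union> A3 \<union> A4)" "r (A2 \<union> A4) < r (A2 \<union> A3 \<union> A4)"
      "r (A3 \<union> A4) < r (A2 \<union> A3 \<union> A4)"
    using ingleton_violation_strict[OF poly sub(1,2,3,4)] ingleton_violation_strict[OF poly sub(1,3,2,4)]
      ingleton_violation_strict[OF poly sub(4,2,3,1)] ingleton_violation_strict[OF poly sub(4,3,2,1)] viol
    by (simp_all add: Un_ac)
  \<comment> \<open>Ranks are measured by their defect from cardinality: \<open>d\<close> on the
    pairwise unions, where it is 0 or 1, and the nullity \<open>e\<close> elsewhere. The violation
    becomes an inequality between small integers.\<close>
  define hyp where "hyp S \<longleftrightarrow> S \<subseteq> Q \<and> card S = k \<and> r S = real k - 1" for S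
  define d where "d S = (if hyp S then 1 else 0 :: int)" for S
  have pair: "r S = real (card S) - d S" if "S \<subseteq> Q" "r S < k" for S
    using rank[OF that(1)] that by (auto simp: hyp_def d_def)
  define e where "e T = int (card T) - \<lfloor>r T\<rfloor>" for T
  have e: "r T = real (card T) - e T" "e T \<ge> 0" if "T \<subseteq> Q" for T
    using r_integer[OF that] r_le_card[OF that] by (auto simp: e_def elim!: Ints_cases)
  \<comment> \<open>A circuit-hyperplane of smaller rank inside \<open>T\<close> forces rank k and
    nullity at least 1. Two that cover \<open>T\<close> are distinct, so \<open>T\<close> has at
    least k + 2 elements and nullity at least 2.\<close>
  have triple: "e T \<ge> d S1 + d S2" "e T \<ge> d S1 + d S3" "e T \<ge> d S2 + d S3" "hyp S1 \<Longrightarrow> r T = k"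
    if T: "T \<subseteq> Q" and S: "S1 \<union> S2 = T" "S1 \<union> S3 = T" "S2 \<union> S3 = T" "r S1 < r T" "r S2 < r T" "r S3 < r T" for T S1 S2 S3
  proof -
    have one: "r T = k \<and> e T \<ge> 1" if "hyp S" "S \<subseteq> T" "r S < r T" for S
    proof -
      have "r T > real k - 1"
        using that by (simp add: hyp_def)
      then have rT: "r T = k"
        using Ints_ge_nat[OF r_integer[OF T]] rk_le[OF T] by fastforce
      have "card S < card T"
        using that fin[OF T] by (metis less_irrefl psubsetI psubset_card_mono)
      then show ?thesis
        using e(1)[OF T] rT that(1) by (auto simp: hyp_def)
    qed
    have two: "e T \<ge> 2" if "hyp S" "hyp S'" "S \<union> S' = T" "r S < r T" for S S'
    proof -
      have "S \<noteq> S'" "S \<subseteq> T"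
        using that by auto
      then have "k + 2 \<le> card T"
        using circuit_hyperplanes_union[OF assms(1) k, of S S'] that by (auto simp: hyp_def)
      then show ?thesis
        using e(1)[OF T] one[OF that(1) \<open>S \<subseteq> T\<close> that(4)] by auto
    qed
    have sum: "e T \<ge> d S + d S'" if "S \<union> S' = T" "r S < r T" "r S' < r T" for S S'
      using one[of S] one[of S'] two[of S S'] e(2)[OF T] that by (auto simp: d_def)
    show "e T \<ge> d S1 + d S2" "e T \<ge> d S1 + d S3" "e T \<ge> d S2 + d S3" "hyp S1 \<Longrightarrow> r T = k"
      using sum[of S1 S2] sum[of S1 S3] sum[of S2 S3] one[of S1] S by auto
  qed
  note t123 = triple[of "A1 \<union> A2 \<union> A3" "A2 \<union> A3" "A1 \<union> A2" "A1 \<union> A3"]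
  note t234 = triple[of "A2 \<union> A3 \<union> A4" "A2 \<union> A3" "A2 \<union> A4" "A3 \<union> A4"]
  have un3: "A2 \<union> A3 \<union> (A1 \<union> A2) = A1 \<union> A2 \<union> A3" "A2 \<union> A3 \<union> (A1 \<union> A3) = A1 \<union> A2 \<union> A3" "A1 \<union> A2 \<union> (A1 \<union> A3) = A1 \<union> A2 \<union> A3"
      "A2 \<union> A3 \<union> (A2 \<union> A4) = A2 \<union> A3 \<union> A4" "A2 \<union> A3 \<union> (A3 \<union> A4) = A2 \<union> A3 \<union> A4" "A2 \<union> A4 \<union> (A3 \<union> A4) = A2 \<union> A3 \<union> A4"
    by auto
  define n where "n b1 b2 b3 b4 = card {x \<in> Q. (x \<in> A1) = b1 \<and> (x \<in> A2) = b2 \<and> (x \<in> A3) = b3 \<and> (x \<in> A4) = b4}"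
    for b1 b2 b3 b4
  have eqs: "A2 = {x \<in> Q. x \<in> A2}" "A3 = {x \<in> Q. x \<in> A3}" "A2 \<union> A3 = {x \<in> Q. x \<in> A2 \<or> x \<in> A3}"
      "A1 \<union> A2 = {x \<in> Q. x \<in> A1 \<or> x \<in> A2}" "A1 \<union> A3 = {x \<in> Q. x \<in> A1 \<or> x \<in> A3}"
      "A2 \<union> A4 = {x \<in> Q. x \<in> A2 \<or> x \<in> A4}" "A3 \<union> A4 = {x \<in> Q. x \<in> A3 \<or> x \<in> A4}"
      "A1 \<union> A4 = {x \<in> Q. x \<in> A1 \<or> x \<in> A4}"
      "A1 \<union> A2 \<union> A3 = {x \<in> Q. x \<in> A1 \<or> x \<in> A2 \<or> x \<in> A3}"
      "A2 \<union> A3 \<union> A4 = {x \<in> Q. x \<in> A2 \<or> x \<in> A3 \<or> x \<in> A4}"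
      "A2 \<inter> A3 = {x \<in> Q. x \<in> A2 \<and> x \<in> A3}" "A1 \<union> A2 \<inter> A3 = {x \<in> Q. x \<in> A1 \<or> x \<in> A2 \<and> x \<in> A3}"
      "A4 \<union> A2 \<inter> A3 = {x \<in> Q. x \<in> A4 \<or> x \<in> A2 \<and> x \<in> A3}"
    using sub by auto
  note cards4 = card_four_sets[OF finite_ground, where ?A1.0 = A1 and ?A2.0 = A2 and ?A3.0 = A3 and ?A4.0 = A4,
      folded n_def]
  note cards = eqs(1)[THEN arg_cong[where f = card], unfolded cards4[of "\<lambda>a b c d. b"]]
    eqs(2)[THEN arg_cong[where f = card], unfolded cards4[of "\<lambda>a b c d. c"]]
    eqs(3)[THEN arg_cong[where f = card], unfolded cards4[of "\<lambda>a b c d. b \<or> c"]]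
    eqs(4)[THEN arg_cong[where f = card], unfolded cards4[of "\<lambda>a b c d. a \<or> b"]]
    eqs(5)[THEN arg_cong[where f = card], unfolded cards4[of "\<lambda>a b c d. a \<or> c"]]
    eqs(6)[THEN arg_cong[where f = card], unfolded cards4[of "\<lambda>a b c d. b \<or> d"]]
    eqs(7)[THEN arg_cong[where f = card], unfolded cards4[of "\<lambda>a b c d. c \<or> d"]]
    eqs(8)[THEN arg_cong[where f = card], unfolded cards4[of "\<lambda>a b c d. a \<or> d"]]
    eqs(9)[THEN arg_cong[where f = card], unfolded cards4[of "\<lambda>a b c d. a \<or> b \<or> c"]]
    eqs(10)[THEN arg_cong[where f = card], unfolded cards4[of "\<lambda>a b c d. b \<or> c \<or> d"]]
    eqs(11)[THEN arg_cong[where f = card], unfolded cards4[of "\<lambda>a b c d. b \<and> c"]]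
    eqs(12)[THEN arg_cong[where f = card], unfolded cards4[of "\<lambda>a b c d. a \<or> b \<and> c"]]
    eqs(13)[THEN arg_cong[where f = card], unfolded cards4[of "\<lambda>a b c d. d \<or> b \<and> c"]]
  note cards' = cards[simplified UNIV_bool, simplified]
  \<comment> \<open>These are the cells on which the Ingleton inequality for cardinality is strict,
    each with excess one.\<close>
  define s where "s = n True False False True + n False True True False + n True True False True + n True False True True"
  have slack: "card (A2 \<union> A3) + card (A1 \<union> A2) + card (A1 \<union> A3) + card (A2 \<union> A4) + card (A3 \<union> A4)
      = card A2 + card A3 + card (A1 \<union> A4) + card (A1 \<union> A2 \<union> A3) + card (A2 \<union> A3 \<union> A4) + s"
    using cards' unfolding s_def by linarith
  have below: "r (A2 \<union> A3) < k" "r (A1 \<union> A2) < k" "r (A1 \<union> A3) < k" "r (A2 \<union> A4) < k" "r (A3 \<union> A4) < k"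
    using strict rk_le[of "A1 \<union> A2 \<union> A3"] rk_le[of "A2 \<union> A3 \<union> A4"] sub by force+
  have "real_of_int (d (A2 \<union> A3) + d (A1 \<union> A2) + d (A1 \<union> A3) + d (A2 \<union> A4) + d (A3 \<union> A4))
      > real_of_int (int s + e (A1 \<union> A4) + e (A1 \<union> A2 \<union> A3) + e (A2 \<union> A3 \<union> A4))"
    using viol pair[OF _ below(1)] pair[OF _ below(2)] pair[OF _ below(3)] pair[OF _ below(4)] pair[OF _ below(5)]
      e(1)[of "A1 \<union> A4"] e(1)[of "A1 \<union> A2 \<union> A3"] e(1)[of "A2 \<union> A3 \<union> A4"] r_le_card[of A2] r_le_card[of A3]
      sub slack[THEN arg_cong[where f = real]]
    by simp
  then have dineq: "d (A2 \<union> A3) + d (A1 \<union> A2) + d (A1 \<union> A3) + d (A2 \<union> A4) + d (A3 \<union> A4)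
      > int s + e (A1 \<union> A4) + e (A1 \<union> A2 \<union> A3) + e (A2 \<union> A3 \<union> A4)"
    by linarith
  have e14: "e (A1 \<union> A4) \<ge> 0"
    using e(2) sub by simp
  have sub3: "A1 \<union> A2 \<union> A3 \<subseteq> Q" "A2 \<union> A3 \<union> A4 \<subseteq> Q"
    using sub by auto
  note tri = t123[OF sub3(1) un3(1,2,3) strict(1,2,3)] t234[OF sub3(2) un3(4,5,6) strict(4,5,6)]
  have d01: "d S \<le> 1" "d S = 1 \<Longrightarrow> hyp S" for S
    by (auto simp: d_def split: if_splits)
  \<comment> \<open>The nullities of the two triple unions already pay for the four indicators other
    than \<open>d (A2 \<union> A3)\<close>. Hence that one is 1 and everything else is tight; the
    bounds for the pairs containing \<open>A2 \<union> A3\<close> then force the other four to be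
    1.\<close>
  have "d (A2 \<union> A3) = 1" "d (A1 \<union> A2) = 1" "d (A1 \<union> A3) = 1" "d (A2 \<union> A4) = 1" "d (A3 \<union> A4) = 1"
    and res0: "s = 0" "e (A1 \<union> A4) = 0" "e (A1 \<union> A2 \<union> A3) = 2" "e (A2 \<union> A3 \<union> A4) = 2"
    using dineq e14 tri(1,2,3,5,6,7) d01(1)[of "A2 \<union> A3"] d01(1)[of "A1 \<union> A2"] d01(1)[of "A1 \<union> A3"]
      d01(1)[of "A2 \<union> A4"] d01(1)[of "A3 \<union> A4"] by linarith+
  then have hyps: "hyp (A2 \<union> A3) \<and> hyp (A1 \<union> A2) \<and> hyp (A1 \<union> A3) \<and> hyp (A2 \<union> A4) \<and> hyp (A3 \<union> A4)"
    using d01(2) by blast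
  then have rk3: "r (A1 \<union> A2 \<union> A3) = k" "r (A2 \<union> A3 \<union> A4) = k"
    using tri(4,8) by blast+
  then have c3: "card (A1 \<union> A2 \<union> A3) = k + 2" "card (A2 \<union> A3 \<union> A4) = k + 2"
      and r14: "r (A1 \<union> A4) = card (A1 \<union> A4)"
    using e(1)[of "A1 \<union> A2 \<union> A3"] e(1)[of "A2 \<union> A3 \<union> A4"] e(1)[of "A1 \<union> A4"] sub res0 by simp_all
  have c14: "card (A1 \<union> A4) \<le> k"
    using rk_le[of "A1 \<union> A4"] r14 sub by simp
  have c2: "card (A2 \<union> A3) = k" "card (A1 \<union> A2) = k" "card (A1 \<union> A3) = k" "card (A2 \<union> A4) = k" "card (A3 \<union> A4) = k"
    using hyps by (simp_all add: hyp_def)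
  have zeros: "n True False False True = 0" "n False True True False = 0" "n True True False True = 0" "n True False True True = 0"
    using \<open>s = 0\<close> by (simp_all add: s_def)
  have part: "n True False False False = 2" "n False False False True = 2"
      "n False True False False + n False True False True = 2" "n False False True False + n False False True True = 2"
      "n False True False False + n True True False False = 2" "n False False True False + n True False True False = 2"
    using cards'(3,9) cards'(3,10) cards'(5,9) cards'(4,9) cards'(7,10) cards'(6,10) zeros c2 c3 by simp_all
  have "n False True False False + n False False True False \<ge> 4"
    using cards'(3,8) c14 zeros c2(1) part(1,2) by simp
  then have part': "n False True False False = 2" "n False False True False = 2" "n False True False True = 0"
      "n False False True True = 0" "n True True False False = 0" "n True False True False = 0"
    using part(3-6) by linarith+
  have res: "card (A2 \<inter> A3) + 4 = k" "card A2 + 2 = k" "card A3 + 2 = k" "card (A1 \<union> A2 \<inter> A3) + 2 = k"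
      "card (A4 \<union> A2 \<inter> A3) + 2 = k" "card (A1 \<union> A4) = k"
    using cards'(3,11) cards'(1) cards'(2) cards'(12) cards'(13) cards'(8) zeros c2(1) part(1,2) part' by simp_all
  \<comment> \<open>Adding \<open>A2 \<inter> A3\<close> to A1 and A4 changes no union in the
    pattern: it lies in \<open>A1 \<union> A4\<close>, and every other union contains A2 or
    A3.\<close>
  have I14: "A2 \<inter> A3 \<subseteq> A1 \<union> A4"
    using zeros(2) sub finite_ground by (auto simp: n_def)
  have small: "r S = card S" if "S \<subseteq> Q" "card S < k" for S
    using rank[OF that(1)] r_le_card[OF that(1)] that(2) by auto
  have un: "(A1 \<union> A2 \<inter> A3) \<union> A2 = A1 \<union> A2" "(A1 \<union> A2 \<inter> A3) \<union> A3 = A1 \<union> A3" "A2 \<union> (A4 \<union> A2 \<inter> A3) = A2 \<union> A4"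
      "A3 \<union> (A4 \<union> A2 \<inter> A3) = A3 \<union> A4" "(A1 \<union> A2 \<inter> A3) \<union> (A4 \<union> A2 \<inter> A3) = A1 \<union> A4"
      "(A1 \<union> A2 \<inter> A3) \<union> A2 \<union> A3 = A1 \<union> A2 \<union> A3" "A2 \<union> A3 \<union> (A4 \<union> A2 \<inter> A3) = A2 \<union> A3 \<union> A4"
    using I14 by blast+
  \<comment> \<open>The subtraction is not truncated: the cell counts give k = |A2 \<inter> A3| + 4,
    so m is the size of the common set.\<close>
  have m: "real k = real (k - 4) + 4"
    using res(1) by linarith
  have ranks: "r (A2 \<inter> A3) = real (k - 4)" "r A2 = real (k - 4) + 2" "r A3 = real (k - 4) + 2"
      "r (A1 \<union> A2 \<inter> A3) = real (k - 4) + 2" "r (A4 \<union> A2 \<inter> A3) = real (k - 4) + 2"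
  proof -
    have two: "r S = real (k - 4) + 2" if "S \<subseteq> Q" "card S + 2 = k" for S
      using small[OF that(1)] that(2) m by linarith
    show "r (A2 \<inter> A3) = real (k - 4)"
      using small[of "A2 \<inter> A3"] sub res(1) m by (simp add: le_infI1)
    have s14: "A1 \<union> A2 \<inter> A3 \<subseteq> Q" "A4 \<union> A2 \<inter> A3 \<subseteq> Q"
      using sub by auto
    show "r A2 = real (k - 4) + 2" "r A3 = real (k - 4) + 2"
        "r (A1 \<union> A2 \<inter> A3) = real (k - 4) + 2" "r (A4 \<union> A2 \<inter> A3) = real (k - 4) + 2"
      using two[OF sub(2) res(2)] two[OF sub(3) res(3)] two[OF s14(1) res(4)] two[OF s14(2) res(5)] .
  qed
  have planes: "r (A2 \<union> A3) = real (k - 4) + 3" "r (A1 \<union> A2) = real (k - 4) + 3" "r (A1 \<union> A3) = real (k - 4) + 3"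
      "r (A2 \<union> A4) = real (k - 4) + 3" "r (A3 \<union> A4) = real (k - 4) + 3" "r (A1 \<union> A4) = real (k - 4) + 4"
  proof -
    have hp: "r S = real (k - 4) + 3" if "hyp S" for S
      using that m unfolding hyp_def by linarith
    show "r (A2 \<union> A3) = real (k - 4) + 3" "r (A1 \<union> A2) = real (k - 4) + 3" "r (A1 \<union> A3) = real (k - 4) + 3"
        "r (A2 \<union> A4) = real (k - 4) + 3" "r (A3 \<union> A4) = real (k - 4) + 3"
      using hyps hp by blast+
    show "r (A1 \<union> A4) = real (k - 4) + 4"
      using r14 res(6) m by linarith
  qed
  have all: "r (A1 \<union> A2 \<union> A3) = real (k - 4) + 4" "r (A2 \<union> A3 \<union> A4) = real (k - 4) + 4"
    using rk3 m by linarith+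
  have subs: "A1 \<union> A2 \<inter> A3 \<subseteq> Q" "A4 \<union> A2 \<inter> A3 \<subseteq> Q"
      "A2 \<inter> A3 \<subseteq> (A1 \<union> A2 \<inter> A3) \<inter> A2 \<inter> A3 \<inter> (A4 \<union> A2 \<inter> A3)"
    using sub by blast+
  have "vamos_configuration Q r (k - 4) (A2 \<inter> A3) (A1 \<union> A2 \<inter> A3) A2 A3 (A4 \<union> A2 \<inter> A3)"
    unfolding vamos_configuration_def un of_nat_add of_nat_numeral by (intro conjI sub subs ranks planes all)
  then show ?thesis
    by (rule that)
qed

section \<open>The Zhang--Yeung inequality for entropic vectors\<close>

text \<open>The block of \<open>y\<close> in the partition induced by the variables in
  \<open>A\<close>. Blocks of one sample space let joint variables be compared without passing to
  their value spaces.\<close>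

definition agree :: "('i \<Rightarrow> 'y \<Rightarrow> 'b) \<Rightarrow> 'i set \<Rightarrow> 'y \<Rightarrow> 'y set" where
  "agree V A y = {y'. \<forall>i\<in>A. V i y' = V i y}"

definition agree_prob :: "'y pmf \<Rightarrow> ('i \<Rightarrow> 'y \<Rightarrow> 'b) \<Rightarrow> 'i set \<Rightarrow> 'y \<Rightarrow> real" where
  "agree_prob P V A y = measure (measure_pmf P) (agree V A y)"

text \<open>Entropy as the expected self-information of a block, which also makes sense for infinite
  support.\<close>

definition pmf_entropy :: "'y pmf \<Rightarrow> ('i \<Rightarrow> 'y \<Rightarrow> 'b) \<Rightarrow> 'i set \<Rightarrow> real" where
  "pmf_entropy P V A = measure_pmf.expectation P (\<lambda>y. - log 2 (agree_prob P V A y))"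

definition integrable_info :: "'y pmf \<Rightarrow> ('i \<Rightarrow> 'y \<Rightarrow> 'b) \<Rightarrow> 'i set \<Rightarrow> bool" where
  "integrable_info P V A \<longleftrightarrow> integrable (measure_pmf P) (\<lambda>y. log 2 (agree_prob P V A y))"

lemma agree_refl [simp]: "y \<in> agree V A y"
  by (simp add: agree_def)

lemma agree_Un: "agree V (A \<union> B) y = agree V A y \<inter> agree V B y"
  by (auto simp: agree_def)

lemma agree_eq: "y' \<in> agree V A y \<Longrightarrow> agree V A y' = agree V A y"
  by (auto simp: agree_def)

lemma agree_sym: "y' \<in> agree V A y \<longleftrightarrow> y \<in> agree V A y'"
  by (auto simp: agree_def)

lemma agree_mono: "A \<subseteq> B \<Longrightarrow> agree V B y \<subseteq> agree V A y"
  by (auto simp: agree_def)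

lemma agree_prob_pos: "y \<in> set_pmf P \<Longrightarrow> agree_prob P V A y > 0"
  unfolding agree_prob_def by (intro measure_pmf_posI[of y]) auto

lemma agree_prob_le_1: "agree_prob P V A y \<le> 1"
  by (simp add: agree_prob_def)

lemma agree_prob_mono: "A \<subseteq> B \<Longrightarrow> agree_prob P V B y \<le> agree_prob P V A y"
  unfolding agree_prob_def by (intro measure_pmf.finite_measure_mono agree_mono) auto

text \<open>Blocks shrink as the index set grows, so 0 \<le> -log p_A \<le> -log p_B. Integrability
  has to be carried along because a divergent Bochner integral is 0.\<close>

lemma integrable_info_mono:
  assumes "integrable_info P V B" "A \<subseteq> B"
  shows "integrable_info P V A"
  unfolding integrable_info_def
proof (rule Bochner_Integration.integrable_bound)
  show "integrable (measure_pmf P) (\<lambda>y. log 2 (agree_prob P V B y))"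
    using assms(1) by (simp add: integrable_info_def)
  show "AE y in measure_pmf P. norm (log 2 (agree_prob P V A y)) \<le> norm (log 2 (agree_prob P V B y))"
  proof (intro AE_pmfI)
    fix y assume "y \<in> set_pmf P"
    then have "0 < agree_prob P V B y" "0 < agree_prob P V A y"
      by (auto intro: agree_prob_pos)
    moreover have "agree_prob P V B y \<le> agree_prob P V A y" "agree_prob P V A y \<le> 1"
      using assms(2) by (auto intro: agree_prob_mono agree_prob_le_1)
    ultimately show "norm (log 2 (agree_prob P V A y)) \<le> norm (log 2 (agree_prob P V B y))"
      by simp
  qed
qed simp

lemma nn_integral_pmf_swap:
  "(\<integral>\<^sup>+ x. \<integral>\<^sup>+ y. f x y \<partial>measure_pmf p \<partial>measure_pmf q) = (\<integral>\<^sup>+ y. \<integral>\<^sup>+ x. f x y \<partial>measure_pmf q \<partial>measure_pmf p)"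
proof -
  have "(\<integral>\<^sup>+ x. \<integral>\<^sup>+ y. f x y \<partial>measure_pmf p \<partial>measure_pmf q) = (\<integral>\<^sup>+ z. f (fst z) (snd z) \<partial>pair_pmf q p)"
    by (simp add: nn_integral_pair_pmf')
  also have "\<dots> = (\<integral>\<^sup>+ y. \<integral>\<^sup>+ x. f x y \<partial>measure_pmf q \<partial>measure_pmf p)"
    by (subst pair_commute_pmf) (simp add: nn_integral_pair_pmf' case_prod_unfold)
  finally show ?thesis .
qed

text \<open>Write the numerators as integrals over independent samples u and v and integrate over y
  first. The A-block of u and the B-block of v meet in a single block of
  \<open>A \<union> B\<close>, over which 1/p integrates to 1, or in a set without mass, which
  contributes 0. What remains is the integral of p/p for \<open>A \<inter> B\<close>.\<close>

lemma agree_ratio_le_1: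
  fixes P :: "'y pmf"
  shows "(\<integral>\<^sup>+ y. ennreal (agree_prob P V A y * agree_prob P V B y /
      (agree_prob P V (A \<union> B) y * agree_prob P V (A \<inter> B) y)) \<partial>measure_pmf P) \<le> 1"
proof -
  let ?m = "agree_prob P V"
  have cls: "ennreal (?m C y) = (\<integral>\<^sup>+ z. indicator (agree V C y) z \<partial>measure_pmf P)" for C y
    by (simp add: agree_prob_def measure_pmf.emeasure_eq_measure)
  have "(\<integral>\<^sup>+ y. ennreal (?m A y * ?m B y / (?m (A \<union> B) y * ?m (A \<inter> B) y)) \<partial>measure_pmf P)
    = (\<integral>\<^sup>+ y. ennreal (?m A y) * ennreal (?m B y) * ennreal (1 / (?m (A \<union> B) y * ?m (A \<inter> B) y)) \<partial>measure_pmf P)"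
    by (simp add: agree_prob_def flip: ennreal_mult)
  also have "\<dots> = (\<integral>\<^sup>+ y. (\<integral>\<^sup>+ u. \<integral>\<^sup>+ v. indicator (agree V A y) u * indicator (agree V B y) v
      * ennreal (1 / (?m (A \<union> B) y * ?m (A \<inter> B) y)) \<partial>measure_pmf P \<partial>measure_pmf P) \<partial>measure_pmf P)"
    by (simp add: cls nn_integral_cmult nn_integral_multc mult.assoc)
  also have "\<dots> \<le> (\<integral>\<^sup>+ y. (\<integral>\<^sup>+ u. \<integral>\<^sup>+ v. (indicator (agree V A u \<inter> agree V B v) y * ennreal (1 / ?m (A \<union> B) y))
      * (indicator (agree V (A \<inter> B) u) v * ennreal (1 / ?m (A \<inter> B) u)) \<partial>measure_pmf P \<partial>measure_pmf P) \<partial>measure_pmf P)"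
  proof (intro nn_integral_mono)
    fix y u v
    have "?m (A \<inter> B) y = ?m (A \<inter> B) u" "v \<in> agree V (A \<inter> B) u" "y \<in> agree V A u" "y \<in> agree V B v"
      if "u \<in> agree V A y" "v \<in> agree V B y"
      using that agree_eq[of u V "A \<inter> B" y] agree_mono[of "A \<inter> B" A V y]
      by (auto simp: agree_prob_def agree_def)
    then show "indicator (agree V A y) u * indicator (agree V B y) v
      * ennreal (1 / (?m (A \<union> B) y * ?m (A \<inter> B) y))
      \<le> (indicator (agree V A u \<inter> agree V B v) y * ennreal (1 / ?m (A \<union> B) y))
      * (indicator (agree V (A \<inter> B) u) v * ennreal (1 / ?m (A \<inter> B) u))"
      by (auto simp: indicator_def agree_prob_def simp flip: ennreal_mult)
  qed
  also have "\<dots> = (\<integral>\<^sup>+ u. \<integral>\<^sup>+ v. (\<integral>\<^sup>+ y. indicator (agree V A u \<inter> agree V B v) y * ennreal (1 / ?m (A \<union> B) y) \<partial>measure_pmf P)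
      * (indicator (agree V (A \<inter> B) u) v * ennreal (1 / ?m (A \<inter> B) u)) \<partial>measure_pmf P \<partial>measure_pmf P)"
    by (subst nn_integral_pmf_swap, subst nn_integral_pmf_swap) (simp add: nn_integral_multc)
  also have "\<dots> \<le> (\<integral>\<^sup>+ u. \<integral>\<^sup>+ v. 1 * (indicator (agree V (A \<inter> B) u) v * ennreal (1 / ?m (A \<inter> B) u)) \<partial>measure_pmf P \<partial>measure_pmf P)"
  proof (intro nn_integral_mono mult_right_mono)
    fix u v
    show "(\<integral>\<^sup>+ y. indicator (agree V A u \<inter> agree V B v) y * ennreal (1 / ?m (A \<union> B) y) \<partial>measure_pmf P) \<le> 1"
    proof (cases "\<exists>w\<in>set_pmf P. w \<in> agree V A u \<inter> agree V B v")
      case True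
      then obtain w where w: "w \<in> set_pmf P" "w \<in> agree V A u \<inter> agree V B v"
        by blast
      then have eq: "agree V A u \<inter> agree V B v = agree V (A \<union> B) w"
        using agree_eq[of w V A u] agree_eq[of w V B v] by (simp add: agree_Un)
      have "(\<integral>\<^sup>+ y. indicator (agree V A u \<inter> agree V B v) y * ennreal (1 / ?m (A \<union> B) y) \<partial>measure_pmf P)
        = (\<integral>\<^sup>+ y. indicator (agree V (A \<union> B) w) y * ennreal (1 / ?m (A \<union> B) w) \<partial>measure_pmf P)"
        unfolding eq by (intro nn_integral_cong) (auto simp: indicator_def agree_prob_def agree_eq)
      also have "\<dots> = ennreal (?m (A \<union> B) w) * ennreal (1 / ?m (A \<union> B) w)"
        by (simp add: nn_integral_multc cls)
      also have "\<dots> = 1"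
        using agree_prob_pos[OF w(1), of V "A \<union> B"] by (simp flip: ennreal_mult)
      finally show ?thesis
        by simp
    next
      case False
      have "(\<integral>\<^sup>+ y. indicator (agree V A u \<inter> agree V B v) y * ennreal (1 / ?m (A \<union> B) y) \<partial>measure_pmf P) = (\<integral>\<^sup>+ y. 0 \<partial>measure_pmf P)"
        using False by (intro nn_integral_cong_AE AE_pmfI) (auto simp: indicator_def)
      then show ?thesis
        by simp
    qed
  qed auto
  also have "\<dots> = (\<integral>\<^sup>+ u. ennreal (?m (A \<inter> B) u) * ennreal (1 / ?m (A \<inter> B) u) \<partial>measure_pmf P)"
    by (simp add: nn_integral_multc cls)
  also have "\<dots> = (\<integral>\<^sup>+ u. 1 \<partial>measure_pmf P)"
    using agree_prob_pos[of _ P V "A \<inter> B"]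
    by (intro nn_integral_cong_AE AE_pmfI) (simp add: less_imp_le less_imp_neq[THEN not_sym] flip: ennreal_mult)
  also have "\<dots> = 1"
    by simp
  finally show ?thesis .
qed

lemma pmf_entropy_mono:
  assumes "integrable_info P V B" "A \<subseteq> B"
  shows "pmf_entropy P V A \<le> pmf_entropy P V B"
  unfolding pmf_entropy_def
proof (intro integral_mono_AE AE_pmfI)
  fix y assume "y \<in> set_pmf P"
  then show "- log 2 (agree_prob P V A y) \<le> - log 2 (agree_prob P V B y)"
    using agree_prob_mono[OF assms(2), of P V y] agree_prob_pos[of y P V] by simp
qed (use assms integrable_info_mono[OF assms] in \<open>auto simp: integrable_info_def\<close>)

text \<open>Conditional mutual information is nonnegative: apply ln x \<le> x - 1 to the ratio
  \<open>\<rho>\<close>, whose expectation is at most 1.\<close>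

lemma pmf_entropy_submodular:
  assumes "integrable_info P V (A \<union> B)"
  shows "pmf_entropy P V (A \<union> B) + pmf_entropy P V (A \<inter> B) \<le> pmf_entropy P V A + pmf_entropy P V B"
proof -
  let ?m = "agree_prob P V"
  define \<rho> where "\<rho> y = ?m A y * ?m B y / (?m (A \<union> B) y * ?m (A \<inter> B) y)" for y
  have \<rho>_nonneg: "\<rho> y \<ge> 0" for y
    by (simp add: \<rho>_def agree_prob_def)
  have nn: "(\<integral>\<^sup>+ y. ennreal (\<rho> y) \<partial>measure_pmf P) \<le> 1"
    using agree_ratio_le_1[of P V A B] by (simp add: \<rho>_def)
  have int_\<rho>: "integrable (measure_pmf P) \<rho>"
    using nn \<rho>_nonneg by (intro integrableI_bounded) (auto intro: le_less_trans)
  have int: "integrable (measure_pmf P) (\<lambda>y. log 2 (?m C y))" if "C \<subseteq> A \<union> B" for C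
    using integrable_info_mono[OF assms that] by (simp add: integrable_info_def)
  have ints: "integrable (measure_pmf P) (\<lambda>y. log 2 (?m A y))" "integrable (measure_pmf P) (\<lambda>y. log 2 (?m B y))"
    "integrable (measure_pmf P) (\<lambda>y. log 2 (?m (A \<union> B) y))" "integrable (measure_pmf P) (\<lambda>y. log 2 (?m (A \<inter> B) y))"
    by (rule int; blast)+
  have "ennreal (measure_pmf.expectation P \<rho>) \<le> ennreal 1"
    using nn nn_integral_eq_integral[OF int_\<rho>] \<rho>_nonneg by simp
  then have E\<rho>: "measure_pmf.expectation P \<rho> \<le> 1"
    by (subst (asm) ennreal_le_iff) auto
  have "measure_pmf.expectation P (\<lambda>y. log 2 (?m A y) + log 2 (?m B y) - log 2 (?m (A \<union> B) y) - log 2 (?m (A \<inter> B) y))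
      \<le> measure_pmf.expectation P (\<lambda>y. (\<rho> y - 1) / ln 2)"
  proof (intro integral_mono_AE AE_pmfI)
    fix y assume "y \<in> set_pmf P"
    then have pos: "?m C y > 0" for C
      by (rule agree_prob_pos)
    then have "log 2 (?m A y) + log 2 (?m B y) - log 2 (?m (A \<union> B) y) - log 2 (?m (A \<inter> B) y) = ln (\<rho> y) / ln 2"
      using less_imp_neq[OF pos, THEN not_sym]
      by (simp add: \<rho>_def log_def ln_mult ln_div diff_divide_distrib add_divide_distrib)
    moreover have "\<rho> y > 0"
      using pos by (simp add: \<rho>_def)
    ultimately show "log 2 (?m A y) + log 2 (?m B y) - log 2 (?m (A \<union> B) y) - log 2 (?m (A \<inter> B) y) \<le> (\<rho> y - 1) / ln 2"
      using ln_le_minus_one[of "\<rho> y"] by (simp add: divide_right_mono)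
  qed (use ints int_\<rho> in auto)
  also have "\<dots> = (measure_pmf.expectation P \<rho> - 1) / ln 2"
    using int_\<rho> by simp
  also have "\<dots> \<le> 0"
    using E\<rho> by (simp add: divide_le_0_iff)
  finally show ?thesis
    using ints by (simp add: pmf_entropy_def)
qed

lemma pmf_entropy_map_pmf: "pmf_entropy (map_pmf g P) V A = pmf_entropy P (\<lambda>i y. V i (g y)) A"
proof -
  have "agree_prob (map_pmf g P) V A (g y) = agree_prob P (\<lambda>i y. V i (g y)) A y" for y
    by (simp add: agree_prob_def agree_def vimage_def)
  then show ?thesis
    by (simp add: pmf_entropy_def)
qed

lemma pmf_entropy_cong:
  assumes "\<And>y y'. y \<in> set_pmf P \<Longrightarrow> y' \<in> set_pmf P \<Longrightarrow> y' \<in> agree V A y \<longleftrightarrow> y' \<in> agree W B y"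
  shows "pmf_entropy P V A = pmf_entropy P W B"
proof -
  have "agree_prob P V A y = agree_prob P W B y" if "y \<in> set_pmf P" for y
    unfolding agree_prob_def
    using assms that by (intro measure_pmf.finite_measure_eq_AE AE_pmfI) auto
  then show ?thesis
    unfolding pmf_entropy_def by (intro integral_cong_AE AE_pmfI) auto
qed

text \<open>Two samples with law \<open>P\<close> that are conditionally independent given the
  variables in \<open>Z\<close>: the second is drawn from \<open>P\<close> conditioned on the
  \<open>Z\<close>-block of the first.\<close>

definition copy_pmf :: "'y pmf \<Rightarrow> ('i \<Rightarrow> 'y \<Rightarrow> 'b) \<Rightarrow> 'i set \<Rightarrow> ('y \<times> 'y) pmf" where
  "copy_pmf P V Z = bind_pmf P (\<lambda>y. map_pmf (Pair y) (cond_pmf P (agree V Z y)))"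

definition copy_var :: "('i \<Rightarrow> 'y \<Rightarrow> 'b) \<Rightarrow> 'i + 'i \<Rightarrow> 'y \<times> 'y \<Rightarrow> 'b" where
  "copy_var V = case_sum (\<lambda>i y. V i (fst y)) (\<lambda>i y. V i (snd y))"

lemma cond_nonempty: "y \<in> set_pmf P \<Longrightarrow> set_pmf P \<inter> agree V Z y \<noteq> {}"
  using agree_refl by fastforce

lemma set_copy_pmf:
  "set_pmf (copy_pmf P V Z) = {(y, y'). y \<in> set_pmf P \<and> y' \<in> set_pmf P \<and> y' \<in> agree V Z y}"
  using cond_nonempty[of _ P V Z] by (auto simp: copy_pmf_def set_cond_pmf)

lemma map_fst_copy_pmf: "map_pmf fst (copy_pmf P V Z) = P"
  by (simp add: copy_pmf_def map_bind_pmf pmf.map_comp comp_def map_pmf_const bind_return_pmf')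

text \<open>The \<open>Z\<close>-blocks partition the space, so averaging the conditional laws over
  the blocks restores \<open>P\<close>.\<close>

lemma map_snd_copy_pmf: "map_pmf snd (copy_pmf P V Z) = P"
proof -
  have "map_pmf snd (copy_pmf P V Z) = bind_pmf P (\<lambda>y. cond_pmf P {y'. y' \<in> agree V Z y})"
    by (simp add: copy_pmf_def map_bind_pmf pmf.map_comp comp_def pmf.map_ident)
  also have "\<dots> = P"
  proof (rule bind_cond_pmf_cancel)
    fix y y' assume "y' \<in> agree V Z y"
    then have "{y'. y' \<in> agree V Z y} = {x. y' \<in> agree V Z x}"
      using agree_eq by (metis agree_sym)
    then show "measure (measure_pmf P) {y'. y' \<in> agree V Z y} = measure (measure_pmf P) {x. y' \<in> agree V Z x}"
      by simp
  qed (use agree_refl in fastforce)+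
  finally show ?thesis .
qed

lemma copy_entropy_left: "pmf_entropy (copy_pmf P V Z) (copy_var V) (Inl ` A) = pmf_entropy P V A"
proof -
  have "pmf_entropy (copy_pmf P V Z) (copy_var V) (Inl ` A) = pmf_entropy (copy_pmf P V Z) (\<lambda>i y. V i (fst y)) A"
    by (intro pmf_entropy_cong) (auto simp: agree_def copy_var_def)
  then show ?thesis
    by (simp flip: pmf_entropy_map_pmf add: map_fst_copy_pmf)
qed

text \<open>The copy agrees with the original on \<open>Z\<close> almost surely.\<close>

lemma copy_entropy_right:
  assumes "C \<subseteq> Z"
  shows "pmf_entropy (copy_pmf P V Z) (copy_var V) (Inl ` C \<union> Inr ` A) = pmf_entropy P V (C \<union> A)"
proof -
  have "pmf_entropy (copy_pmf P V Z) (copy_var V) (Inl ` C \<union> Inr ` A)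
      = pmf_entropy (copy_pmf P V Z) (\<lambda>i y. V i (snd y)) (C \<union> A)"
  proof (intro pmf_entropy_cong)
    fix y y' :: "'b \<times> 'b"
    assume "y \<in> set_pmf (copy_pmf P V Z)" "y' \<in> set_pmf (copy_pmf P V Z)"
    then have "V i (fst y) = V i (snd y)" "V i (fst y') = V i (snd y')" if "i \<in> C" for i
      using that assms by (auto simp: set_copy_pmf agree_def)
    then show "y' \<in> agree (copy_var V) (Inl ` C \<union> Inr ` A) y \<longleftrightarrow> y' \<in> agree (\<lambda>i y. V i (snd y)) (C \<union> A) y"
      by (auto simp: agree_def copy_var_def ball_Un)
  qed
  then show ?thesis
    by (simp flip: pmf_entropy_map_pmf add: map_snd_copy_pmf)
qed

lemma measure_cond_pmf:
  assumes "set_pmf p \<inter> s \<noteq> {}"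
  shows "measure (measure_pmf (cond_pmf p s)) B = measure (measure_pmf p) (s \<inter> B) / measure (measure_pmf p) s"
proof -
  have "measure (measure_pmf p) s > 0"
    using assms by (auto intro: measure_pmf_posI)
  then show ?thesis
    using assms by (simp add: cond_pmf.rep_eq measure_pmf.emeasure_eq_measure)
qed

text \<open>Every first sample in the \<open>A\<close>-block of \<open>y\<close> has the
  \<open>Z\<close>-block of \<open>y\<close>, so the second sample follows one fixed conditional law
  and has to fall into the \<open>B\<close>-block of \<open>y'\<close>.\<close>

lemma copy_agree_prob:
  assumes "Z \<subseteq> A" "(y, y') \<in> set_pmf (copy_pmf P V Z)"
  shows "agree_prob (copy_pmf P V Z) (copy_var V) (Inl ` A \<union> Inr ` B) (y, y')
    = agree_prob P V A y * agree_prob P V (Z \<union> B) y' / agree_prob P V Z y"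
proof -
  have y: "y \<in> set_pmf P" "agree V Z y' = agree V Z y"
    using assms(2) agree_eq by (fastforce simp: set_copy_pmf)+
  define E where "E = agree (copy_var V) (Inl ` A \<union> Inr ` B) (y, y')"
  have vim: "Pair u -` E = (if u \<in> agree V A y then agree V B y' else {})" for u
    by (auto simp: E_def agree_def copy_var_def ball_Un)
  have "emeasure (measure_pmf (copy_pmf P V Z)) E
      = (\<integral>\<^sup>+ u. emeasure (measure_pmf (cond_pmf P (agree V Z u))) (Pair u -` E) \<partial>measure_pmf P)"
    by (simp add: copy_pmf_def)
  also have "\<dots> = (\<integral>\<^sup>+ u. ennreal (agree_prob P V (Z \<union> B) y' / agree_prob P V Z y) * indicator (agree V A y) u \<partial>measure_pmf P)"
  proof (intro nn_integral_cong_AE AE_pmfI)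
    fix u assume u: "u \<in> set_pmf P"
    show "emeasure (measure_pmf (cond_pmf P (agree V Z u))) (Pair u -` E)
        = ennreal (agree_prob P V (Z \<union> B) y' / agree_prob P V Z y) * indicator (agree V A y) u"
    proof (cases "u \<in> agree V A y")
      case True
      then have "agree V Z u = agree V Z y"
        using agree_mono[OF assms(1), of V y] by (intro agree_eq) auto
      then show ?thesis
        using True measure_cond_pmf[OF cond_nonempty[OF y(1)], of V Z]
        by (simp add: vim measure_pmf.emeasure_eq_measure agree_prob_def agree_Un y(2))
    qed (simp add: vim)
  qed
  also have "\<dots> = ennreal (agree_prob P V (Z \<union> B) y' / agree_prob P V Z y) * ennreal (agree_prob P V A y)"
    by (simp add: nn_integral_cmult agree_prob_def measure_pmf.emeasure_eq_measure)
  also have "\<dots> = ennreal (agree_prob P V A y * agree_prob P V (Z \<union> B) y' / agree_prob P V Z y)"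
    by (simp add: agree_prob_def mult.commute flip: ennreal_mult)
  finally show ?thesis
    by (simp add: E_def agree_prob_def measure_pmf.emeasure_eq_measure)
qed

text \<open>Conditional independence in entropic form, H(A, B') = H(A) + H(B | Z): the logarithm
  turns the product formula for blocks into a sum, and both marginals are \<open>P\<close>. The same
  pointwise formula gives integrability.\<close>

lemma
  assumes "Z \<subseteq> A" "integrable_info P V (A \<union> B)"
  shows copy_entropy: "pmf_entropy (copy_pmf P V Z) (copy_var V) (Inl ` A \<union> Inr ` B)
      = pmf_entropy P V A + pmf_entropy P V (Z \<union> B) - pmf_entropy P V Z"
    and copy_integrable_info: "integrable_info (copy_pmf P V Z) (copy_var V) (Inl ` A \<union> Inr ` B)"
proof -
  let ?m = "agree_prob P V" and ?P = "copy_pmf P V Z"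
  have int: "integrable (measure_pmf P) (\<lambda>y. log 2 (?m C y))" if "C \<subseteq> A \<union> B" for C
    using integrable_info_mono[OF assms(2) that] by (simp add: integrable_info_def)
  have left: "integrable (measure_pmf ?P) (\<lambda>y. log 2 (?m C (fst y)))"
     "measure_pmf.expectation ?P (\<lambda>y. log 2 (?m C (fst y))) = - pmf_entropy P V C" if "C \<subseteq> A \<union> B" for C
    using int[OF that] map_fst_copy_pmf[of P V Z]
      integrable_map_pmf_eq[of fst ?P "\<lambda>y. log 2 (?m C y)"] integral_map_pmf[of fst ?P "\<lambda>y. log 2 (?m C y)"]
    by (simp_all add: pmf_entropy_def)
  have right: "integrable (measure_pmf ?P) (\<lambda>y. log 2 (?m C (snd y)))"
     "measure_pmf.expectation ?P (\<lambda>y. log 2 (?m C (snd y))) = - pmf_entropy P V C" if "C \<subseteq> A \<union> B" for C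
    using int[OF that] map_snd_copy_pmf[of P V Z]
      integrable_map_pmf_eq[of snd ?P "\<lambda>y. log 2 (?m C y)"] integral_map_pmf[of snd ?P "\<lambda>y. log 2 (?m C y)"]
    by (simp_all add: pmf_entropy_def)
  let ?g = "\<lambda>y. log 2 (?m A (fst y)) + log 2 (?m (Z \<union> B) (snd y)) - log 2 (?m Z (fst y))"
  have eq: "log 2 (agree_prob ?P (copy_var V) (Inl ` A \<union> Inr ` B) y) = ?g y" if y: "y \<in> set_pmf ?P" for y
  proof -
    have "?m C (fst y) > 0" "?m C (snd y) > 0" for C
      using y by (auto simp: set_copy_pmf intro: agree_prob_pos)
    then show ?thesis
      using copy_agree_prob[OF assms(1), of "fst y" "snd y" P V B] y
      by (simp add: log_mult_pos log_divide_pos)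
  qed
  note ints = left[of A] left[of Z] right[of "Z \<union> B"]
  have sub: "A \<subseteq> A \<union> B" "Z \<subseteq> A \<union> B" "Z \<union> B \<subseteq> A \<union> B"
    using assms(1) by auto
  have int_g: "integrable (measure_pmf ?P) ?g"
    using ints sub by auto
  then show "integrable_info ?P (copy_var V) (Inl ` A \<union> Inr ` B)"
    unfolding integrable_info_def using eq by (subst integrable_cong_AE[of _ _ ?g]) (auto intro: AE_pmfI)
  have "pmf_entropy ?P (copy_var V) (Inl ` A \<union> Inr ` B) = measure_pmf.expectation ?P (\<lambda>y. - ?g y)"
    unfolding pmf_entropy_def using eq by (intro integral_cong_AE) (auto intro: AE_pmfI)
  also have "\<dots> = pmf_entropy P V A + pmf_entropy P V (Z \<union> B) - pmf_entropy P V Z"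
    using ints sub by simp
  finally show "pmf_entropy ?P (copy_var V) (Inl ` A \<union> Inr ` B)
      = pmf_entropy P V A + pmf_entropy P V (Z \<union> B) - pmf_entropy P V Z" .
qed

text \<open>The copy of \<open>A\<close> is taken over \<open>C \<union> D\<close>. Jointly with
  subsets of \<open>C \<union> D\<close> it has the entropies of \<open>A\<close> itself, while
  given \<open>C \<union> D\<close> it is independent of the original variables. Here
  \<open>A\<close>, \<open>B\<close>, \<open>C\<close>, \<open>D\<close> stand for A1, A4, A2,
  A3.\<close>

theorem zhang_yeung_pmf:
  assumes int: "integrable_info P V (A \<union> B \<union> C \<union> D)"
  defines "h \<equiv> pmf_entropy P V"
  shows "2 * (h C + h D - h (C \<union> D)) \<le> (h A + h B - h (A \<union> B)) + (h A + h (C \<union> D) - h (A \<union> (C \<union> D)))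
    + 3 * (h (A \<union> C) + h (A \<union> D) - h (A \<union> C \<union> D) - h A) + (h (B \<union> C) + h (B \<union> D) - h (B \<union> C \<union> D) - h B)"
proof -
  let ?P = "copy_pmf P V (C \<union> D)" and ?V = "copy_var V"
  let ?a = "Inl ` A" and ?b = "Inl ` B" and ?c = "Inl ` C" and ?d = "Inl ` D" and ?t = "Inr ` A"
  define g where "g = pmf_entropy ?P ?V"
  have sub: "C \<union> D \<subseteq> A \<union> B \<union> C \<union> D" and int': "integrable_info P V (A \<union> B \<union> C \<union> D \<union> A)"
    using int by (auto simp: Un_ac)
  have top: "integrable_info ?P ?V (?a \<union> ?b \<union> ?c \<union> ?d \<union> ?t)"
    using copy_integrable_info[OF sub int'] by (simp add: image_Un Un_ac)
  \<comment> \<open>The sets \<open>A\<close>, \<open>B\<close>, \<open>C\<close>, \<open>D\<close>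
    may overlap, hence only an inclusion for \<open>U\<close>.\<close>
  have sm: "g (S \<union> T) + g U \<le> g S + g T"
    if "S \<union> T \<subseteq> ?a \<union> ?b \<union> ?c \<union> ?d \<union> ?t" "U \<subseteq> S \<inter> T" for S T U
  proof -
    have "integrable_info ?P ?V (S \<inter> T)"
      by (rule integrable_info_mono[OF top]) (use that(1) in blast)
    then show ?thesis
      using pmf_entropy_submodular[OF integrable_info_mono[OF top that(1)]] pmf_entropy_mono[OF _ that(2)]
      unfolding g_def by fastforce
  qed
  have left: "g (Inl ` S) = h S" for S
    by (simp add: g_def h_def copy_entropy_left)
  have right: "g (Inl ` S \<union> Inr ` T) = h (S \<union> T)" if "S \<subseteq> C \<union> D" for S T
    using that by (simp add: g_def h_def copy_entropy_right)
  have full: "g (Inl ` (A \<union> B \<union> C \<union> D) \<union> ?t) = h (A \<union> B \<union> C \<union> D) + h (C \<union> D \<union> A) - h (C \<union> D)"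
    using copy_entropy[OF sub int'] by (simp add: g_def h_def)
  \<comment> \<open>The plain sum of these inequalities is the claim: intermediate terms with the
    copy cancel, and those that remain are evaluated by \<open>full\<close> and
    \<open>right\<close>. The last four repeat the preceding four with \<open>B\<close> in place of
    \<open>A\<close>.\<close>
  have ineqs:
    "g (?a \<union> ?b \<union> ?t) + g (?t) \<le> g (?a \<union> ?t) + g (?b \<union> ?t)"
    "g (?a \<union> ?b \<union> ?c \<union> ?d \<union> ?t) + g (?a \<union> ?b) \<le> g (?a \<union> ?b \<union> ?t) + g (?a \<union> ?b \<union> ?c \<union> ?d)"
    "g (?a \<union> ?b \<union> ?c \<union> ?d \<union> ?t) + g (?a \<union> ?c \<union> ?d) \<le> g (?a \<union> ?c \<union> ?d \<union> ?t) + g (?a \<union> ?b \<union> ?c \<union> ?d)"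
    "g (?a \<union> ?d \<union> ?t) + g (?d) \<le> g (?d \<union> ?t) + g (?a \<union> ?d)"
    "g (?a \<union> ?c \<union> ?t) + g (?c) \<le> g (?c \<union> ?t) + g (?a \<union> ?c)"
    "g (?a \<union> ?c \<union> ?d \<union> ?t) + g (?a \<union> ?t) \<le> g (?a \<union> ?c \<union> ?t) + g (?a \<union> ?d \<union> ?t)"
    "g (?a \<union> ?b \<union> ?c \<union> ?d \<union> ?t) + g (?b \<union> ?c \<union> ?d) \<le> g (?b \<union> ?c \<union> ?d \<union> ?t) + g (?a \<union> ?b \<union> ?c \<union> ?d)"
    "g (?b \<union> ?d \<union> ?t) + g (?d) \<le> g (?d \<union> ?t) + g (?b \<union> ?d)"
    "g (?b \<union> ?c \<union> ?t) + g (?c) \<le> g (?c \<union> ?t) + g (?b \<union> ?c)"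
    "g (?b \<union> ?c \<union> ?d \<union> ?t) + g (?b \<union> ?t) \<le> g (?b \<union> ?c \<union> ?t) + g (?b \<union> ?d \<union> ?t)"
    using
    sm[of "?a \<union> ?t" "?b \<union> ?t" "?t"]
    sm[of "?a \<union> ?b \<union> ?t" "?a \<union> ?b \<union> ?c \<union> ?d" "?a \<union> ?b"]
    sm[of "?a \<union> ?c \<union> ?d \<union> ?t" "?a \<union> ?b \<union> ?c \<union> ?d" "?a \<union> ?c \<union> ?d"]
    sm[of "?d \<union> ?t" "?a \<union> ?d" "?d"]
    sm[of "?c \<union> ?t" "?a \<union> ?c" "?c"]
    sm[of "?a \<union> ?c \<union> ?t" "?a \<union> ?d \<union> ?t" "?a \<union> ?t"]
    sm[of "?b \<union> ?c \<union> ?d \<union> ?t" "?a \<union> ?b \<union> ?c \<union> ?d" "?b \<union> ?c \<union> ?d"]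
    sm[of "?d \<union> ?t" "?b \<union> ?d" "?d"]
    sm[of "?c \<union> ?t" "?b \<union> ?c" "?c"]
    sm[of "?b \<union> ?c \<union> ?t" "?b \<union> ?d \<union> ?t" "?b \<union> ?t"]
    by (simp_all add: Un_ac Un_upper1 Un_upper2 le_supI1 le_supI2)
  note vals = full right[of "C \<union> D" A] right[of C A] right[of D A] right[of "{}" A]
    left[of A] left[of B] left[of C] left[of D] left[of "A \<union> B"] left[of "A \<union> C"] left[of "A \<union> D"] left[of "B \<union> C"]
    left[of "B \<union> D"] left[of "C \<union> D"] left[of "A \<union> C \<union> D"] left[of "B \<union> C \<union> D"] left[of "A \<union> B \<union> C \<union> D"]
  show ?thesis
    using ineqs vals by (simp add: image_Un Un_ac)
qed

section \<open>Transfer to random variables and to limits\<close>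

lemma joint_rv_agree:
  assumes "A \<subseteq> Q"
  shows "joint_rv S Q \<omega> \<in> agree (\<lambda>i y. y i) A (joint_rv S Q \<omega>') \<longleftrightarrow> joint_rv S A \<omega> = joint_rv S A \<omega>'"
  using assms by (auto simp: joint_rv_def agree_def restrict_def fun_eq_iff)

text \<open>The law of the joint variable on \<open>Q\<close> is discrete, so it is a pmf whose
  variables are the coordinate projections. The blocks for \<open>A\<close> correspond to the fibres
  of \<open>joint_rv S A\<close>.\<close>

lemma joint_rv_pmf:
  fixes M :: "'w measure" and S :: "'a \<Rightarrow> 'w \<Rightarrow> 'v"
  assumes M: "prob_space M" and fin: "finite Q" and rv: "\<forall>x\<in>Q. discrete_rv M (S x)"
    and fe: "\<forall>A\<in>Pow Q. has_finite_entropy M (joint_rv S A)"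
  obtains P :: "('a \<Rightarrow> 'v) pmf" where
    "\<And>A. A \<subseteq> Q \<Longrightarrow> integrable_info P (\<lambda>i y. y i) A \<and> shannon_entropy M (joint_rv S A) = pmf_entropy P (\<lambda>i y. y i) A"
proof -
  interpret prob_space M by fact
  interpret information_space M 2 by unfold_locales simp
  let ?Y = "joint_rv S Q"
  have count: "countable (?Y ` space M)"
  proof (rule countable_subset)
    show "?Y ` space M \<subseteq> (\<Pi>\<^sub>E x\<in>Q. S x ` space M)"
      by (auto simp: joint_rv_def)
    show "countable (\<Pi>\<^sub>E x\<in>Q. S x ` space M)"
      using rv fin by (intro countable_PiE) (auto simp: discrete_rv_def)
  qed
  obtain q where "finite_entropy (count_space (?Y ` space M)) ?Y q"
    using fe by (auto simp: has_finite_entropy_def)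
  then have Ym: "?Y \<in> measurable M (count_space (?Y ` space M))"
    using distributed_measurable[OF finite_entropy_distributed] by blast
  have Y: "?Y \<in> measurable M (count_space UNIV)"
  proof (rule measurableI)
    fix B :: "('a \<Rightarrow> 'v) set"
    have "?Y -` B \<inter> space M = ?Y -` (B \<inter> ?Y ` space M) \<inter> space M"
      by auto
    also have "\<dots> \<in> sets M"
      using Ym by (rule measurable_sets) auto
    finally show "?Y -` B \<inter> space M \<in> sets M" .
  qed simp
  define N where "N = distr M (count_space UNIV) ?Y"
  have pmf: "prob_space N \<and> sets N = UNIV \<and> (AE x in N. measure N {x} \<noteq> 0)"
  proof (intro conjI)
    show "prob_space N"
      unfolding N_def using Y by (rule prob_space_distr)
    show "sets N = UNIV"
      by (simp add: N_def)
    \<comment> \<open>There are countably many values, so those of probability zero have a null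
      union. This is what makes the law a pmf.\<close>
    have "AE x in M. x \<notin> (\<Union>y\<in>{y\<in>?Y ` space M. prob (?Y -` {y} \<inter> space M) = 0}. ?Y -` {y} \<inter> space M)"
    proof (intro AE_not_in null_sets_UN')
      show "countable {y \<in> ?Y ` space M. prob (?Y -` {y} \<inter> space M) = 0}"
        using count by (rule countable_subset[rotated]) auto
    qed (use Y in \<open>auto simp: null_sets_def emeasure_eq_measure\<close>)
    then show "AE x in N. measure N {x} \<noteq> 0"
      unfolding N_def using Y by (subst AE_distr_iff) (auto simp: measure_distr elim!: AE_mp)
  qed
  define P where "P = Abs_pmf N"
  have P: "measure_pmf P = N"
    unfolding P_def using pmf by (intro Abs_pmf_inverse) auto
  show ?thesis
  proof (rule that)
    fix A assume A: "A \<subseteq> Q"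
    let ?Z = "joint_rv S A" and ?V = "\<lambda>i (y :: 'a \<Rightarrow> 'v). y i"
    let ?D = "count_space (?Z ` space M)"
    obtain p where p: "finite_entropy ?D ?Z p"
      using fe A by (auto simp: has_finite_entropy_def)
    note dist = finite_entropy_distributed[OF p] and nn = finite_entropy_nn[OF p]
    have Z: "?Z \<in> measurable M ?D"
      using distributed_measurable[OF dist] .
    \<comment> \<open>The density with respect to counting measure is the mass of an atom, that is,
      of a block; this identifies the two notions of entropy.\<close>
    have prob: "agree_prob P ?V A (?Y \<omega>) = p (?Z \<omega>)" if "\<omega> \<in> space M" for \<omega>
    proof -
      have "?Y -` agree ?V A (?Y \<omega>) \<inter> space M = ?Z -` {?Z \<omega>} \<inter> space M"
        using joint_rv_agree[OF A, of S] by auto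
      then have "agree_prob P ?V A (?Y \<omega>) = prob (?Z -` {?Z \<omega>} \<inter> space M)"
        using Y by (simp add: agree_prob_def P N_def measure_distr)
      also have "\<dots> = measure (distr M ?D ?Z) {?Z \<omega>}"
        using Z that by (subst measure_distr) auto
      also have "\<dots> = measure (density ?D p) {?Z \<omega>}"
        by (simp add: distributed_distr_eq_density[OF dist])
      also have "\<dots> = p (?Z \<omega>)"
        using nn that by (simp add: measure_def emeasure_density nn_integral_count_space_indicator nn_integral_indicator_singleton)
      finally show ?thesis .
    qed
    have log_meas: "(\<lambda>y. log 2 (p y)) \<in> borel_measurable ?D"
      by simp
    have "integrable M (\<lambda>\<omega>. log 2 (p (?Z \<omega>)))"
      using finite_entropy_integrable[OF p] distributed_integrable[OF dist log_meas nn] by simp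
    then have int: "integrable M (\<lambda>\<omega>. log 2 (agree_prob P ?V A (?Y \<omega>)))"
      by (simp add: prob cong: Bochner_Integration.integrable_cong)
    have "shannon_entropy M ?Z = - (\<integral>x. p x * log 2 (p x) \<partial>?D)"
      unfolding shannon_entropy_def using entropy_distr[OF dist nn] .
    also have "\<dots> = - (\<integral>\<omega>. log 2 (p (?Z \<omega>)) \<partial>M)"
      using distributed_integral[OF dist log_meas nn] by simp
    also have "\<dots> = - (\<integral>\<omega>. log 2 (agree_prob P ?V A (?Y \<omega>)) \<partial>M)"
      by (intro arg_cong[where f = uminus] Bochner_Integration.integral_cong) (auto simp: prob)
    also have "\<dots> = pmf_entropy P ?V A"
      unfolding pmf_entropy_def P N_def using Y by (subst integral_distr) auto
    finally show "integrable_info P ?V A \<and> shannon_entropy M ?Z = pmf_entropy P ?V A"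
      unfolding integrable_info_def P N_def using Y int by (simp add: integrable_distr_eq)
  qed
qed

lemma entropic_ZY_compliant:
  fixes Q :: "'a set"
  assumes "finite Q" and "h \<in> entropic_vectors TYPE('w) TYPE('v) Q"
  shows "ZY_compliant Q h"
proof -
  obtain M :: "'w measure" and S :: "'a \<Rightarrow> 'w \<Rightarrow> 'v" where
    M: "prob_space M" "\<forall>x\<in>Q. discrete_rv M (S x)" "\<forall>A\<in>Pow Q. has_finite_entropy M (joint_rv S A)"
    and h: "h = (\<lambda>A\<in>Pow Q. shannon_entropy M (joint_rv S A))"
    using assms(2) unfolding entropic_vectors_def by blast
  obtain P :: "('a \<Rightarrow> 'v) pmf" where
    P: "\<And>A. A \<subseteq> Q \<Longrightarrow> integrable_info P (\<lambda>i y. y i) A \<and> shannon_entropy M (joint_rv S A) = pmf_entropy P (\<lambda>i y. y i) A"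
    using joint_rv_pmf[OF M(1) assms(1) M(2,3)] by blast
  have h_eq: "h A = pmf_entropy P (\<lambda>i y. y i) A" if "A \<subseteq> Q" for A
    using that P h by simp
  have "pmf_entropy P (\<lambda>i y. y i) {} = 0"
    by (simp add: pmf_entropy_def agree_prob_def agree_def)
  then show ?thesis
    unfolding ZY_compliant_def info_def cond_info_def
    using zhang_yeung_pmf[of P "\<lambda>i y. y i"] P by (auto simp: h_eq Un_assoc)
qed

text \<open>Each instance is a weak inequality between continuous functions of finitely many
  coordinates.\<close>

lemma closedin_ZY:
  "closedin (product_topology (\<lambda>_. euclideanreal) (Pow Q))
     {h \<in> topspace (product_topology (\<lambda>_. euclideanreal) (Pow Q)). ZY_compliant Q h}"
proof -
  let ?T = "product_topology (\<lambda>_. euclideanreal) (Pow Q)"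
  let ?g = "\<lambda>A1 A2 A3 A4 h. info h A1 A4 + info h A1 (A2 \<union> A3) + 3 * cond_info h A2 A3 A1 + cond_info h A2 A3 A4 - 2 * info h A2 A3"
  have proj: "continuous_map ?T euclideanreal (\<lambda>h. h A)" if "A \<subseteq> Q" for A
    using that by (intro continuous_map_product_projection) auto
  have cont: "continuous_map ?T euclideanreal (?g A1 A2 A3 A4)"
    if "A1 \<subseteq> Q" "A2 \<subseteq> Q" "A3 \<subseteq> Q" "A4 \<subseteq> Q" for A1 A2 A3 A4
    unfolding info_def cond_info_def
    using that by (intro continuous_intros proj) auto
  have "closedin ?T (topspace ?T \<inter> (\<Inter>(A1, A2, A3, A4) \<in> Pow Q \<times> Pow Q \<times> Pow Q \<times> Pow Q.
      {h \<in> topspace ?T. ?g A1 A2 A3 A4 h \<in> {0..}}))"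
  proof (intro closedin_Int closedin_topspace closedin_INT)
    fix a assume "a \<in> Pow Q \<times> Pow Q \<times> Pow Q \<times> Pow Q"
    then obtain A1 A2 A3 A4 where a: "a = (A1, A2, A3, A4)" "A1 \<subseteq> Q" "A2 \<subseteq> Q" "A3 \<subseteq> Q" "A4 \<subseteq> Q"
      by auto
    show "closedin ?T (case a of (A1, A2, A3, A4) \<Rightarrow> {h \<in> topspace ?T. ?g A1 A2 A3 A4 h \<in> {0..}})"
      unfolding a(1) prod.case
      by (rule closedin_continuous_map_preimage[OF cont]) (use a in auto)
  qed auto
  also have "topspace ?T \<inter> (\<Inter>(A1, A2, A3, A4) \<in> Pow Q \<times> Pow Q \<times> Pow Q \<times> Pow Q.
      {h \<in> topspace ?T. ?g A1 A2 A3 A4 h \<in> {0..}}) = {h \<in> topspace ?T. ZY_compliant Q h}"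
    unfolding ZY_compliant_def by auto
  finally show ?thesis .
qed

lemma ZY_compliant_restrict: "ZY_compliant Q (restrict f (Pow Q)) \<longleftrightarrow> ZY_compliant Q f"
proof -
  have "info (restrict f (Pow Q)) A B = info f A B" "cond_info (restrict f (Pow Q)) A B C = cond_info f A B C"
    if "A \<subseteq> Q" "B \<subseteq> Q" "C \<subseteq> Q" for A B C
    using that by (auto simp: info_def cond_info_def)
  then show ?thesis
    unfolding ZY_compliant_def by (intro iff_allI imp_cong refl) (auto simp: le_sup_iff)
qed

theorem almost_entropic_ZY_compliant:
  assumes "finite Q" and "almost_entropic TYPE('w) TYPE('v) Q f"
  shows "ZY_compliant Q f"
proof -
  let ?T = "product_topology (\<lambda>_. euclideanreal) (Pow Q)"
  have "entropic_vectors TYPE('w) TYPE('v) Q \<subseteq> {h \<in> topspace ?T. ZY_compliant Q h}"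
  proof
    fix h assume h: "h \<in> entropic_vectors TYPE('w) TYPE('v) Q"
    then have "h \<in> topspace ?T"
      unfolding entropic_vectors_def topspace_product_topology by (auto simp: PiE_def intro: restrict_extensional)
    then show "h \<in> {h \<in> topspace ?T. ZY_compliant Q h}"
      using entropic_ZY_compliant[OF assms(1) h] by blast
  qed
  then have "?T closure_of entropic_vectors TYPE('w) TYPE('v) Q \<subseteq> {h \<in> topspace ?T. ZY_compliant Q h}"
    by (rule closure_of_minimal[OF _ closedin_ZY])
  then show ?thesis
    using assms(2) by (auto simp: almost_entropic_def ZY_compliant_restrict)
qed

section \<open>Algebraic extensions\<close>

context field
begin

lemma subfield_inv:
  assumes "subfield k R" "x \<in> k" "x \<noteq> \<zero>"
  shows "inv x \<in> k"
  using assms subfield_m_inv(1) by blast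

text \<open>The coefficients of one equation for \<open>x\<close> generate a finite extension of
  \<open>k\<close>; \<open>x\<close> is finite over it, and finiteness passes through
  towers.\<close>

lemma algebraic_trans:
  assumes "subfield k R" "x \<in> carrier R"
    and "(algebraic over {y \<in> carrier R. (algebraic over k) y}) x"
  shows "(algebraic over k) x"
proof -
  let ?M = "{y \<in> carrier R. (algebraic over k) y}"
  have M: "subfield ?M R"
    using subfield_of_algebraics[OF assms(1)] .
  obtain p where p: "p \<in> carrier (?M[X])" "p \<noteq> []" "eval p x = \<zero>"
    using algebraicE[OF subfieldE(1)[OF M] assms(2,3)] by blast
  then have pol: "polynomial ?M p"
    by (simp add: univ_poly_carrier)
  then have setp: "set p \<subseteq> ?M"
    by (rule polynomial_incl)
  let ?K = "finite_extension k p"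
  have sc: "set p \<subseteq> carrier R" and alg: "\<And>y. y \<in> set p \<Longrightarrow> (algebraic over k) y"
    using setp by auto
  have K: "subfield ?K R" and dimK: "finite_dimension k ?K"
    using finite_extension_is_subfield[OF assms(1) sc alg] finite_extension_finite_dimension(1)[OF assms(1) sc alg] by auto
  have "set p \<subseteq> ?K"
    using finite_extension_mem[OF subfieldE(1)[OF assms(1)] sc] .
  then have "p \<in> carrier (?K[X])"
    using pol by (auto simp: polynomial_def simp flip: univ_poly_carrier)
  then have alg': "(algebraic over ?K) x"
    using p by (intro algebraicI) auto
  then have "finite_dimension ?K (simple_extension ?K x)"
    using finite_dimension_simple_extension[OF K assms(2)] by blast
  then have "finite_dimension k (simple_extension ?K x)"
    using telescopic_base_dim(1)[OF assms(1) K dimK] by blast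
  then show ?thesis
    using finite_dimension_imp_algebraic[OF assms(1) simple_extension_is_subring[OF subfieldE(1)[OF K] assms(2)]]
      simple_extension_mem[OF subfieldE(1)[OF K] assms(2)] by blast
qed

text \<open>Elements of k[X] are coefficient lists with non-zero head. The computations below
  produce lists with leading zeros; stripping these leaves something as soon as one entry is
  non-zero.\<close>

lemma algebraic_of_list:
  assumes "subring k R" "set r \<subseteq> k" "x \<in> carrier R" "eval r x = \<zero>" "\<exists>c\<in>set r. c \<noteq> \<zero>"
  shows "(algebraic over k) x"
proof (rule algebraicI)
  show "normalize r \<in> carrier (k[X])"
    using normalize_gives_polynomial[OF assms(2)] by (simp add: univ_poly_carrier)
  have "set r \<subseteq> carrier R"
    using assms(2) subringE(1)[OF assms(1)] by blast
  then show "eval (normalize r) x = \<zero>"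
    using assms(3,4) eval_normalize by simp
  show "normalize r \<noteq> []"
  proof
    assume "normalize r = []"
    then have "r = replicate (length r) \<zero>"
      using normalize_trick[of r] by simp
    then show False
      using assms(5) by (metis in_set_replicate)
  qed
qed

section \<open>Algebraic closure\<close>

text \<open>The relative algebraic closure inside \<open>R\<close>, where \<open>R\<close> is an
  arbitrary field.\<close>

definition acl :: "'a set \<Rightarrow> 'a set" where
  "acl H = {x \<in> carrier R. (algebraic over generate_field R H) x}"

lemma acl_subfield: "H \<subseteq> carrier R \<Longrightarrow> subfield (acl H) R"
  unfolding acl_def by (intro subfield_of_algebraics generate_field_is_subfield)

lemma acl_carrier: "acl H \<subseteq> carrier R"
  by (auto simp: acl_def)

lemma generate_subset_acl: "H \<subseteq> carrier R \<Longrightarrow> generate_field R H \<subseteq> acl H"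
  using algebraic_self[OF subfieldE(1)[OF generate_field_is_subfield]] generate_field_incl
  unfolding acl_def by blast

lemma subset_acl: "H \<subseteq> carrier R \<Longrightarrow> H \<subseteq> acl H"
  using generate_subset_acl generate_fieldE(2) by blast

lemma acl_mono:
  assumes "H \<subseteq> H'" "H' \<subseteq> carrier R"
  shows "acl H \<subseteq> acl H'"
  using algebraic_mono[OF mono_generate_field[OF assms]] by (auto simp: acl_def)

lemma acl_closed:
  assumes "H \<subseteq> carrier R" "x \<in> carrier R" "(algebraic over acl H) x"
  shows "x \<in> acl H"
  using algebraic_trans[OF generate_field_is_subfield[OF assms(1)] assms(2)] assms(2,3)
  by (simp add: acl_def)

lemma acl_idem:
  assumes "H \<subseteq> carrier R"
  shows "acl (acl H) = acl H"
proof
  have "generate_field R (acl H) = acl H"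
    using generate_field_min_subfield1[OF acl_carrier acl_subfield[OF assms] order_refl]
      generate_fieldE(2)[OF acl_carrier refl] by (rule equalityI)
  then show "acl (acl H) \<subseteq> acl H"
    using acl_closed[OF assms] acl_def[of "acl H"] by auto
qed (rule subset_acl[OF acl_carrier])

lemma acl_least:
  assumes "H \<subseteq> acl H'" "H' \<subseteq> carrier R"
  shows "acl H \<subseteq> acl H'"
  using acl_mono[OF assms(1) acl_carrier] acl_idem[OF assms(2)] by simp

section \<open>Clearing denominators\<close>

lemma eval_smult:
  assumes "s \<in> carrier R" "set p \<subseteq> carrier R" "x \<in> carrier R"
  shows "eval (map (\<lambda>a. s \<otimes> a) p) x = s \<otimes> eval p x"
  using assms(2)
proof (induction p)
  case (Cons a p)
  then show ?case
    using assms(1,3) eval_in_carrier[of p x] by (simp add: r_distr m_assoc)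
qed (simp add: assms)

lemma fractions_subfield:
  assumes "subring S R"
  shows "subfield {x \<in> carrier R. \<exists>s\<in>S. s \<noteq> \<zero> \<and> s \<otimes> x \<in> S} R" (is "subfield ?F R")
proof (rule subfieldI')
  note S = subringE[OF assms]
  show "subring ?F R"
  proof (rule subringI)
    fix x y assume "x \<in> ?F" "y \<in> ?F"
    then obtain s t where s: "s \<in> S" "s \<noteq> \<zero>" "s \<otimes> x \<in> S" and t: "t \<in> S" "t \<noteq> \<zero>" "t \<otimes> y \<in> S"
      and xy: "x \<in> carrier R" "y \<in> carrier R"
      by auto
    have c: "s \<in> carrier R" "t \<in> carrier R"
      using s t S(1) by auto
    have st: "s \<otimes> t \<in> S" "s \<otimes> t \<noteq> \<zero>"
      using s t S c by (auto simp: integral_iff)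
    have "(s \<otimes> t) \<otimes> (x \<otimes> y) = (s \<otimes> x) \<otimes> (t \<otimes> y)" "(s \<otimes> t) \<otimes> (x \<oplus> y) = t \<otimes> (s \<otimes> x) \<oplus> s \<otimes> (t \<otimes> y)"
      using c xy by algebra+
    then have "(s \<otimes> t) \<otimes> (x \<otimes> y) \<in> S" "(s \<otimes> t) \<otimes> (x \<oplus> y) \<in> S"
      using s t S by simp_all
    then show "x \<otimes> y \<in> ?F" "x \<oplus> y \<in> ?F"
      using st xy by blast+
  next
    fix x assume "x \<in> ?F"
    then obtain s where s: "s \<in> S" "s \<noteq> \<zero>" "s \<otimes> x \<in> S" and x: "x \<in> carrier R"
      by auto
    have "s \<otimes> \<ominus> x = \<ominus> (s \<otimes> x)"
      using s x S(1) r_minus by auto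
    then show "\<ominus> x \<in> ?F"
      using s x S(5) by auto
  next
    show "\<one> \<in> ?F"
      using S(3) by force
  qed auto
  fix x assume "x \<in> ?F - {\<zero>}"
  then obtain s where s: "s \<in> S" "s \<noteq> \<zero>" "s \<otimes> x \<in> S" and x: "x \<in> carrier R" "x \<noteq> \<zero>"
    by auto
  have c: "s \<in> carrier R" and xu: "x \<in> Units R"
    using s S(1) x by (auto simp: field_Units)
  have "(s \<otimes> x) \<otimes> inv x = s"
    using c xu x by (simp add: m_assoc)
  moreover have "s \<otimes> x \<noteq> \<zero>"
    using c x s by (simp add: integral_iff)
  ultimately show "inv x \<in> ?F"
    using s xu by auto
qed

lemma generate_field_fractions:
  assumes "subring S R" "H \<subseteq> S" "x \<in> generate_field R H"
  shows "\<exists>s\<in>S. s \<noteq> \<zero> \<and> s \<otimes> x \<in> S"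
proof -
  have "H \<subseteq> {x \<in> carrier R. \<exists>s\<in>S. s \<noteq> \<zero> \<and> s \<otimes> x \<in> S}"
  proof
    fix y assume "y \<in> H"
    then have y: "y \<in> carrier R" "y \<in> S"
      using assms(2) subringE(1)[OF assms(1)] by auto
    then have "\<one> \<otimes> y \<in> S"
      by simp
    then show "y \<in> {x \<in> carrier R. \<exists>s\<in>S. s \<noteq> \<zero> \<and> s \<otimes> x \<in> S}"
      using subringE(3)[OF assms(1)] y by force
  qed
  moreover have "H \<subseteq> carrier R"
    using assms(2) subringE(1)[OF assms(1)] by blast
  ultimately have "generate_field R H \<subseteq> {x \<in> carrier R. \<exists>s\<in>S. s \<noteq> \<zero> \<and> s \<otimes> x \<in> S}"
    using generate_field_min_subfield1[OF _ fractions_subfield[OF assms(1)]] by blast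
  then show ?thesis
    using assms(3) by blast
qed

text \<open>Replaces coefficients in a field of fractions by coefficients in the ring: below,
  \<open>S\<close> is k[e] or the ring generated over a base field by all but one element of a
  transcendence basis.\<close>

lemma algebraic_clear_denominators:
  assumes S: "subring S R" "H \<subseteq> S" and u: "u \<in> carrier R" "(algebraic over generate_field R H) u"
  obtains c where "set c \<subseteq> S" "\<exists>x\<in>set c. x \<noteq> \<zero>" "eval c u = \<zero>"
proof -
  let ?E = "generate_field R H"
  note SE = subringE[OF S(1)]
  have H: "H \<subseteq> carrier R"
    using S SE(1) by blast
  have E: "subfield ?E R"
    by (rule generate_field_is_subfield[OF H])
  have common: "\<exists>s\<in>S. s \<noteq> \<zero> \<and> (\<forall>x\<in>set p. s \<otimes> x \<in> S)" if "set p \<subseteq> ?E" for p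
    using that
  proof (induction p)
    case Nil
    then show ?case
      using SE(3) by force
  next
    case (Cons a p)
    then obtain s t where s: "s \<in> S" "s \<noteq> \<zero>" "\<forall>x\<in>set p. s \<otimes> x \<in> S" and t: "t \<in> S" "t \<noteq> \<zero>" "t \<otimes> a \<in> S"
      using generate_field_fractions[OF S, of a] by auto
    have c: "s \<in> carrier R" "t \<in> carrier R" "a \<in> carrier R"
      using s t SE(1) Cons.prems subfieldE(3)[OF E] by auto
    have "(s \<otimes> t) \<otimes> x \<in> S" if x: "x \<in> set (a # p)" for x
    proof (cases "x = a")
      case True
      then show ?thesis
        using s t SE(6) c by (simp add: m_assoc)
    next
      case False
      then have "s \<otimes> x \<in> S" "x \<in> carrier R"
        using x s(3) Cons.prems subfieldE(3)[OF E] by auto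
      moreover have "(s \<otimes> t) \<otimes> x = t \<otimes> (s \<otimes> x)"
        using calculation c by algebra
      ultimately show ?thesis
        using SE(6)[OF t(1)] by simp
    qed
    moreover have "s \<otimes> t \<in> S" "s \<otimes> t \<noteq> \<zero>"
      using s t SE(6) c by (auto simp: integral_iff)
    ultimately show ?case
      by blast
  qed
  obtain p where p: "p \<in> carrier (?E[X])" "p \<noteq> []" "eval p u = \<zero>"
    using algebraicE[OF subfieldE(1)[OF E] u] by blast
  have setp: "set p \<subseteq> ?E" and hd: "hd p \<noteq> \<zero>"
    using p by (auto simp: polynomial_def simp flip: univ_poly_carrier)
  then obtain s where s: "s \<in> S" "s \<noteq> \<zero>" "\<forall>x\<in>set p. s \<otimes> x \<in> S"
    using common by blast
  have pc: "set p \<subseteq> carrier R" "s \<in> carrier R" "hd p \<in> carrier R"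
    using setp subfieldE(3)[OF E] s(1) SE(1) p(2) hd_in_set[of p] by blast+
  show ?thesis
  proof (rule that)
    show "set (map (\<lambda>a. s \<otimes> a) p) \<subseteq> S"
      using s(3) by auto
    show "eval (map (\<lambda>a. s \<otimes> a) p) u = \<zero>"
      using eval_smult[OF pc(2,1) u(1)] p(3) pc(2) by simp
    show "\<exists>x\<in>set (map (\<lambda>a. s \<otimes> a) p). x \<noteq> \<zero>"
      using hd s(2) pc hd_in_set[OF p(2)] by (auto simp: integral_iff intro: bexI[of _ "hd p"])
  qed
qed

section \<open>Leading coefficients of fractions\<close>

text \<open>For \<open>e\<close> transcendental over \<open>L\<close>, the fractions \<open>g(e)/h(e)\<close> with \<open>deg g < deg h\<close> form the maximal
  ideal of the valuation ring of \<open>L(e)\<close> at infinity.\<close>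

definition proper_fracs :: "'a set \<Rightarrow> 'a \<Rightarrow> 'a set" where
  "proper_fracs L e = {x \<in> carrier R. \<exists>g\<in>carrier (L[X]). \<exists>h\<in>carrier (L[X]).
     length g < length h \<and> x \<otimes> eval h e = eval g e}"

context
  fixes L e
  assumes L: "subfield L R" and e: "e \<in> carrier R" and transc: "(transcendental over L) e"
begin

lemma Lc: "L \<subseteq> carrier R"
  using subfieldE(3)[OF L] .

lemma poly_carrier: "p \<in> carrier (L[X]) \<Longrightarrow> set p \<subseteq> carrier R"
  using polynomial_in_carrier[OF subfieldE(1)[OF L]] by (simp add: univ_poly_carrier)

lemma eval_e_closed: "p \<in> carrier (L[X]) \<Longrightarrow> eval p e \<in> carrier R"
  using eval_in_carrier[OF poly_carrier e] .

lemma eval_e_nonzero: "p \<in> carrier (L[X]) \<Longrightarrow> p \<noteq> [] \<Longrightarrow> eval p e \<noteq> \<zero>"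
  using eval_transcendental[OF transc] by blast

lemma eval_e_inj: "p \<in> carrier (L[X]) \<Longrightarrow> q \<in> carrier (L[X]) \<Longrightarrow> eval p e = eval q e \<Longrightarrow> p = q"
  using transc by (auto simp: over_def transcendental_def inj_on_def)

lemma e_nonzero: "e \<noteq> \<zero>"
  using zero_is_algebraic[OF subfieldE(1)[OF L]] transc by (auto simp: over_def)

lemma e_pow_nonzero: "e [^] (n::nat) \<noteq> \<zero>"
  using e_nonzero e by (induction n) (auto simp: integral_iff)

lemma mult_polys:
  assumes "p \<in> carrier (L[X])" "q \<in> carrier (L[X])"
  shows "poly_mult p q \<in> carrier (L[X])" "eval (poly_mult p q) e = eval p e \<otimes> eval q e"
    "p \<noteq> [] \<Longrightarrow> q \<noteq> [] \<Longrightarrow> length (poly_mult p q) = length p + length q - 1"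
proof -
  have pol: "polynomial L p" "polynomial L q"
    using assms by (simp_all add: univ_poly_carrier)
  show "poly_mult p q \<in> carrier (L[X])"
    using poly_mult_closed[OF subfieldE(1)[OF L] pol] by (simp add: univ_poly_carrier)
  show "eval (poly_mult p q) e = eval p e \<otimes> eval q e"
    using eval_poly_mult[OF poly_carrier poly_carrier e] assms by blast
  assume ne: "p \<noteq> []" "q \<noteq> []"
  then have "poly_mult p q \<noteq> []"
    using poly_mult_integral[OF subfieldE(1)[OF L] pol] by blast
  moreover have "length p > 0" "length q > 0" "length (poly_mult p q) > 0"
    using ne calculation by auto
  moreover have "length (poly_mult p q) - 1 = (length p - 1) + (length q - 1)"
    using poly_mult_degree_eq[OF subfieldE(1)[OF L] pol] ne by simp
  ultimately show "length (poly_mult p q) = length p + length q - 1"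
    by linarith
qed

lemma proper_fracs_add:
  assumes "x \<in> proper_fracs L e" "y \<in> proper_fracs L e"
  shows "x \<oplus> y \<in> proper_fracs L e"
proof -
  obtain g h where g: "g \<in> carrier (L[X])" "h \<in> carrier (L[X])" "length g < length h" "x \<otimes> eval h e = eval g e"
    using assms(1) by (auto simp: proper_fracs_def)
  obtain g' h' where g': "g' \<in> carrier (L[X])" "h' \<in> carrier (L[X])" "length g' < length h'" "y \<otimes> eval h' e = eval g' e"
    using assms(2) by (auto simp: proper_fracs_def)
  have xy: "x \<in> carrier R" "y \<in> carrier R"
    using assms by (auto simp: proper_fracs_def)
  note ev = g(1,2)[THEN eval_e_closed] g'(1,2)[THEN eval_e_closed]
  let ?g = "poly_add (poly_mult g h') (poly_mult g' h)" and ?h = "poly_mult h h'"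
  note m = mult_polys[OF g(1) g'(2)] mult_polys[OF g'(1) g(2)] mult_polys[OF g(2) g'(2)]
  have ne: "h \<noteq> []" "h' \<noteq> []" "length h \<ge> 1" "length h' \<ge> 1"
    using g(3) g'(3) by auto
  then have len: "length ?h = length h + length h' - 1"
    using m(9) by blast
  have "length (poly_mult g h') < length ?h"
    using m(3) len g(3) ne(3,4) ne(1,2) by (cases "g = []") (auto simp: less_diff_conv)
  moreover have "length (poly_mult g' h) < length ?h"
    using m(6) len g'(3) ne by (cases "g' = []") (auto simp: less_diff_conv)
  ultimately have "length ?g < length ?h"
    using poly_add_length_le[of "poly_mult g h'" "poly_mult g' h"] by linarith
  moreover have "?g \<in> carrier (L[X])"
    using poly_add_closed[OF subfieldE(1)[OF L]] m(1,4) by (simp flip: univ_poly_carrier)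
  moreover have "(x \<oplus> y) \<otimes> eval ?h e = eval ?g e"
  proof -
    have "eval ?g e = eval g e \<otimes> eval h' e \<oplus> eval g' e \<otimes> eval h e"
      using eval_poly_add[OF poly_carrier[OF m(1)] poly_carrier[OF m(4)] e] m(2,5) by simp
    also have "\<dots> = (x \<oplus> y) \<otimes> (eval h e \<otimes> eval h' e)"
      using ev xy unfolding g(4)[symmetric] g'(4)[symmetric] by algebra
    finally show ?thesis
      using m(8) by simp
  qed
  ultimately show ?thesis
    using m(7) xy unfolding proper_fracs_def by blast
qed

lemma proper_fracs_mult:
  assumes "x \<in> proper_fracs L e" "y \<in> proper_fracs L e"
  shows "x \<otimes> y \<in> proper_fracs L e"
proof -
  obtain g h where g: "g \<in> carrier (L[X])" "h \<in> carrier (L[X])" "length g < length h" "x \<otimes> eval h e = eval g e"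
    using assms(1) by (auto simp: proper_fracs_def)
  obtain g' h' where g': "g' \<in> carrier (L[X])" "h' \<in> carrier (L[X])" "length g' < length h'" "y \<otimes> eval h' e = eval g' e"
    using assms(2) by (auto simp: proper_fracs_def)
  have xy: "x \<in> carrier R" "y \<in> carrier R"
    using assms by (auto simp: proper_fracs_def)
  note ev = g(1,2)[THEN eval_e_closed] g'(1,2)[THEN eval_e_closed]
  note m = mult_polys[OF g(1) g'(1)] mult_polys[OF g(2) g'(2)]
  have ne: "h \<noteq> []" "h' \<noteq> []" "length h \<ge> 1" "length h' \<ge> 1"
    using g(3) g'(3) by auto
  have len: "length (poly_mult h h') = length h + length h' - 1"
    using m(6) ne by blast
  have "length (poly_mult g g') < length (poly_mult h h')"
  proof (cases "g = [] \<or> g' = []")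
    case True
    then have "poly_mult g g' = []"
      using poly_mult_zero[OF poly_carrier[OF g(1)]] poly_mult_zero[OF poly_carrier[OF g'(1)]] by auto
    then show ?thesis
      using len ne by (simp add: less_diff_conv)
  next
    case False
    then show ?thesis
      using m(3) len g(3) g'(3) ne by (simp add: less_diff_conv)
  qed
  moreover have "(x \<otimes> y) \<otimes> eval (poly_mult h h') e = eval (poly_mult g g') e"
    unfolding m(2,5) using ev xy unfolding g(4)[symmetric] g'(4)[symmetric] by algebra
  ultimately show ?thesis
    using m(1,4) xy unfolding proper_fracs_def by blast
qed

lemma proper_fracs_smult:
  assumes "l \<in> L" "x \<in> proper_fracs L e"
  shows "l \<otimes> x \<in> proper_fracs L e"
proof -
  obtain g h where g: "g \<in> carrier (L[X])" "h \<in> carrier (L[X])" "length g < length h" "x \<otimes> eval h e = eval g e"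
    using assms(2) by (auto simp: proper_fracs_def)
  have xl: "x \<in> carrier R" "l \<in> carrier R"
    using assms Lc by (auto simp: proper_fracs_def)
  let ?g = "normalize (map (\<lambda>b. l \<otimes> b) g)"
  have "?g = poly_mult [l] g"
    using poly_mult_const'[OF poly_carrier[OF g(1)] xl(2)] by simp
  then have ev: "eval ?g e = l \<otimes> eval g e"
    using eval_poly_mult[of "[l]" g e] poly_carrier[OF g(1)] xl(2) e by simp
  have "set (map (\<lambda>b. l \<otimes> b) g) \<subseteq> L"
    using g(1) assms(1) subringE(6)[OF subfieldE(1)[OF L]] polynomial_incl[of L g]
    by (auto simp flip: univ_poly_carrier)
  then have "?g \<in> carrier (L[X])"
    using normalize_gives_polynomial by (simp flip: univ_poly_carrier)
  moreover have "length ?g < length h"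
    using normalize_length_le[of "map (\<lambda>b. l \<otimes> b) g"] g(3) by simp
  moreover have "(l \<otimes> x) \<otimes> eval h e = eval ?g e"
    using ev g(4) xl eval_e_closed[OF g(2)] by (simp add: m_assoc)
  ultimately show ?thesis
    using g(2) xl unfolding proper_fracs_def by blast
qed

lemma proper_fracs_zero: "\<zero> \<in> proper_fracs L e"
proof -
  have "[\<one>] \<in> carrier (L[X])" "[] \<in> carrier (L[X])"
    using subringE(3)[OF subfieldE(1)[OF L]] by (auto simp: polynomial_def simp flip: univ_poly_carrier)
  moreover have "\<zero> \<otimes> eval [\<one>] e = eval [] e"
    by (simp add: e)
  ultimately show ?thesis
    unfolding proper_fracs_def by (intro CollectI conjI zero_closed bexI[of _ "[]"] bexI[of _ "[\<one>]"]) auto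
qed

lemma monom_poly: "monom \<one> n \<in> carrier (L[X])" "eval (monom \<one> n) e = e [^] n" "length (monom \<one> n) = Suc n"
  using monom_is_polynomial[OF subfieldE(1)[OF L], of \<one> n] subringE(3)[OF subfieldE(1)[OF L]] eval_monom[OF one_closed e] e
  by (auto simp: monom_def simp flip: univ_poly_carrier)

text \<open>Length at most \<open>n\<close> means degree below \<open>n\<close>, so division by
  \<open>e [^] n\<close> gives a proper fraction.\<close>

lemma proper_fracsI_pow:
  assumes "set p \<subseteq> L" "length p \<le> n"
  shows "inv (e [^] n) \<otimes> eval p e \<in> proper_fracs L e"
proof -
  have pc: "set p \<subseteq> carrier R"
    using assms(1) Lc by blast
  have en: "e [^] n \<in> Units R" "e [^] n \<in> carrier R"
    using e_pow_nonzero e by (auto simp: field_Units)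
  have "(inv (e [^] n) \<otimes> eval p e) \<otimes> eval (monom \<one> n) e = eval (normalize p) e"
    unfolding monom_poly eval_normalize[OF pc e]
    using en eval_in_carrier[OF pc e]
    by (metis Units_inv_closed Units_l_inv m_assoc m_comm r_one)
  moreover have "length (normalize p) < length (monom \<one> n)"
    using normalize_length_le[of p] assms(2) by (simp add: monom_poly)
  moreover have "normalize p \<in> carrier (L[X])"
    using normalize_gives_polynomial[OF assms(1)] by (simp add: univ_poly_carrier)
  ultimately show ?thesis
    using monom_poly(1) en eval_in_carrier[OF pc e] unfolding proper_fracs_def by auto
qed

text \<open>Transcendence of \<open>e\<close> turns x h(e) = g(e) into an identity of polynomials,
  and a non-zero constant factor preserves the degree.\<close>

lemma proper_fracs_inter: "x \<in> L \<Longrightarrow> x \<in> proper_fracs L e \<Longrightarrow> x = \<zero>"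
proof (rule ccontr)
  assume x: "x \<in> L" "x \<in> proper_fracs L e" "x \<noteq> \<zero>"
  obtain g h where g: "g \<in> carrier (L[X])" "h \<in> carrier (L[X])" "length g < length h" "x \<otimes> eval h e = eval g e"
    using x(2) by (auto simp: proper_fracs_def)
  have c: "[x] \<in> carrier (L[X])"
    using x by (auto simp: polynomial_def simp flip: univ_poly_carrier)
  have "eval (poly_mult [x] h) e = eval g e"
    using mult_polys(2)[OF c g(2)] g(4) x(1) Lc e by auto
  then have "poly_mult [x] h = g"
    using eval_e_inj mult_polys(1)[OF c g(2)] g(1) by blast
  then show False
    using mult_polys(3)[OF c g(2)] g(3) by (cases "h = []") (simp_all del: poly_mult.simps)
qed

text \<open>\<open>l\<close> is the residue at infinity of x divided by \<open>e [^] n\<close>. It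
  may be zero, so \<open>n\<close> is only a bound on the degree; sums with cancellation are then
  covered.\<close>

definition lead_form :: "'a \<Rightarrow> nat \<Rightarrow> 'a \<Rightarrow> bool" where
  "lead_form x n l \<longleftrightarrow> l \<in> L \<and> (\<exists>m\<in>proper_fracs L e. x = e [^] n \<otimes> (l \<oplus> m))"

lemma proper_fracs_carrier: "m \<in> proper_fracs L e \<Longrightarrow> m \<in> carrier R"
  by (simp add: proper_fracs_def)

lemma lead_form_poly:
  assumes "set p \<subseteq> L" "a \<in> L"
  shows "lead_form (eval (a # p) e) (length p) a"
  unfolding lead_form_def
proof (intro conjI bexI assms(2))
  let ?m = "inv (e [^] length p) \<otimes> eval p e"
  show "?m \<in> proper_fracs L e"
    by (rule proper_fracsI_pow[OF assms(1) order_refl])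
  have c: "a \<in> carrier R" "eval p e \<in> carrier R" "e [^] length p \<in> Units R" "e [^] length p \<in> carrier R"
    using assms Lc e e_pow_nonzero eval_in_carrier[of p e] by (auto simp: field_Units)
  have "e [^] length p \<otimes> (a \<oplus> ?m) = a \<otimes> e [^] length p \<oplus> (e [^] length p \<otimes> inv (e [^] length p)) \<otimes> eval p e"
    using c(1,2,4) Units_inv_closed[OF c(3)] by algebra
  then show "eval (a # p) e = e [^] length p \<otimes> (a \<oplus> ?m)"
    using c by simp
qed

lemma lead_form_add:
  assumes "lead_form x n l" "lead_form y n l'"
  shows "lead_form (x \<oplus> y) n (l \<oplus> l')"
proof -
  obtain m m' where m: "m \<in> proper_fracs L e" "x = e [^] n \<otimes> (l \<oplus> m)" "m' \<in> proper_fracs L e" "y = e [^] n \<otimes> (l' \<oplus> m')"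
      and l: "l \<in> L" "l' \<in> L"
    using assms by (auto simp: lead_form_def)
  have c: "l \<in> carrier R" "l' \<in> carrier R" "m \<in> carrier R" "m' \<in> carrier R" "e [^] n \<in> carrier R"
    using l Lc m proper_fracs_carrier e by auto
  have "x \<oplus> y = e [^] n \<otimes> ((l \<oplus> l') \<oplus> (m \<oplus> m'))"
    unfolding m(2,4) using c by algebra
  then show ?thesis
    using proper_fracs_add[OF m(1,3)] l subringE(7)[OF subfieldE(1)[OF L]] unfolding lead_form_def by blast
qed

lemma lead_form_mult:
  assumes "lead_form x n l" "lead_form y n' l'"
  shows "lead_form (x \<otimes> y) (n + n') (l \<otimes> l')"
proof -
  obtain m m' where m: "m \<in> proper_fracs L e" "x = e [^] n \<otimes> (l \<oplus> m)" "m' \<in> proper_fracs L e" "y = e [^] n' \<otimes> (l' \<oplus> m')"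
      and l: "l \<in> L" "l' \<in> L"
    using assms by (auto simp: lead_form_def)
  have c: "l \<in> carrier R" "l' \<in> carrier R" "m \<in> carrier R" "m' \<in> carrier R" "e [^] n \<in> carrier R" "e [^] n' \<in> carrier R"
    using l Lc m proper_fracs_carrier e by auto
  have "x \<otimes> y = (e [^] n \<otimes> e [^] n') \<otimes> ((l \<otimes> l') \<oplus> (l \<otimes> m' \<oplus> (l' \<otimes> m \<oplus> m \<otimes> m')))"
    unfolding m(2,4) using c by algebra
  moreover have "l \<otimes> m' \<oplus> (l' \<otimes> m \<oplus> m \<otimes> m') \<in> proper_fracs L e"
    using m l by (intro proper_fracs_add proper_fracs_smult proper_fracs_mult)
  ultimately show ?thesis
    using l subringE(6)[OF subfieldE(1)[OF L]] e unfolding lead_form_def by (auto simp: nat_pow_mult)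
qed

text \<open>Brings terms of different degrees to a common exponent, so that they can be
  added.\<close>

lemma lead_form_raise:
  assumes "lead_form x n l" "n < n'"
  shows "lead_form x n' \<zero>"
proof -
  obtain m where m: "m \<in> proper_fracs L e" "x = e [^] n \<otimes> (l \<oplus> m)" and l: "l \<in> L"
    using assms by (auto simp: lead_form_def)
  define i where "i = inv (e [^] (n' - n)) \<otimes> eval [\<one>] e"
  have i: "i \<in> proper_fracs L e"
    unfolding i_def using subringE(3)[OF subfieldE(1)[OF L]] assms(2) by (intro proper_fracsI_pow) auto
  have c: "l \<in> carrier R" "m \<in> carrier R" "e [^] n \<in> carrier R" "e [^] (n' - n) \<in> carrier R" "i \<in> carrier R"
    using l Lc m i proper_fracs_carrier e by auto
  have "e [^] (n' - n) \<in> Units R"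
    using e_pow_nonzero c by (simp add: field_Units)
  then have ei: "e [^] (n' - n) \<otimes> i = \<one>"
    using e by (simp add: i_def)
  have en: "e [^] n' = e [^] n \<otimes> e [^] (n' - n)"
    using e assms(2) by (simp add: nat_pow_mult)
  have "e [^] n' \<otimes> (\<zero> \<oplus> (l \<otimes> i \<oplus> m \<otimes> i)) = (e [^] n \<otimes> (l \<oplus> m)) \<otimes> (e [^] (n' - n) \<otimes> i)"
    unfolding en using c by algebra
  also have "\<dots> = x"
    using ei m c by simp
  finally have "x = e [^] n' \<otimes> (\<zero> \<oplus> (l \<otimes> i \<oplus> m \<otimes> i))"
    by simp
  moreover have "l \<otimes> i \<oplus> m \<otimes> i \<in> proper_fracs L e"
    using m l i by (intro proper_fracs_add proper_fracs_smult proper_fracs_mult)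
  ultimately show ?thesis
    using subringE(2)[OF subfieldE(1)[OF L]] unfolding lead_form_def by blast
qed

lemma lead_form_zero: "lead_form \<zero> n \<zero>"
  using proper_fracs_zero subringE(2)[OF subfieldE(1)[OF L]] e unfolding lead_form_def
  by (intro conjI bexI[of _ \<zero>]) auto

text \<open>From l + m = 0 the proper fraction m lies in \<open>L\<close>, and \<open>L\<close>
  meets the proper fractions only in 0.\<close>

lemma lead_form_zeroD:
  assumes "lead_form \<zero> n l"
  shows "l = \<zero>"
proof -
  obtain m where m: "m \<in> proper_fracs L e" "\<zero> = e [^] n \<otimes> (l \<oplus> m)" and l: "l \<in> L"
    using assms by (auto simp: lead_form_def)
  have c: "l \<in> carrier R" "m \<in> carrier R" "e [^] n \<in> carrier R"
    using l Lc m proper_fracs_carrier e by auto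
  have "l \<oplus> m = \<zero>"
    using m(2) c e_pow_nonzero by (metis add.m_closed integral_iff)
  then have "m = \<ominus> l"
    using c minus_equality[of m l] a_comm[of l m] by simp
  then have "m \<in> L"
    using l subringE(5)[OF subfieldE(1)[OF L]] by blast
  then have "m = \<zero>"
    using proper_fracs_inter m(1) by blast
  then show ?thesis
    using \<open>l \<oplus> m = \<zero>\<close> c by simp
qed

lemma lead_form_one: "lead_form \<one> 0 \<one>"
  using proper_fracs_zero subringE(3)[OF subfieldE(1)[OF L]] e unfolding lead_form_def
  by (intro conjI bexI[of _ \<zero>]) auto

lemma lead_form_const: "l \<in> L \<Longrightarrow> lead_form l 0 l"
  using proper_fracs_zero Lc by (force simp: lead_form_def)

lemma lead_form_pow: "lead_form x n l \<Longrightarrow> lead_form (x [^] j) (j * n) (l [^] (j :: nat))"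
proof (induction j)
  case (Suc j)
  then have "lead_form (x [^] j \<otimes> x) (j * n + n) (l [^] j \<otimes> l)"
    using lead_form_mult by blast
  then show ?case
    by (simp add: add.commute)
qed (simp add: lead_form_one)

text \<open>c(u) is a sum of terms c_i(e) u^i. For non-zero \<open>c\<close>, \<open>n\<close> is
  the largest exponent bound among the non-zero c_i, and \<open>r\<close> collects the leading
  coefficients of those c_i that attain it, with zeros elsewhere.\<close>

lemma lead_form_eval:
  assumes k: "subring k R" "k \<subseteq> L" and u: "lead_form u d l"
    and c: "set c \<subseteq> simple_extension k e"
  shows "\<exists>n r. set r \<subseteq> k \<and> length r = length c \<and> ((\<exists>x\<in>set c. x \<noteq> \<zero>) \<longrightarrow> (\<exists>x\<in>set r. x \<noteq> \<zero>)) \<and>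
    lead_form (eval c u) n (eval r l)"
  using c
proof (induction c)
  case Nil
  then show ?case
    using lead_form_zero by auto
next
  case (Cons x c)
  note kE = subringE[OF k(1)]
  have lL: "l \<in> L" "l \<in> carrier R"
    using u Lc by (auto simp: lead_form_def)
  have uc: "u \<in> carrier R"
    using u lL e proper_fracs_carrier by (auto simp: lead_form_def)
  have scc: "set (x # c) \<subseteq> carrier R"
    using Cons.prems simple_extension_in_carrier[of k e] kE(1) e by blast
  obtain n r where r: "set r \<subseteq> k" "length r = length c" "(\<exists>x\<in>set c. x \<noteq> \<zero>) \<longrightarrow> (\<exists>x\<in>set r. x \<noteq> \<zero>)"
      "lead_form (eval c u) n (eval r l)"
    using Cons by auto
  have rc: "set r \<subseteq> carrier R" "eval r l \<in> carrier R" "eval c u \<in> carrier R"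
    using r(1) kE(1) scc lL(2) uc by (auto intro!: eval_in_carrier)
  let ?z = "replicate (length c) \<zero>"
  have z: "eval ?z l = \<zero>" "set ?z \<subseteq> k"
    using eval_replicate[of "[]" l "length c"] lL kE(2) by auto
  show ?case
  proof (cases "x = \<zero>")
    case True
    then have "lead_form (eval (x # c) u) n (eval (\<zero> # r) l)"
      using r(4) rc lL uc by simp
    then show ?thesis
      using r True kE(2) by (intro exI[of _ n] exI[of _ "\<zero> # r"]) auto
  next
    case False
    obtain p where p: "p \<in> carrier (k[X])" "x = eval p e"
      using Cons.prems simple_extension_as_eval_img[OF kE(1) e] by auto
    have "p \<noteq> []"
      using False p(2) by auto
    then obtain a q where pq: "p = a # q"
      by (cases p) auto
    then have a: "a \<in> k" "a \<noteq> \<zero>" "set q \<subseteq> k" "a \<in> carrier R"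
      using p(1) kE(1) by (auto simp: polynomial_def simp flip: univ_poly_carrier)
    have "lead_form x (length q) a"
      unfolding p(2) pq using a k(2) by (intro lead_form_poly) auto
    then have xu: "lead_form (x \<otimes> u [^] length c) (length q + length c * d) (a \<otimes> l [^] length c)"
      using lead_form_mult lead_form_pow[OF u] by blast
    let ?n = "length q + length c * d"
    have ev: "eval (x # c) u = x \<otimes> u [^] length c \<oplus> eval c u"
      by simp
    \<comment> \<open>The new term has exponent \<open>?n\<close>. In a tie both sides contribute;
      otherwise the smaller side is raised and contributes zeros. A vanishing tail is separated
      because its exponent \<open>n\<close> carries no information.\<close>
    consider "\<forall>y\<in>set c. y = \<zero>" | "?n = n" | "?n < n" "\<exists>y\<in>set c. y \<noteq> \<zero>" | "n < ?n" "\<exists>y\<in>set c. y \<noteq> \<zero>"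
      by force
    then show ?thesis
    proof cases
      case 1
      then have "c = ?z"
        by (metis replicate_eqI)
      then have "eval c u = \<zero>"
        using eval_replicate[of "[]" u "length c"] uc by simp
      then have "lead_form (eval (x # c) u) ?n (eval (a # ?z) l)"
        using lead_form_add[OF xu lead_form_zero[of ?n]] ev z by simp
      then show ?thesis
        using a z by (intro exI[of _ ?n] exI[of _ "a # ?z"]) auto
    next
      case 2
      then have "lead_form (eval (x # c) u) n (eval (a # r) l)"
        using lead_form_add[OF xu, of "eval c u" "eval r l"] r(2,4) ev by simp
      then show ?thesis
        using a r by (intro exI[of _ n] exI[of _ "a # r"]) auto
    next
      case 3
      have "lead_form (eval (x # c) u) n (eval (\<zero> # r) l)"
        using lead_form_add[OF lead_form_raise[OF xu 3(1)] r(4)] ev rc lL by simp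
      then show ?thesis
        using 3 r kE(2) by (intro exI[of _ n] exI[of _ "\<zero> # r"]) auto
    next
      case 4
      have "lead_form (eval (x # c) u) ?n (eval (a # ?z) l)"
        using lead_form_add[OF xu lead_form_raise[OF r(4) 4(1)]] ev z by simp
      then show ?thesis
        using a z by (intro exI[of _ ?n] exI[of _ "a # ?z"]) auto
    qed
  qed
qed

text \<open>An equation for \<open>u\<close> over k(e), cleared to k[e], has value zero, hence
  leading coefficient zero; by \<open>lead_form_eval\<close> that is a non-trivial equation for
  \<open>l\<close> over \<open>k\<close>.\<close>

lemma lead_form_algebraic:
  assumes k: "subfield k R" "k \<subseteq> L" and u: "lead_form u d l" "(algebraic over generate_field R (insert e k)) u"
  shows "(algebraic over k) l"
proof -
  note kr = subfieldE(1)[OF k(1)]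
  have lL: "l \<in> L" "l \<in> carrier R"
    using u Lc by (auto simp: lead_form_def)
  have uc: "u \<in> carrier R"
    using u lL e proper_fracs_carrier by (auto simp: lead_form_def)
  have S: "subring (simple_extension k e) R" "insert e k \<subseteq> simple_extension k e"
    using simple_extension_is_subring[OF kr e] simple_extension_mem[OF kr e] simple_extension_incl[OF subringE(1)[OF kr] e]
    by auto
  obtain c where c: "set c \<subseteq> simple_extension k e" "\<exists>x\<in>set c. x \<noteq> \<zero>" "eval c u = \<zero>"
    using algebraic_clear_denominators[OF S uc u(2)] by blast
  then obtain n r where r: "set r \<subseteq> k" "\<exists>x\<in>set r. x \<noteq> \<zero>" "lead_form \<zero> n (eval r l)"
    using lead_form_eval[OF kr k(2) u(1) c(1)] by auto
  then show ?thesis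
    using algebraic_of_list[OF kr r(1) lL(2)] lead_form_zeroD by blast
qed

lemma cancel_leading_term:
  assumes g: "g \<in> carrier (L[X])" "g \<noteq> []" and h: "h \<in> carrier (L[X])" "h \<noteq> []" and len: "length h \<le> length g"
  defines "l \<equiv> hd g \<otimes> inv (hd h)" and "d \<equiv> length g - length h"
  shows "l \<in> L" "\<exists>r\<in>carrier (L[X]). length r < length g \<and> eval r e = eval g e \<ominus> (l \<otimes> e [^] d) \<otimes> eval h e"
proof -
  note LE = subringE[OF subfieldE(1)[OF L]]
  obtain a g' where ag: "g = a # g'"
    using g(2) by (cases g) auto
  obtain b h' where bh: "h = b # h'"
    using h(2) by (cases h) auto
  have ab: "a \<in> L" "b \<in> L" "b \<noteq> \<zero>" "set g' \<subseteq> L" "set h' \<subseteq> L"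
    using g h by (auto simp: ag bh polynomial_def simp flip: univ_poly_carrier)
  have l: "l = a \<otimes> inv b"
    by (simp add: l_def ag bh)
  show lL: "l \<in> L"
    unfolding l using ab LE(6) subfield_inv[OF L] by blast
  have c: "a \<in> carrier R" "b \<in> carrier R" "b \<in> Units R" "set g' \<subseteq> carrier R" "set h' \<subseteq> carrier R" "l \<in> carrier R"
    using ab lL Lc by (auto simp: field_Units)
  \<comment> \<open>One step of long division. The heads of g and l X^d h cancel, so only the tails
    are combined, which makes the length bound immediate; the appended zeros multiply by
    X^d.\<close>
  let ?h = "map (\<lambda>x. \<ominus> l \<otimes> x) h' @ replicate d \<zero>"
  let ?r = "poly_add g' ?h"
  have hL: "set ?h \<subseteq> L"
    using ab lL LE(2,5,6) by auto
  have hc: "set ?h \<subseteq> carrier R" "set (map (\<lambda>x. \<ominus> l \<otimes> x) h') \<subseteq> carrier R" "set (replicate d \<zero>) \<subseteq> carrier R"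
    using hL Lc by auto
  have evc: "eval g' e \<in> carrier R" "eval h' e \<in> carrier R" "e [^] d \<in> carrier R" "e [^] length h' \<in> carrier R"
    using c e eval_in_carrier by auto
  have z: "eval (replicate d \<zero>) e = \<zero>"
    using eval_replicate[of "[]" e d] e by simp
  have "eval ?h e = eval (map (\<lambda>x. \<ominus> l \<otimes> x) h') e \<otimes> e [^] d"
    using eval_append[OF hc(2,3) e] z evc hc e eval_in_carrier by simp
  also have "\<dots> = (\<ominus> l \<otimes> eval h' e) \<otimes> e [^] d"
    using eval_smult[of "\<ominus> l" h' e] c e by simp
  finally have "eval ?r e = eval g' e \<oplus> (\<ominus> l \<otimes> eval h' e) \<otimes> e [^] d"
    using eval_poly_add[OF c(4) hc(1) e] by simp
  also have "\<dots> = eval g e \<ominus> (l \<otimes> e [^] d) \<otimes> eval h e"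
  proof -
    have lb: "l \<otimes> b = a"
      unfolding l using c by (simp add: m_assoc)
    have len': "length g' = d + length h'"
      using len by (simp add: ag bh d_def)
    have "e [^] length g' = e [^] d \<otimes> e [^] length h'"
      unfolding len' using nat_pow_mult[OF e] by simp
    then have "eval g e \<ominus> (l \<otimes> e [^] d) \<otimes> eval h e
      = (((l \<otimes> b) \<otimes> (e [^] d \<otimes> e [^] length h')) \<oplus> eval g' e) \<ominus> (l \<otimes> e [^] d) \<otimes> (b \<otimes> e [^] length h' \<oplus> eval h' e)"
      by (simp add: ag bh lb)
    also have "\<dots> = eval g' e \<oplus> (\<ominus> l \<otimes> eval h' e) \<otimes> e [^] d"
      using c evc by algebra
    finally show ?thesis
      by simp
  qed
  finally have "eval ?r e = eval g e \<ominus> (l \<otimes> e [^] d) \<otimes> eval h e" .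
  moreover have "?r \<in> carrier (L[X])"
    using poly_add_is_polynomial[OF subfieldE(1)[OF L] ab(4) hL] by (simp add: univ_poly_carrier)
  moreover have "length ?r < length g"
    using poly_add_length_le[of g' ?h] len by (simp add: ag bh d_def)
  ultimately show "\<exists>r\<in>carrier (L[X]). length r < length g \<and> eval r e = eval g e \<ominus> (l \<otimes> e [^] d) \<otimes> eval h e"
    by blast
qed

text \<open>With \<open>u\<close> = g(e)/h(e), the remainder u - l e^d is r(e)/h(e). Divided by e^d
  it becomes proper, since \<open>length r < length g\<close> and
  \<open>length g = length h + d\<close>; so \<open>l\<close> is the leading coefficient at exponent
  \<open>d\<close>.\<close>

lemma subtract_leading_term:
  assumes g: "g \<in> carrier (L[X])" "g \<noteq> []" and h: "h \<in> carrier (L[X])" "h \<noteq> []" and len: "length h \<le> length g"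
    and u: "u \<in> carrier R" "u \<otimes> eval h e = eval g e"
  obtains l d r where "lead_form u d l" "r \<in> carrier (L[X])" "length r < length g"
    "(u \<ominus> l \<otimes> e [^] d) \<otimes> eval h e = eval r e"
proof -
  define l d where "l = hd g \<otimes> inv (hd h)" and "d = length g - length h"
  obtain r where lL: "l \<in> L" and r: "r \<in> carrier (L[X])" "length r < length g"
      "eval r e = eval g e \<ominus> (l \<otimes> e [^] d) \<otimes> eval h e"
    using cancel_leading_term[OF g h len] unfolding l_def d_def by blast
  have c: "l \<in> carrier R" "e [^] d \<in> carrier R" "eval h e \<in> carrier R" "eval g e \<in> carrier R" "e [^] d \<in> Units R"
    using lL Lc e eval_e_closed g h e_pow_nonzero by (auto simp: field_Units)
  have eq: "(u \<ominus> l \<otimes> e [^] d) \<otimes> eval h e = eval r e"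
    unfolding r(3) u(2)[symmetric] using c u(1) by algebra
  let ?m = "inv (e [^] d) \<otimes> (u \<ominus> l \<otimes> e [^] d)" and ?h = "h @ replicate d \<zero>"
  have ev: "eval ?h e = eval h e \<otimes> e [^] d"
    using eval_append[of h "replicate d \<zero>" e] eval_replicate[of "[]" e d] poly_carrier[OF h(1)] e c
    by (simp add: set_replicate_conv_if split: if_splits)
  have "?m \<otimes> eval ?h e = (inv (e [^] d) \<otimes> e [^] d) \<otimes> ((u \<ominus> l \<otimes> e [^] d) \<otimes> eval h e)"
    unfolding ev using c(1-4) Units_inv_closed[OF c(5)] u(1) by algebra
  also have "\<dots> = eval r e"
    using eq c u(1) eval_e_closed[OF r(1)] by simp
  finally have "?m \<otimes> eval ?h e = eval r e" .
  moreover have "?h \<in> carrier (L[X])"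
    using append_is_polynomial[OF subfieldE(1)[OF L]] h by (simp flip: univ_poly_carrier)
  moreover have "length r < length ?h"
    using r(2) len by (simp add: d_def)
  ultimately have m: "?m \<in> proper_fracs L e"
    using c u(1) r(1) unfolding proper_fracs_def by blast
  have "e [^] d \<otimes> (l \<oplus> ?m) = e [^] d \<otimes> l \<oplus> (e [^] d \<otimes> inv (e [^] d)) \<otimes> (u \<ominus> l \<otimes> e [^] d)"
    using c(1-4) Units_inv_closed[OF c(5)] u(1) by algebra
  also have "\<dots> = e [^] d \<otimes> l \<oplus> (u \<ominus> l \<otimes> e [^] d)"
    using c u(1) by simp
  also have "\<dots> = u"
    using c u(1) by algebra
  finally have "lead_form u d l"
    using lL m unfolding lead_form_def by metis
  then show ?thesis
    using that r eq by blast
qed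

text \<open>The leading coefficient of \<open>u\<close> is algebraic over k1 and over k2, hence lies
  in both by relative closedness. Subtracting the leading term shortens the numerator, and inverting
  handles numerators shorter than the denominator, as in Euclid's algorithm.\<close>

lemma algebraic_fraction_inter:
  assumes k1: "subfield k1 R" "k1 \<subseteq> L" "\<And>x. x \<in> L \<Longrightarrow> (algebraic over k1) x \<Longrightarrow> x \<in> k1"
    and k2: "subfield k2 R" "k2 \<subseteq> L" "\<And>x. x \<in> L \<Longrightarrow> (algebraic over k2) x \<Longrightarrow> x \<in> k2"
    and g: "g \<in> carrier (L[X])" and h: "h \<in> carrier (L[X])" "h \<noteq> []"
    and u: "u \<in> carrier R" "u \<otimes> eval h e = eval g e"
    and alg: "(algebraic over generate_field R (insert e k1)) u" "(algebraic over generate_field R (insert e k2)) u"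
  shows "u \<in> generate_field R (insert e (k1 \<inter> k2))"
  using g h u alg
proof (induction "length g + length h" arbitrary: g h u rule: less_induct)
  case less
  let ?G = "generate_field R (insert e (k1 \<inter> k2))"
  let ?A1 = "acl (insert e k1)" and ?A2 = "acl (insert e k2)"
  have kc: "insert e k1 \<subseteq> carrier R" "insert e k2 \<subseteq> carrier R" "insert e (k1 \<inter> k2) \<subseteq> carrier R"
    using k1(2) k2(2) Lc e by auto
  note G = generate_field_is_subfield[OF kc(3)]
  note GE = subringE[OF subfieldE(1)[OF G]]
  note A1 = acl_subfield[OF kc(1)] and A2 = acl_subfield[OF kc(2)]
  have GA: "?G \<subseteq> ?A1" "?G \<subseteq> ?A2"
    using generate_subset_acl[OF kc(1)] generate_subset_acl[OF kc(2)]
      mono_generate_field[OF _ kc(1), of "insert e (k1 \<inter> k2)"] mono_generate_field[OF _ kc(2), of "insert e (k1 \<inter> k2)"] by blast+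
  \<comment> \<open>Separated from the case distinction because inversion keeps the induction
    measure: the inverted fraction must use this step before the induction hypothesis
    applies.\<close>
  have step: "v \<in> ?G" if p: "p \<in> carrier (L[X])" "p \<noteq> []" and q: "q \<in> carrier (L[X])" "q \<noteq> []"
      and len: "length q \<le> length p" "length p + length q = length g + length h"
      and v: "v \<in> ?A1" "v \<in> ?A2" "v \<otimes> eval q e = eval p e" for v p q
  proof -
    have vc: "v \<in> carrier R"
      using v(1) acl_carrier by blast
    obtain l d r where ld: "lead_form v d l" and r: "r \<in> carrier (L[X])" "length r < length p"
        "(v \<ominus> l \<otimes> e [^] d) \<otimes> eval q e = eval r e"
      using subtract_leading_term[OF p q len(1) vc v(3)] by blast
    have lL: "l \<in> L"
      using ld by (simp add: lead_form_def)
    have "l \<in> k1 \<inter> k2"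
      using lead_form_algebraic[OF k1(1,2) ld] lead_form_algebraic[OF k2(1,2) ld] v(1,2) k1(3)[OF lL] k2(3)[OF lL]
      by (simp add: acl_def)
    then have "l \<in> ?G" "e \<in> ?G"
      by (auto intro: generate_field.incl)
    moreover from this have "e [^] d \<in> ?G"
      using GE(3,6) by (induction d) auto
    ultimately have led: "l \<otimes> e [^] d \<in> ?G"
      using GE(6) by blast
    let ?w = "v \<ominus> l \<otimes> e [^] d"
    have "?w \<in> ?A1" "?w \<in> ?A2"
      using v(1,2) led GA subringE(5,7)[OF subfieldE(1)[OF A1]] subringE(5,7)[OF subfieldE(1)[OF A2]]
      unfolding a_minus_def by blast+
    then have "?w \<in> ?G"
      using less.hyps[of r q ?w] r q len(2) by (auto simp: acl_def)
    then have "?w \<oplus> l \<otimes> e [^] d \<in> ?G"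
      using led GE(7) by blast
    moreover have "?w \<oplus> l \<otimes> e [^] d = v"
      using vc subsetD[OF GE(1) led] by algebra
    ultimately show ?thesis
      by simp
  qed
  have uA: "u \<in> ?A1" "u \<in> ?A2"
    using less.prems by (auto simp: acl_def)
  have hz: "eval h e \<noteq> \<zero>" and hc: "eval h e \<in> carrier R"
    using eval_e_nonzero eval_e_closed less.prems by auto
  show ?case
  proof (cases "u = \<zero>")
    case True
    then show ?thesis
      using GE(2) by simp
  next
    case False
    then have "eval g e \<noteq> \<zero>"
      using less.prems hz hc by (metis integral_iff)
    then have g: "g \<noteq> []"
      by auto
    show ?thesis
    proof (cases "length h \<le> length g")
      case True
      then show ?thesis
        using step[OF less.prems(1) g less.prems(2,3)] uA less.prems(5) by simp
    next
      \<comment> \<open>A proper fraction has no leading term at a natural exponent; its inverse has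
        one.\<close>
      case len: False
      have unit: "u \<in> Units R"
        using False less.prems(4) by (simp add: field_Units)
      have inv: "inv u \<otimes> eval g e = eval h e"
        unfolding less.prems(5)[symmetric] using unit hc less.prems(4) by (simp flip: m_assoc)
      have "inv u \<in> ?A1" "inv u \<in> ?A2"
        using subfield_inv[OF A1 uA(1) False] subfield_inv[OF A2 uA(2) False] by auto
      then have "inv u \<in> ?G"
        using step[OF less.prems(2,3,1) g _ _ _ _ inv] len by simp
      moreover have "inv u \<noteq> \<zero>"
        using unit False by (metis Units_inv_inv Units_inv_Units field_Units DiffE singletonI)
      ultimately have "inv (inv u) \<in> ?G"
        using subfield_inv[OF G] by blast
      then show ?thesis
        using unit by simp
    qed
  qed
qed

end

section \<open>Factors of polynomials\<close>

text \<open>Vieta by induction: splitting off X - a for one root leaves a cofactor with the same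
  head and the remaining roots.\<close>

lemma splitted_coeffs_in_subfield:
  assumes M: "subfield M R" and q: "q \<in> carrier (poly_ring R)" "splitted q" "q \<noteq> []" "hd q \<in> M" "set_mset (roots q) \<subseteq> M"
  shows "set q \<subseteq> M"
  using q
proof (induction "length q" arbitrary: q rule: less_induct)
  case less
  note ME = subringE[OF subfieldE(1)[OF M]]
  show ?case
  proof (cases "length q = 1")
    case True
    then obtain a where "q = [a]"
      by (metis One_nat_def length_0_conv length_Suc_conv)
    then show ?thesis
      using less.prems(4) by simp
  next
    case False
    then have "length q > 1"
      using less.prems(3) by (cases q) auto
    then have "roots q \<noteq> {#}"
      using less.prems(2) by (auto simp: splitted_def)
    then obtain a where a: "a \<in> carrier R" "a \<in># roots q" "[\<one>, \<ominus> a] \<in> carrier (poly_ring R)" "[\<one>, \<ominus> a] pdivides q"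
      using not_empty_rootsE[OF less.prems(1)] by blast
    then obtain s where s: "s \<in> carrier (poly_ring R)" "q = [\<one>, \<ominus> a] \<otimes>\<^bsub>poly_ring R\<^esub> s"
      unfolding pdivides_def factor_def by blast
    then have q: "q = poly_mult [\<one>, \<ominus> a] s"
      by (simp only: univ_poly_mult)
    have pol: "polynomial (carrier R) [\<one>, \<ominus> a]" "polynomial (carrier R) s"
      using a(3) s(1) by (simp_all only: univ_poly_carrier)
    have sne: "s \<noteq> []"
      using less.prems(3) poly_mult_zero(2)[of "[\<one>, \<ominus> a]"] a(1) unfolding q by (auto simp del: poly_mult.simps)
    have "length q - 1 = 1 + (length s - 1)" "length s \<ge> 1"
      using poly_mult_degree_eq[OF carrier_is_subring pol] sne unfolding q by (auto simp del: poly_mult.simps simp: Suc_le_eq)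
    then have len: "length q = Suc (length s)"
      using \<open>length q > 1\<close> by linarith
    have roots: "roots q = add_mset a (roots s)"
      unfolding s(2) by (rule poly_mult_degree_one_monic_imp_same_roots[OF a(1) s(1) sne])
    have "splitted s"
      using less.prems(2) len \<open>length s \<ge> 1\<close> by (simp add: splitted_def roots)
    moreover have "hd q = hd s"
      using poly_mult_lead_coeff[OF carrier_is_subring pol] sne lead_coeff_in_carrier[OF carrier_is_subring, of "hd s" "tl s"] pol(2)
      unfolding q by (simp del: poly_mult.simps)
    ultimately have sM: "set s \<subseteq> M"
      using less.hyps[of s] len s(1) sne less.prems(4,5) roots by auto
    have "a \<in> M"
      using less.prems(5) roots by simp
    then have "polynomial M q"
      unfolding q using poly_mult_is_polynomial[OF subfieldE(1)[OF M] _ sM, of "[\<one>, \<ominus> a]"] ME(3,5) by (simp del: poly_mult.simps)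
    then show ?thesis
      by (rule polynomial_incl)
  qed
qed

lemma algebraic_generate_mono:
  "I \<subseteq> J \<Longrightarrow> J \<subseteq> carrier R \<Longrightarrow> (algebraic over generate_field R I) x \<Longrightarrow> (algebraic over generate_field R J) x"
  using algebraic_mono[OF mono_generate_field] by blast

text \<open>The minimal polynomial over \<open>L\<close> divides the one over \<open>E\<close>, so
  its roots are algebraic over \<open>E\<close>, and its coefficients are built from the roots.
  Since the roots may lie outside \<open>R\<close>, the argument runs in an algebraic closure and is
  pulled back along the embedding.\<close>

lemma Irr_coeffs_algebraic:
  assumes E: "subfield E R" and L: "subfield L R" and EL: "E \<subseteq> L"
    and f: "f \<in> carrier R" "(algebraic over E) f" and c: "c \<in> set (Irr L f)"
  shows "(algebraic over E) c"
proof -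
  let ?h = "indexed_const :: 'a \<Rightarrow> ('a list \<times> nat) multiset \<Rightarrow> 'a"
  obtain C :: "((('a list \<times> nat) multiset) \<Rightarrow> 'a) ring" where C: "algebraic_closure C (?h ` carrier R)"
    and hom: "?h \<in> ring_hom R C"
    using exists_closure by blast
  interpret C: algebraic_closure C "?h ` carrier R"
    by (rule C)
  interpret h: ring_hom_ring R C ?h
    using ring_hom_ringI2[OF ring_axioms C.ring_axioms hom] .
  have one: "\<one>\<^bsub>C\<^esub> \<noteq> \<zero>\<^bsub>C\<^esub>"
    by simp
  have fL: "(algebraic over L) f"
    using algebraic_mono[OF EL f(2)] .
  define p q where "p = Irr E f" and "q = Irr L f"
  have p: "p \<in> carrier (E[X])" "eval p f = \<zero>" "p \<noteq> []"
    using IrrE[OF E f] pirreducibleE(1)[OF subfieldE(1)[OF E], of "Irr E f"] by (simp_all add: p_def)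
  have q: "q \<in> carrier (L[X])" "hd q = \<one>" "q \<noteq> []"
    using IrrE[OF L f(1) fL] pirreducibleE(1)[OF subfieldE(1)[OF L], of "Irr L f"] by (simp_all add: q_def)
  have pL: "p \<in> carrier (L[X])"
    using p(1) EL by (auto simp: polynomial_def simp flip: univ_poly_carrier)
  have "q pdivides p"
    unfolding q_def using Irr_minimal[OF L f(1) fL pL p(2)] .
  then obtain s where s: "s \<in> carrier (poly_ring R)" "p = poly_mult q s"
    unfolding pdivides_def factor_def by (auto simp: univ_poly_mult)
  have qR: "q \<in> carrier (poly_ring R)"
    using carrier_polynomial_shell[OF subfieldE(1)[OF L] q(1)] .
  have sets: "set p \<subseteq> carrier R" "set q \<subseteq> carrier R" "set s \<subseteq> carrier R"
    using carrier_polynomial_shell[OF subfieldE(1)[OF L] pL] qR s(1)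
    by (auto simp: polynomial_def simp flip: univ_poly_carrier)
  have hsub: "subfield (?h ` E) C"
    using h.img_is_subfield(2)[OF E one] .
  have hq: "map ?h q \<in> carrier (poly_ring C)" "C.splitted (map ?h q)"
  proof -
    have "map ?h q \<in> carrier ((?h ` carrier R)[X]\<^bsub>C\<^esub>)"
      using h.subfield_polynomial_hom[OF carrier_is_subfield one qR] .
    then show "map ?h q \<in> carrier (poly_ring C)" "C.splitted (map ?h q)"
      using C.roots_over_subfield C.carrier_polynomial_shell[OF subfieldE(1)[OF C.subfield_axioms]] by blast+
  qed
  have hp: "map ?h p \<in> carrier ((?h ` E)[X]\<^bsub>C\<^esub>)"
    using h.subfield_polynomial_hom[OF E one p(1)] .
  let ?M = "{y \<in> carrier C. (C.algebraic over (?h ` E)) y}"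
  have M: "subfield ?M C"
    using C.subfield_of_algebraics[OF hsub] .
  have "set (map ?h q) \<subseteq> ?M"
  proof (rule C.splitted_coeffs_in_subfield[OF M hq])
    show "map ?h q \<noteq> []"
      using q(3) by simp
    show "hd (map ?h q) \<in> ?M"
      using q(2,3) subringE(3)[OF subfieldE(1)[OF M]] by (simp add: hd_map)
    show "set_mset (C.roots (map ?h q)) \<subseteq> ?M"
    proof
      fix x assume "x \<in> set_mset (C.roots (map ?h q))"
      then have x: "x \<in> carrier C" "C.eval (map ?h q) x = \<zero>\<^bsub>C\<^esub>"
        using C.roots_mem_iff_is_root[OF hq(1)] by (auto simp: C.is_root_def)
      have hs: "set (map ?h p) \<subseteq> carrier C" "set (map ?h q) \<subseteq> carrier C" "set (map ?h s) \<subseteq> carrier C"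
        using sets by auto
      have "C.eval (map ?h p) x = C.eval (C.poly_mult (map ?h q) (map ?h s)) x"
        using C.eval_normalize[OF hs(1) x(1)] h.poly_mult_hom'[OF sets(2,3)] s(2) by simp
      also have "\<dots> = \<zero>\<^bsub>C\<^esub>"
        using C.eval_poly_mult[OF hs(2,3) x(1)] x C.eval_in_carrier[OF hs(3) x(1)] by simp
      finally show "x \<in> ?M"
        using x(1) hp p(3) C.algebraicI[of "map ?h p" "?h ` E" x] by simp
    qed
  qed
  then have hc: "?h c \<in> carrier C" "(C.algebraic over (?h ` E)) (?h c)"
    using c by (auto simp: q_def)
  have cR: "c \<in> carrier R"
    using c sets(2) by (auto simp: q_def)
  obtain P where P: "P \<in> carrier ((?h ` E)[X]\<^bsub>C\<^esub>)" "P \<noteq> []" "C.eval P (?h c) = \<zero>\<^bsub>C\<^esub>"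
    using C.algebraicE[OF subfieldE(1)[OF hsub] hc] by blast
  then have Ps: "set P \<subseteq> ?h ` E" "hd P \<noteq> \<zero>\<^bsub>C\<^esub>"
    by (auto simp: polynomial_def simp flip: univ_poly_carrier)
  \<comment> \<open>The embedding is injective, so the equation over the image of \<open>E\<close>
    pulls back coefficientwise.\<close>
  let ?P = "map (inv_into E ?h) P"
  have PE: "set ?P \<subseteq> E"
    using Ps(1) by (auto intro: inv_into_into)
  have hP: "map ?h ?P = P"
    using Ps(1) by (auto simp: f_inv_into_f intro!: map_idI)
  have PR: "set ?P \<subseteq> carrier R"
    using PE subfieldE(3)[OF E] by blast
  have "?h (eval ?P c) = ?h \<zero>"
    using h.eval_hom'[OF cR PR] P(3) h.hom_zero unfolding hP by metis
  then have "eval ?P c = \<zero>"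
    using inj_onD[OF indexed_const_inj_on] eval_in_carrier[OF PR cR] by blast
  moreover have "\<exists>x\<in>set ?P. x \<noteq> \<zero>"
  proof (intro bexI)
    have "hd P \<in> ?h ` E"
      using Ps(1) hd_in_set[OF P(2)] by blast
    then show "inv_into E ?h (hd P) \<noteq> \<zero>"
      using Ps(2) f_inv_into_f[of "hd P" ?h E] by (metis h.hom_zero)
    show "inv_into E ?h (hd P) \<in> set ?P"
      using hd_in_set[OF P(2)] by simp
  qed
  ultimately show ?thesis
    using algebraic_of_list[OF subfieldE(1)[OF E] PE cR] by blast
qed

text \<open>The minimal polynomial of \<open>f\<close> over L(e) already has its coefficients in (k1
  \<inter> k2)(e): each is a fraction in \<open>e\<close> that is algebraic over k1(e) and over
  k2(e).\<close>

lemma algebraic_inter: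
  assumes L: "subfield L R" and e: "e \<in> carrier R" "(transcendental over L) e"
    and k1: "subfield k1 R" "k1 \<subseteq> L" "\<And>x. x \<in> L \<Longrightarrow> (algebraic over k1) x \<Longrightarrow> x \<in> k1"
    and k2: "subfield k2 R" "k2 \<subseteq> L" "\<And>x. x \<in> L \<Longrightarrow> (algebraic over k2) x \<Longrightarrow> x \<in> k2"
    and f: "f \<in> carrier R" "(algebraic over generate_field R (insert e k1)) f" "(algebraic over generate_field R (insert e k2)) f"
  shows "(algebraic over generate_field R (insert e (k1 \<inter> k2))) f"
proof -
  let ?Le = "generate_field R (insert e L)" and ?G = "generate_field R (insert e (k1 \<inter> k2))"
  let ?E1 = "generate_field R (insert e k1)" and ?E2 = "generate_field R (insert e k2)"
  have Lc: "L \<subseteq> carrier R"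
    using subfieldE(3)[OF L] .
  have sub: "insert e L \<subseteq> carrier R" "insert e k1 \<subseteq> carrier R" "insert e k2 \<subseteq> carrier R"
    using Lc e k1(2) k2(2) by auto
  have Le: "subfield ?Le R" and E: "subfield ?E1 R" "subfield ?E2 R"
    using sub generate_field_is_subfield by blast+
  have EL: "?E1 \<subseteq> ?Le" "?E2 \<subseteq> ?Le"
    using mono_generate_field[OF Set.insert_mono[OF k1(2)] sub(1)] mono_generate_field[OF Set.insert_mono[OF k2(2)] sub(1)] by auto
  have fL: "(algebraic over ?Le) f"
    using algebraic_mono[OF EL(1) f(2)] .
  define q where "q = Irr ?Le f"
  have q: "q \<in> carrier (?Le[X])" "eval q f = \<zero>" "q \<noteq> []"
    using IrrE[OF Le f(1) fL] pirreducibleE(1)[OF subfieldE(1)[OF Le], of "Irr ?Le f"] by (simp_all add: q_def)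
  have S: "subring (simple_extension L e) R" "insert e L \<subseteq> simple_extension L e"
    using simple_extension_is_subring[OF subfieldE(1)[OF L] e(1)] simple_extension_mem[OF subfieldE(1)[OF L] e(1)]
      simple_extension_incl[OF Lc e(1)] by auto
  have "set q \<subseteq> ?G"
  proof
    fix c assume c: "c \<in> set q"
    then have cL: "c \<in> ?Le"
      using q(1) by (auto simp: polynomial_def simp flip: univ_poly_carrier)
    then obtain s where "s \<in> simple_extension L e" "s \<noteq> \<zero>" "s \<otimes> c \<in> simple_extension L e"
      using generate_field_fractions[OF S] by blast
    then obtain g h where gh: "g \<in> carrier (L[X])" "h \<in> carrier (L[X])" "s = eval h e" "s \<otimes> c = eval g e"
      using simple_extension_as_eval_img[OF Lc e(1)] by auto
    have "h \<noteq> []"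
      using \<open>s \<noteq> \<zero>\<close> gh(3) by auto
    have cR: "c \<in> carrier R" "s \<in> carrier R"
      using cL subfieldE(3)[OF Le] subringE(1)[OF S(1)] \<open>s \<in> simple_extension L e\<close> by auto
    have "c \<otimes> eval h e = eval g e"
      using gh(3,4) m_comm[OF cR] by simp
    moreover have "(algebraic over ?E1) c" "(algebraic over ?E2) c"
      using Irr_coeffs_algebraic[OF E(1) Le EL(1) f(1,2)] Irr_coeffs_algebraic[OF E(2) Le EL(2) f(1,3)] c
      by (auto simp: q_def)
    ultimately show "c \<in> ?G"
      using algebraic_fraction_inter[OF L e k1 k2 gh(1,2) \<open>h \<noteq> []\<close> cR(1)] by blast
  qed
  then have "q \<in> carrier (?G[X])"
    using q(1) by (auto simp: polynomial_def simp flip: univ_poly_carrier)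
  then show ?thesis
    using q(2,3) by (intro algebraicI)
qed

text \<open>If \<open>x\<close> were transcendental over the field L generated by \<open>y\<close>
  and \<open>H\<close>, then \<open>y\<close> would be a constant of L(x) and so its own leading
  coefficient; \<open>lead_form_algebraic\<close> would make it algebraic over the field generated
  by \<open>H\<close>.\<close>

theorem acl_exchange:
  assumes H: "H \<subseteq> carrier R" "x \<in> carrier R" and y: "y \<in> acl (insert x H)" "y \<notin> acl H"
  shows "x \<in> acl (insert y H)"
proof (rule ccontr)
  assume neg: "x \<notin> acl (insert y H)"
  have yR: "y \<in> carrier R"
    using y(1) acl_carrier by blast
  let ?L = "generate_field R (insert y H)" and ?k = "generate_field R H"
  have sub: "insert y H \<subseteq> carrier R" "insert x ?k \<subseteq> carrier R"
    using H yR generate_field_incl[OF H(1)] by auto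
  have L: "subfield ?L R" and k: "subfield ?k R"
    using generate_field_is_subfield sub(1) H(1) by auto
  have transc: "(transcendental over ?L) x"
    using neg H(2) by (simp add: acl_def over_def)
  have kL: "?k \<subseteq> ?L"
    using mono_generate_field[OF _ sub(1)] by blast
  have "y \<in> ?L"
    by (simp add: generate_field.incl)
  then have "lead_form ?L x y 0 y"
    using lead_form_const[OF L H(2) transc] by blast
  moreover have "insert x H \<subseteq> insert x ?k"
    by (auto intro: generate_field.incl)
  then have "(algebraic over generate_field R (insert x ?k)) y"
    using y(1) algebraic_generate_mono[OF _ sub(2)] unfolding acl_def by blast
  ultimately have "(algebraic over ?k) y"
    using lead_form_algebraic[OF L H(2) transc k kL] by blast
  then show False
    using y(2) yR by (simp add: acl_def)
qed

text \<open>The key fact behind the Ingleton--Main lemma: the coefficients of the minimal polynomial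
  of \<open>f\<close> over \<open>acl (H1 \<union> H2)(e)\<close> lie in \<open>acl H1(e)\<close> and in \<open>acl H2(e)\<close>.\<close>

theorem acl_inter:
  assumes H: "H1 \<subseteq> carrier R" "H2 \<subseteq> carrier R" and e: "e \<in> carrier R" "e \<notin> acl (H1 \<union> H2)"
    and f: "f \<in> acl (insert e H1)" "f \<in> acl (insert e H2)"
  shows "f \<in> acl (insert e (acl H1 \<inter> acl H2))"
proof -
  let ?L = "acl (H1 \<union> H2)"
  have L: "subfield ?L R" and k: "subfield (acl H1) R" "subfield (acl H2) R"
    using H acl_subfield by auto
  have kL: "acl H1 \<subseteq> ?L" "acl H2 \<subseteq> ?L"
    using H by (auto intro: acl_mono[THEN subsetD])
  have transc: "(transcendental over ?L) e"
    using acl_closed[of "H1 \<union> H2" e] H e by (auto simp: over_def)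
  \<comment> \<open>\<open>acl H1\<close> and \<open>acl H2\<close> are relatively algebraically
    closed in \<open>?L\<close>.\<close>
  have closed: "x \<in> acl H'" if "H' \<subseteq> carrier R" "x \<in> ?L" "(algebraic over acl H') x" for x H'
    using acl_closed[OF that(1) _ that(3)] that(2) acl_carrier by blast
  have "(algebraic over generate_field R (insert e (acl H'))) f" if "H' \<subseteq> carrier R" "f \<in> acl (insert e H')" for H'
  proof -
    have "insert e H' \<subseteq> insert e (acl H')" "insert e (acl H') \<subseteq> carrier R"
      using subset_acl[OF that(1)] acl_carrier e(1) by auto
    then show ?thesis
      using that(2) algebraic_generate_mono unfolding acl_def[of "insert e H'"] by blast
  qed
  then have "(algebraic over generate_field R (insert e (acl H1))) f" "(algebraic over generate_field R (insert e (acl H2))) f"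
    using H f by blast+
  moreover have "f \<in> carrier R"
    using f(1) acl_carrier by blast
  ultimately show ?thesis
    using algebraic_inter[OF L e(1) transc k(1) kL(1) closed[OF H(1)] k(2) kL(2) closed[OF H(2)]]
    by (simp add: acl_def[of "insert e (acl H1 \<inter> acl H2)"])
qed

end

section \<open>Pregeometries\<close>

text \<open>A closure operator with exchange; \<open>cl_least\<close> combines monotonicity and
  idempotence.\<close>

locale pregeometry =
  fixes U :: "'a set" and cl :: "'a set \<Rightarrow> 'a set"
  assumes cl_subset: "S \<subseteq> U \<Longrightarrow> cl S \<subseteq> U"
    and cl_incl: "S \<subseteq> U \<Longrightarrow> S \<subseteq> cl S"
    and cl_least: "S \<subseteq> cl T \<Longrightarrow> T \<subseteq> U \<Longrightarrow> cl S \<subseteq> cl T"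
    and cl_exchange: "S \<subseteq> U \<Longrightarrow> x \<in> U \<Longrightarrow> y \<in> cl (insert x S) \<Longrightarrow> y \<notin> cl S \<Longrightarrow> x \<in> cl (insert y S)"
begin

definition indep :: "'a set \<Rightarrow> bool" where
  "indep B \<longleftrightarrow> finite B \<and> B \<subseteq> U \<and> (\<forall>b\<in>B. b \<notin> cl (B - {b}))"

lemma cl_mono: "S \<subseteq> T \<Longrightarrow> T \<subseteq> U \<Longrightarrow> cl S \<subseteq> cl T"
  using cl_least[of S T] cl_incl[of T] by blast

text \<open>If some \<open>b\<close> depended on the other elements together with \<open>x\<close>,
  exchange would put \<open>x\<close> into \<open>cl B\<close>.\<close>

lemma indep_insert:
  assumes "indep B" "x \<in> U" "x \<notin> cl B"
  shows "indep (insert x B)"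
proof -
  have B: "finite B" "B \<subseteq> U" "\<And>b. b \<in> B \<Longrightarrow> b \<notin> cl (B - {b})"
    using assms(1) by (auto simp: indep_def)
  have "x \<notin> B"
    using assms(3) cl_incl[OF B(2)] by blast
  have "b \<notin> cl (insert x B - {b})" if "b \<in> B" for b
  proof
    assume "b \<in> cl (insert x B - {b})"
    moreover have "insert x B - {b} = insert x (B - {b})"
      using \<open>x \<notin> B\<close> that by auto
    ultimately have "x \<in> cl (insert b (B - {b}))"
      using cl_exchange[of "B - {b}" x b] B that assms(2) by auto
    then show False
      using assms(3) that by (simp add: insert_absorb)
  qed
  moreover have "insert x B - {x} = B"
    using \<open>x \<notin> B\<close> by simp
  ultimately show ?thesis
    using B assms by (auto simp: indep_def)
qed

lemma indep_subset:
  assumes "indep B" "A \<subseteq> B"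
  shows "indep A"
proof -
  have "cl (A - {b}) \<subseteq> cl (B - {b})" for b
    using assms by (intro cl_mono) (auto simp: indep_def)
  then show ?thesis
    using assms finite_subset unfolding indep_def by blast
qed

text \<open>Elements of \<open>B\<close> outside \<open>C\<close> are traded one at a time for
  elements of \<open>C\<close>. A suitable \<open>c\<close> exists, for otherwise b \<in> cl C
  \<subseteq> cl (B - {b}).\<close>

lemma steinitz:
  assumes "indep B" "finite C" "C \<subseteq> U" "B \<subseteq> cl C"
  shows "card B \<le> card C"
  using assms
proof (induction "card (B - C)" arbitrary: B rule: less_induct)
  case less
  have B: "finite B" "B \<subseteq> U"
    using less.prems(1) by (auto simp: indep_def)
  show ?case
  proof (cases "B \<subseteq> C")
    case True
    then show ?thesis
      using less.prems(2) card_mono by blast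
  next
    case False
    then obtain b where b: "b \<in> B" "b \<notin> C"
      by blast
    have sub: "B - {b} \<subseteq> U"
      using B by blast
    have nb: "b \<notin> cl (B - {b})"
      using less.prems(1) b(1) by (auto simp: indep_def)
    have "\<not> C \<subseteq> cl (B - {b})"
      using cl_least[of C "B - {b}"] nb sub less.prems(4) b(1) by blast
    then obtain c where c: "c \<in> C" "c \<notin> cl (B - {b})"
      by blast
    then have cn: "c \<notin> B - {b}"
      using cl_incl[OF sub] by blast
    let ?B = "insert c (B - {b})"
    have "indep (B - {b})"
      using indep_subset[OF less.prems(1)] by blast
    then have "indep ?B"
      using indep_insert c less.prems(3) by blast
    moreover have "?B \<subseteq> cl C"
      using less.prems(3,4) c(1) cl_incl[OF less.prems(3)] by blast
    moreover have "?B - C = (B - C) - {b}"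
      using c(1) by auto
    then have "card (?B - C) < card (B - C)"
      using b B(1) by (metis Diff_iff card_Diff1_less finite_Diff)
    ultimately have "card ?B \<le> card C"
      using less.hyps less.prems(2,3) by blast
    moreover have "card ?B = card B"
      using cn b(1) B(1) by (metis card_Suc_Diff1 card_insert_disjoint finite_Diff)
    ultimately show ?thesis
      by simp
  qed
qed

text \<open>Spanning sets may lie outside \<open>S\<close>. This suits transcendence bases, which
  consist of elements of the generated field rather than of generators.\<close>

definition rk :: "'a set \<Rightarrow> nat" where
  "rk S = (LEAST n. \<exists>C. finite C \<and> C \<subseteq> U \<and> card C = n \<and> S \<subseteq> cl C)"

lemma rk_eq_card:
  assumes "indep B" "B \<subseteq> cl S" "S \<subseteq> cl B"
  shows "rk S = card B"
  unfolding rk_def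
proof (rule Least_equality)
  show "\<exists>C. finite C \<and> C \<subseteq> U \<and> card C = card B \<and> S \<subseteq> cl C"
    using assms by (auto simp: indep_def)
  fix n assume "\<exists>C. finite C \<and> C \<subseteq> U \<and> card C = n \<and> S \<subseteq> cl C"
  then obtain C where C: "finite C" "C \<subseteq> U" "card C = n" "S \<subseteq> cl C"
    by blast
  then have "B \<subseteq> cl C"
    using assms(2) cl_least[OF C(4,2)] by blast
  then show "card B \<le> n"
    using steinitz[OF assms(1) C(1,2)] C(3) by simp
qed

lemma basis_exists:
  assumes "finite S" "S \<subseteq> U"
  obtains B where "indep B" "B \<subseteq> S" "S \<subseteq> cl B"
proof -
  have "\<exists>B. indep B \<and> B \<subseteq> S \<and> S \<subseteq> cl B"
    using assms
  proof (induction S)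
    case empty
    then show ?case
      by (auto simp: indep_def)
  next
    case (insert x S)
    then obtain B where B: "indep B" "B \<subseteq> S" "S \<subseteq> cl B"
      by auto
    have BU: "B \<subseteq> U"
      using B(1) by (simp add: indep_def)
    show ?case
    proof (cases "x \<in> cl B")
      case True
      then show ?thesis
        using B by blast
    next
      case False
      have "insert x B \<subseteq> U"
        using BU insert.prems by blast
      then have "cl B \<subseteq> cl (insert x B)" "insert x B \<subseteq> cl (insert x B)"
        using cl_mono[of B "insert x B"] cl_incl[of "insert x B"] by auto
      then have "insert x S \<subseteq> cl (insert x B)"
        using B(3) by blast
      moreover have "indep (insert x B)"
        using indep_insert[OF B(1) _ False] insert.prems by blast
      ultimately show ?thesis
        using B(2) by blast
    qed
  qed
  then show ?thesis
    using that by blast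
qed

lemma rk_mono:
  assumes "S \<subseteq> cl T" "finite T" "T \<subseteq> U" "finite S" "S \<subseteq> U"
  shows "rk S \<le> rk T"
proof -
  obtain B where B: "indep B" "B \<subseteq> S" "S \<subseteq> cl B"
    using basis_exists[OF assms(4,5)] .
  obtain C where C: "indep C" "C \<subseteq> T" "T \<subseteq> cl C"
    using basis_exists[OF assms(2,3)] .
  have U: "B \<subseteq> U" "C \<subseteq> U" "finite C"
    using B C by (auto simp: indep_def)
  have "rk S = card B" "rk T = card C"
    using rk_eq_card[OF B(1) order_trans[OF B(2) cl_incl[OF assms(5)]] B(3)]
      rk_eq_card[OF C(1) order_trans[OF C(2) cl_incl[OF assms(3)]] C(3)] by auto
  moreover have "B \<subseteq> cl C"
    using B(2) assms(1) cl_least[OF C(3) U(2)] by blast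
  ultimately show ?thesis
    using steinitz[OF B(1) U(3,2)] by simp
qed

lemma rk_insert:
  assumes "finite S" "S \<subseteq> U" "x \<in> U"
  shows "rk (insert x S) = (if x \<in> cl S then rk S else Suc (rk S))"
proof -
  obtain B where B: "indep B" "B \<subseteq> S" "S \<subseteq> cl B"
    using basis_exists[OF assms(1,2)] .
  have U: "B \<subseteq> U" "finite B" "insert x S \<subseteq> U" "insert x B \<subseteq> U"
    using B assms by (auto simp: indep_def)
  have clS: "cl S = cl B"
    using cl_least[OF B(3) U(1)] cl_mono[OF B(2) assms(2)] by blast
  have BS: "B \<subseteq> cl S" "B \<subseteq> cl (insert x S)"
    using B(2) cl_incl[OF assms(2)] cl_incl[OF U(3)] by blast+
  have rkS: "rk S = card B"
    using rk_eq_card[OF B(1) BS(1) B(3)] .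
  show ?thesis
  proof (cases "x \<in> cl S")
    case True
    then have "rk (insert x S) = card B"
      using rk_eq_card[OF B(1) BS(2)] B(3) clS by auto
    then show ?thesis
      using True rkS by simp
  next
    case False
    then have ind: "indep (insert x B)"
      using indep_insert[OF B(1) assms(3)] clS by simp
    have "insert x S \<subseteq> cl (insert x B)"
      using cl_incl[OF U(4)] cl_mono[OF _ U(4), of B] B(3) by blast
    moreover have "insert x B \<subseteq> cl (insert x S)"
      using B(2) cl_incl[OF U(3)] by blast
    ultimately have "rk (insert x S) = card (insert x B)"
      using rk_eq_card[OF ind] by blast
    moreover have "x \<notin> B"
      using False BS(1) by blast
    ultimately show ?thesis
      using False rkS U(2) by simp
  qed
qed

text \<open>An element of \<open>T\<close> outside \<open>cl S\<close> would raise the rank above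
  that of \<open>T\<close>.\<close>

lemma rk_eq_imp_subset_cl:
  assumes "S \<subseteq> cl T" "finite S" "S \<subseteq> U" "finite T" "T \<subseteq> U" "rk T \<le> rk S"
  shows "T \<subseteq> cl S"
proof
  fix x assume x: "x \<in> T"
  then have xU: "x \<in> U" "insert x S \<subseteq> cl T"
    using assms cl_incl[OF assms(5)] by auto
  then have "rk (insert x S) \<le> rk T"
    using assms by (intro rk_mono) auto
  then show "x \<in> cl S"
    using rk_insert[OF assms(2,3) xU(1)] assms(6) by (auto split: if_splits)
qed

text \<open>The hypothesis \<open>meet\<close> is the property of algebraic closure that fails for arbitrary matroids.
  Three pairwise coplanar lines that are not all coplanar then meet in a point.\<close>

context
  assumes meet: "\<And>S T e f. S \<subseteq> U \<Longrightarrow> T \<subseteq> U \<Longrightarrow> e \<in> U \<Longrightarrow> e \<notin> cl (S \<union> T) \<Longrightarrow> f \<in> cl (insert e S) \<Longrightarrow>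
    f \<in> cl (insert e T) \<Longrightarrow> f \<in> cl (insert e (cl S \<inter> cl T))"
begin

text \<open>Take \<open>e\<close> on \<open>A\<close> outside the plane of \<open>B\<close> and
  \<open>C\<close>. Every point of \<open>A\<close> lies in the span of \<open>e\<close> with
  \<open>B\<close> and of \<open>e\<close> with \<open>C\<close>, hence by \<open>meet\<close> in
  the span of \<open>e\<close> with the common points of \<open>B\<close> and \<open>C\<close>. If
  these were only \<open>cl I\<close>, then \<open>A\<close> would have rank at most m + 1.\<close>

lemma two_lines_meet:
  assumes fin: "finite A" "finite B" "finite C" "A \<subseteq> U" "B \<subseteq> U" "C \<subseteq> U"
    and I: "I \<subseteq> A" "I \<subseteq> B" "I \<subseteq> C" "rk I = m" and lines: "rk A = m + 2" "rk B = m + 2" "rk C = m + 2"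
    and planes: "rk (A \<union> B) = m + 3" "rk (A \<union> C) = m + 3" "rk (B \<union> C) = m + 3"
    and all: "rk (A \<union> B \<union> C) = m + 4"
  obtains p where "p \<in> cl B \<inter> cl C" "p \<notin> cl I"
proof (rule ccontr)
  assume "\<not> thesis"
  then have BC: "cl B \<inter> cl C \<subseteq> cl I"
    using that by blast
  have IU: "I \<subseteq> U" "finite I"
    using I(1) fin(1,4) finite_subset by auto
  have BCU: "finite (B \<union> C)" "B \<union> C \<subseteq> U"
    using fin by auto
  have "\<not> A \<subseteq> cl (B \<union> C)"
  proof
    assume "A \<subseteq> cl (B \<union> C)"
    then have "A \<union> B \<union> C \<subseteq> cl (B \<union> C)"
      using cl_incl[OF BCU(2)] by blast
    then have "rk (A \<union> B \<union> C) \<le> rk (B \<union> C)"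
      using rk_mono[of "A \<union> B \<union> C" "B \<union> C"] fin by simp
    then show False
      using all planes by simp
  qed
  then obtain e where e: "e \<in> A" "e \<notin> cl (B \<union> C)"
    by blast
  have eU: "e \<in> U" "insert e I \<subseteq> U"
    using e(1) fin IU by auto
  \<comment> \<open>Modulo \<open>I\<close>, adding \<open>e\<close> to the line \<open>D\<close>
    spans the plane of \<open>A\<close> and \<open>D\<close>.\<close>
  have contain: "A \<subseteq> cl (insert e D)" if D: "D \<subseteq> B \<union> C" "rk D = m + 2" "rk (A \<union> D) = m + 3" for D
  proof -
    have DU: "D \<subseteq> U" "finite D" "A \<union> D \<subseteq> U"
      using D(1) fin BCU finite_subset[of D "B \<union> C"] by auto
    have "e \<notin> cl D"
      using e(2) cl_mono[OF D(1) BCU(2)] by blast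
    then have "rk (insert e D) = m + 3"
      using rk_insert[OF DU(2,1) eU(1)] D(2) by simp
    moreover have "insert e D \<subseteq> cl (A \<union> D)"
      using cl_incl[OF DU(3)] e(1) by blast
    ultimately have "A \<union> D \<subseteq> cl (insert e D)"
      using rk_eq_imp_subset_cl[of "insert e D" "A \<union> D"] D(3) DU fin(1) eU(1) by simp
    then show ?thesis
      by blast
  qed
  have "A \<subseteq> cl (insert e B)" "A \<subseteq> cl (insert e C)"
    using contain[of B] contain[of C] lines planes by auto
  then have "A \<subseteq> cl (insert e (cl B \<inter> cl C))"
    using meet[OF fin(5,6) eU(1) e(2)] by blast
  moreover have "cl (insert e (cl B \<inter> cl C)) \<subseteq> cl (insert e I)"
  proof (rule cl_least)
    show "insert e (cl B \<inter> cl C) \<subseteq> cl (insert e I)"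
      using BC cl_mono[OF _ eU(2), of I] cl_incl[OF eU(2)] by blast
  qed (rule eU)
  ultimately have "A \<subseteq> cl (insert e I)"
    by blast
  then have "rk A \<le> rk (insert e I)"
    using rk_mono[of A "insert e I"] fin(1,4) IU eU by simp
  also have "\<dots> \<le> m + 1"
    using rk_insert[OF IU(2,1) eU(1)] I(4) by simp
  finally show False
    using lines by simp
qed

text \<open>Modulo \<open>I\<close>, \<open>p\<close> and \<open>x\<close> are two distinct points
  of the line \<open>L\<close>.\<close>

lemma plane_spanned:
  assumes fin: "finite L" "L \<subseteq> U" and I: "I \<subseteq> L" "rk I = m" and L: "rk L = m + 2"
    and p: "p \<in> cl L" "p \<notin> cl I" and x: "x \<in> cl L" "x \<notin> cl (insert p I)"
  shows "L \<subseteq> cl (insert x (insert p I))"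
proof -
  have U: "I \<subseteq> U" "finite I" "p \<in> U" "x \<in> U"
    using I fin p x cl_subset[OF fin(2)] finite_subset by auto
  have "rk (insert p I) = m + 1"
    using rk_insert[OF U(2,1,3)] p I by simp
  then have "rk (insert x (insert p I)) = m + 2"
    using rk_insert[of "insert p I" x] U x by simp
  moreover have "insert x (insert p I) \<subseteq> cl L"
    using p x I cl_incl[OF fin(2)] by blast
  ultimately show ?thesis
    using rk_eq_imp_subset_cl[of "insert x (insert p I)" L] U L fin by simp
qed

text \<open>If \<open>p\<close> were off \<open>A\<close>, the points where \<open>A\<close> meets
  \<open>B\<close> and \<open>C\<close> would differ from \<open>p\<close>, and together with
  \<open>p\<close> they would span \<open>B\<close> and \<open>C\<close> modulo \<open>I\<close>.
  All three lines would then lie in the plane of \<open>p\<close> and \<open>A\<close>, of rank m +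
  3.\<close>

lemma three_lines_meet:
  assumes fin: "finite A" "finite B" "finite C" "A \<subseteq> U" "B \<subseteq> U" "C \<subseteq> U"
    and I: "I \<subseteq> A" "I \<subseteq> B" "I \<subseteq> C" "rk I = m" and lines: "rk A = m + 2" "rk B = m + 2" "rk C = m + 2"
    and planes: "rk (A \<union> B) = m + 3" "rk (A \<union> C) = m + 3" "rk (B \<union> C) = m + 3"
    and all: "rk (A \<union> B \<union> C) = m + 4"
    and p: "p \<in> cl B \<inter> cl C" "p \<notin> cl I"
  shows "p \<in> cl A"
proof (rule ccontr)
  assume pA: "p \<notin> cl A"
  have pU: "p \<in> U" "insert p A \<subseteq> U"
    using p(1) cl_subset[OF fin(5)] fin(4) by auto
  have inA: "D \<subseteq> cl (insert p A)"
    if D: "finite D" "D \<subseteq> U" "I \<subseteq> D" "rk D = m + 2" "p \<in> cl D" and q: "q \<in> cl A \<inter> cl D" "q \<notin> cl I" for D q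
  proof -
    have qI: "insert q I \<subseteq> cl A"
      using q(1) I(1) cl_incl[OF fin(4)] by blast
    then have "p \<notin> cl (insert q I)"
      using pA cl_least[OF _ fin(4)] by blast
    then have "D \<subseteq> cl (insert p (insert q I))"
      using plane_spanned[OF D(1-3) I(4) D(4) _ q(2) D(5)] q(1) by blast
    also have "\<dots> \<subseteq> cl (insert p A)"
      using qI cl_mono[OF _ pU(2), of A] cl_incl[OF pU(2)] pU(2) by (intro cl_least) auto
    finally show ?thesis .
  qed
  have comm: "B \<union> A = A \<union> B" "C \<union> A = A \<union> C" "C \<union> B = B \<union> C" "A \<union> C \<union> B = A \<union> B \<union> C" "B \<union> A \<union> C = A \<union> B \<union> C"
    by auto
  obtain q where "q \<in> cl A \<inter> cl B" "q \<notin> cl I"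
    by (rule two_lines_meet[of C A B I m]) (use fin I lines planes all in \<open>simp_all add: comm\<close>)
  then have "B \<subseteq> cl (insert p A)"
    using inA[OF fin(2,5) I(2) lines(2)] p(1) by blast
  moreover obtain q' where "q' \<in> cl A \<inter> cl C" "q' \<notin> cl I"
    by (rule two_lines_meet[of B A C I m]) (use fin I lines planes all in \<open>simp_all add: comm\<close>)
  then have "C \<subseteq> cl (insert p A)"
    using inA[OF fin(3,6) I(3) lines(3)] p(1) by blast
  ultimately have "A \<union> B \<union> C \<subseteq> cl (insert p A)"
    using cl_incl[OF pU(2)] by blast
  then have "rk (A \<union> B \<union> C) \<le> rk (insert p A)"
    using rk_mono[of "A \<union> B \<union> C" "insert p A"] fin pU by simp
  then show False
    using all lines rk_insert[OF fin(1,4) pU(1)] pA by simp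
qed

text \<open>The point common to A2 and A3 also lies on A1 and on A4, by the triples A1, A2, A3 and
  A4, A2, A3. Modulo \<open>I\<close>, one further point on each of A1 and A4 then spans both lines
  with it, giving rank at most m + 3.\<close>

theorem no_vamos:
  assumes fin: "finite A1" "finite A2" "finite A3" "finite A4" "A1 \<subseteq> U" "A2 \<subseteq> U" "A3 \<subseteq> U" "A4 \<subseteq> U"
    and I: "I \<subseteq> A1" "I \<subseteq> A2" "I \<subseteq> A3" "I \<subseteq> A4" "rk I = m"
    and lines: "rk A1 = m + 2" "rk A2 = m + 2" "rk A3 = m + 2" "rk A4 = m + 2"
    and planes: "rk (A1 \<union> A2) = m + 3" "rk (A1 \<union> A3) = m + 3" "rk (A2 \<union> A3) = m + 3" "rk (A2 \<union> A4) = m + 3"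
      "rk (A3 \<union> A4) = m + 3"
    and all: "rk (A1 \<union> A2 \<union> A3) = m + 4" "rk (A2 \<union> A3 \<union> A4) = m + 4"
    and skew: "rk (A1 \<union> A4) = m + 4"
  shows False
proof -
  have comm: "A4 \<union> A2 = A2 \<union> A4" "A4 \<union> A3 = A3 \<union> A4" "A2 \<union> A4 \<union> A3 = A2 \<union> A3 \<union> A4"
    by auto
  obtain p where p: "p \<in> cl A2 \<inter> cl A3" "p \<notin> cl I"
    by (rule two_lines_meet[OF fin(1-3,5-7) I(1-3,5) lines(1-3) planes(1-3) all(1)])
  have p1: "p \<in> cl A1"
    by (rule three_lines_meet[OF fin(1-3,5-7) I(1-3,5) lines(1-3) planes(1-3) all(1) p])
  have p4: "p \<in> cl A4"
    by (rule three_lines_meet[OF fin(4,2,3,8,6,7) I(4,2,3,5) lines(4,2,3) _ _ planes(3) _ p])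
      (simp_all add: comm planes all)
  have U: "I \<subseteq> U" "finite I" "p \<in> U"
    using I fin p1 cl_subset[OF fin(5)] finite_subset by auto
  have rp: "rk (insert p I) = m + 1"
    using rk_insert[OF U(2,1,3)] p(2) I by simp
  have span: "\<exists>x\<in>D. D \<subseteq> cl (insert x (insert p I))" if D: "finite D" "D \<subseteq> U" "I \<subseteq> D" "rk D = m + 2" "p \<in> cl D" for D
  proof -
    have "\<not> D \<subseteq> cl (insert p I)"
      using rk_mono[of D "insert p I"] D U rp by auto
    then obtain x where x: "x \<in> D" "x \<notin> cl (insert p I)"
      by blast
    then show ?thesis
      using plane_spanned[OF D(1-3) I(5) D(4,5) p(2)] cl_incl[OF D(2)] by blast
  qed
  obtain x y where xy: "x \<in> A1" "A1 \<subseteq> cl (insert x (insert p I))" "y \<in> A4" "A4 \<subseteq> cl (insert y (insert p I))"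
    using span[OF fin(1,5) I(1) lines(1) p1] span[OF fin(4,8) I(4) lines(4) p4] by blast
  let ?T = "insert x (insert y (insert p I))"
  have xyU: "x \<in> U" "y \<in> U" "?T \<subseteq> U"
    using xy fin U by auto
  have "cl (insert x (insert p I)) \<subseteq> cl ?T" "cl (insert y (insert p I)) \<subseteq> cl ?T"
    by (intro cl_mono xyU(3); blast)+
  then have "A1 \<union> A4 \<subseteq> cl ?T"
    using xy(2,4) by blast
  then have "rk (A1 \<union> A4) \<le> rk ?T"
    using rk_mono[of "A1 \<union> A4" ?T] fin U xyU by simp
  also have "\<dots> \<le> m + 3"
    using rk_insert[of "insert y (insert p I)" x] rk_insert[of "insert p I" y] rp U xyU by (auto split: if_splits)
  finally show False
    using skew by simp
qed

end

end

section \<open>Algebraic matroids\<close>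

context field
begin

text \<open>With \<open>combination\<close>, names for the expressions that
  \<open>algebraically_independent\<close> spells out.\<close>

definition monomial :: "'a multiset \<Rightarrow> 'a" where
  "monomial m = (\<Otimes>b\<in>set_mset m. b [^] count m b)"

definition combination :: "'a multiset set \<Rightarrow> ('a multiset \<Rightarrow> 'a) \<Rightarrow> 'a" where
  "combination E c = (\<Oplus>m\<in>E. c m \<otimes> monomial m)"

lemma monomial_closed: "set_mset m \<subseteq> carrier R \<Longrightarrow> monomial m \<in> carrier R"
  unfolding monomial_def by (intro finprod_closed) auto

lemma monomial_add_power:
  assumes "set_mset m \<subseteq> carrier R" "b \<in> carrier R" "b \<notin># m"
  shows "monomial (m + replicate_mset n b) = monomial m \<otimes> b [^] n"
proof (cases "n = 0")
  case True
  then show ?thesis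
    using monomial_closed[OF assms(1)] by simp
next
  case False
  then have "set_mset (m + replicate_mset n b) = insert b (set_mset m)"
    by (simp add: set_mset_replicate_mset_subset)
  then have "monomial (m + replicate_mset n b) = (\<Otimes>x\<in>insert b (set_mset m). x [^] count (m + replicate_mset n b) x)"
    by (simp add: monomial_def)
  also have "\<dots> = b [^] count (m + replicate_mset n b) b \<otimes> (\<Otimes>x\<in>set_mset m. x [^] count (m + replicate_mset n b) x)"
    using assms by (intro finprod_insert) auto
  also have "(\<Otimes>x\<in>set_mset m. x [^] count (m + replicate_mset n b) x) = monomial m"
    unfolding monomial_def using assms by (intro finprod_cong') auto
  also have "count (m + replicate_mset n b) b = n"
    using assms(3) by (simp add: not_in_iff)
  finally show ?thesis
    using assms monomial_closed m_comm by simp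
qed

lemma combination_closed:
  assumes "\<forall>m\<in>E. set_mset m \<subseteq> carrier R \<and> c m \<in> carrier R"
  shows "combination E c \<in> carrier R"
  unfolding combination_def using assms monomial_closed by (intro finsum_closed) auto

text \<open>Substitutes polynomials in \<open>B\<close> for the coefficients of \<open>p\<close>.
  The bound on the multiplicity of \<open>b\<close> keeps monomials from different powers of
  \<open>b\<close> distinct, so no coefficients merge and non-triviality survives.\<close>

lemma eval_combinations:
  assumes F: "F \<subseteq> carrier R" and B: "B \<subseteq> carrier R" and b: "b \<in> carrier R" "b \<notin> B"
    and p: "\<forall>x\<in>set p. \<exists>E c. finite E \<and> (\<forall>m\<in>E. set_mset m \<subseteq> B \<and> c m \<in> F) \<and> x = combination E c"
  shows "\<exists>E c. finite E \<and> (\<forall>m\<in>E. set_mset m \<subseteq> insert b B \<and> count m b < length p \<and> c m \<in> F) \<and>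
    eval p b = combination E c \<and> ((\<exists>x\<in>set p. x \<noteq> \<zero>) \<longrightarrow> (\<exists>m\<in>E. c m \<noteq> \<zero>))"
  using p
proof (induction p)
  case Nil
  show ?case
    by (intro exI[of _ "{}"]) (simp add: combination_def)
next
  case (Cons a p)
  have "\<exists>E c. finite E \<and> (\<forall>m\<in>E. set_mset m \<subseteq> insert b B \<and> count m b < length p \<and> c m \<in> F) \<and>
    eval p b = combination E c \<and> ((\<exists>x\<in>set p. x \<noteq> \<zero>) \<longrightarrow> (\<exists>m\<in>E. c m \<noteq> \<zero>))"
    by (rule Cons.IH) (use Cons.prems in simp)
  then obtain E c where E0: "finite E \<and> (\<forall>m\<in>E. set_mset m \<subseteq> insert b B \<and> count m b < length p \<and> c m \<in> F) \<and>
    eval p b = combination E c \<and> ((\<exists>x\<in>set p. x \<noteq> \<zero>) \<longrightarrow> (\<exists>m\<in>E. c m \<noteq> \<zero>))"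
    by (elim exE)
  then have E: "finite E" "\<And>m. m \<in> E \<Longrightarrow> set_mset m \<subseteq> insert b B" "\<And>m. m \<in> E \<Longrightarrow> count m b < length p"
      "\<And>m. m \<in> E \<Longrightarrow> c m \<in> F" "eval p b = combination E c" "(\<exists>x\<in>set p. x \<noteq> \<zero>) \<longrightarrow> (\<exists>m\<in>E. c m \<noteq> \<zero>)"
    by simp_all
  have "\<exists>E c. finite E \<and> (\<forall>m\<in>E. set_mset m \<subseteq> B \<and> c m \<in> F) \<and> a = combination E c"
    by (rule bspec[OF Cons.prems]) simp
  then obtain E' c' where E'0: "finite E' \<and> (\<forall>m\<in>E'. set_mset m \<subseteq> B \<and> c' m \<in> F) \<and> a = combination E' c'"
    by (elim exE)
  then have E': "finite E'" "\<And>m. m \<in> E' \<Longrightarrow> set_mset m \<subseteq> B" "\<And>m. m \<in> E' \<Longrightarrow> c' m \<in> F" "a = combination E' c'"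
    by simp_all
  define n where "n = length p"
  define s where "s m = m + replicate_mset n b" for m
  \<comment> \<open>Monomials with exactly \<open>n\<close> copies of \<open>b\<close> stem from the
    head of the list; removing the copies recovers the original monomial.\<close>
  define d where "d m = (if count m b = n then c' (m - replicate_mset n b) else c m)" for m
  have nb: "b \<notin># m" "count (s m) b = n" "d (s m) = c' m" "set_mset (s m) \<subseteq> insert b B" if "m \<in> E'" for m
  proof -
    show "b \<notin># m"
      using E'(2)[OF that] b(2) by blast
    then show "count (s m) b = n"
      by (simp add: s_def not_in_iff)
    then show "d (s m) = c' m"
      by (simp add: d_def) (simp add: s_def)
    show "set_mset (s m) \<subseteq> insert b B"
      using E'(2)[OF that] by (auto simp: s_def split: if_splits)
  qed
  have dE: "d m = c m" if "m \<in> E" for m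
    using E(3)[OF that] by (simp add: d_def n_def)
  have disj: "E \<inter> s ` E' = {}"
    using E(3) nb(2) by (force simp: n_def)
  have bB: "insert b B \<subseteq> carrier R"
    using b B by auto
  have mc: "monomial m \<in> carrier R" if "m \<in> E \<union> s ` E'" for m
  proof (rule monomial_closed)
    show "set_mset m \<subseteq> carrier R"
      using that E(2) nb(4) bB by blast
  qed
  have dF: "d m \<in> F" if "m \<in> E \<union> s ` E'" for m
    using that dE E(4) nb(3) E'(3) by auto
  have c'C: "c' m \<in> carrier R" if "m \<in> E'" for m
    using E'(3)[OF that] F by blast
  have dC: "d m \<otimes> monomial m \<in> carrier R" if "m \<in> E \<union> s ` E'" for m
    using dF[OF that] mc[OF that] F by auto
  have mc': "monomial m \<in> carrier R" if "m \<in> E'" for m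
    using that E'(2) B by (intro monomial_closed) blast
  have "combination (E \<union> s ` E') d = combination E d \<oplus> combination (s ` E') d"
    unfolding combination_def using E(1) E'(1) disj dC by (intro finsum_Un_disjoint) auto
  also have "combination E d = eval p b"
    unfolding E(5) combination_def
  proof (rule finsum_cong'[OF refl])
    show "(\<lambda>m. c m \<otimes> monomial m) \<in> E \<rightarrow> carrier R"
      using dC dE by force
  qed (simp add: dE)
  also have "combination (s ` E') d = a \<otimes> b [^] n"
  proof -
    have "combination (s ` E') d = (\<Oplus>m\<in>E'. d (s m) \<otimes> monomial (s m))"
      unfolding combination_def
    proof (rule finsum_reindex)
      show "(\<lambda>m. d m \<otimes> monomial m) \<in> s ` E' \<rightarrow> carrier R"
        using dC by blast
      show "inj_on s E'"
        by (simp add: s_def inj_on_def)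
    qed
    also have "\<dots> = (\<Oplus>m\<in>E'. (c' m \<otimes> monomial m) \<otimes> b [^] n)"
    proof (rule finsum_cong'[OF refl])
      show "(\<lambda>m. (c' m \<otimes> monomial m) \<otimes> b [^] n) \<in> E' \<rightarrow> carrier R"
        using mc' c'C b by auto
      fix m assume m: "m \<in> E'"
      have "set_mset m \<subseteq> carrier R"
        using E'(2)[OF m] B by blast
      then have "monomial (s m) = monomial m \<otimes> b [^] n"
        unfolding s_def using monomial_add_power b(1) nb(1)[OF m] by blast
      then show "d (s m) \<otimes> monomial (s m) = (c' m \<otimes> monomial m) \<otimes> b [^] n"
        using nb(3)[OF m] mc'[OF m] c'C[OF m] b by (simp add: m_assoc)
    qed
    also have "\<dots> = a \<otimes> b [^] n"
      unfolding E'(4) combination_def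
    proof (rule finsum_ldistr[symmetric])
      show "(\<lambda>m. c' m \<otimes> monomial m) \<in> E' \<rightarrow> carrier R"
        using mc' c'C by auto
    qed (use E'(1) b in auto)
    finally show ?thesis .
  qed
  also have "eval p b \<oplus> a \<otimes> b [^] n = eval (a # p) b"
  proof -
    have "eval p b \<in> carrier R" "a \<in> carrier R"
      unfolding E(5) E'(4) using E(2,4) E'(2,3) bB B F by (intro combination_closed; blast)+
    then show ?thesis
      using b by (simp add: n_def a_comm)
  qed
  finally have ev: "eval (a # p) b = combination (E \<union> s ` E') d"
    by simp
  have "\<exists>m\<in>E'. c' m \<noteq> \<zero>" if "a \<noteq> \<zero>"
  proof (rule ccontr)
    assume "\<not> ?thesis"
    then have "combination E' c' = (\<Oplus>m\<in>E'. \<zero>)"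
      unfolding combination_def by (intro finsum_cong') (auto simp: mc')
    then show False
      using that E'(4) by simp
  qed
  then have "(\<exists>x\<in>set (a # p). x \<noteq> \<zero>) \<longrightarrow> (\<exists>m\<in>E \<union> s ` E'. d m \<noteq> \<zero>)"
    using E(6) dE nb(3) by (metis UnI1 UnI2 imageI set_ConsD)
  moreover have "\<forall>m\<in>E \<union> s ` E'. set_mset m \<subseteq> insert b B \<and> count m b < length (a # p) \<and> d m \<in> F"
  proof
    fix m assume m: "m \<in> E \<union> s ` E'"
    then consider "m \<in> E" | m' where "m' \<in> E'" "m = s m'"
      by blast
    then have "set_mset m \<subseteq> insert b B \<and> count m b \<le> n"
    proof cases
      case 1
      then show ?thesis
        using E(2)[OF 1] E(3)[OF 1] by (simp add: n_def)
    next
      case 2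
      then show ?thesis
        using nb(2)[OF 2(1)] nb(4)[OF 2(1)] by simp
    qed
    then show "set_mset m \<subseteq> insert b B \<and> count m b < length (a # p) \<and> d m \<in> F"
      using dF[OF m] by (simp add: n_def less_Suc_eq_le)
  qed
  ultimately show ?case
    using ev E(1) E'(1) by (intro exI[of _ "E \<union> s ` E'"] exI[of _ d]) simp
qed

lemma finite_extension_combination:
  assumes F: "subring F R" and xs: "set xs \<subseteq> carrier R" "distinct xs" and y: "y \<in> finite_extension F xs"
  shows "\<exists>E c. finite E \<and> (\<forall>m\<in>E. set_mset m \<subseteq> set xs \<and> c m \<in> F) \<and> y = combination E c"
  using xs y
proof (induction xs arbitrary: y)
  case Nil
  then have "y \<in> F"
    by simp
  then have "combination {{#}} (\<lambda>_. y) = y"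
    using subringE(1)[OF F] by (auto simp: combination_def monomial_def)
  then show ?case
    using \<open>y \<in> F\<close> by (intro exI[of _ "{{#}}"] exI[of _ "\<lambda>_. y"]) simp
next
  case (Cons x xs)
  have xc: "x \<in> carrier R" "set xs \<subseteq> carrier R"
    using Cons.prems by auto
  then obtain p where p: "p \<in> carrier ((finite_extension F xs)[X])" "y = eval p x"
    using finite_extension_as_eval_img[OF subringE(1)[OF F] xc] Cons.prems(3) by auto
  have "set p \<subseteq> finite_extension F xs"
    using p(1) by (auto simp: polynomial_def simp flip: univ_poly_carrier)
  then have "\<forall>z\<in>set p. \<exists>E c. finite E \<and> (\<forall>m\<in>E. set_mset m \<subseteq> set xs \<and> c m \<in> F) \<and> z = combination E c"
    using Cons.IH[OF xc(2)] Cons.prems(2) by (simp add: subset_eq)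
  moreover have "x \<notin> set xs"
    using Cons.prems(2) by simp
  ultimately have "\<exists>E c. finite E \<and> (\<forall>m\<in>E. set_mset m \<subseteq> insert x (set xs) \<and> count m x < length p \<and> c m \<in> F) \<and>
      eval p x = combination E c \<and> ((\<exists>z\<in>set p. z \<noteq> \<zero>) \<longrightarrow> (\<exists>m\<in>E. c m \<noteq> \<zero>))"
    by (intro eval_combinations[OF subringE(1)[OF F] xc(2,1)])
  then obtain E c where "finite E \<and> (\<forall>m\<in>E. set_mset m \<subseteq> insert x (set xs) \<and> count m x < length p \<and> c m \<in> F) \<and>
      eval p x = combination E c \<and> ((\<exists>z\<in>set p. z \<noteq> \<zero>) \<longrightarrow> (\<exists>m\<in>E. c m \<noteq> \<zero>))"
    by (elim exE)
  then show ?case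
    unfolding p(2) by (intro exI[of _ E] exI[of _ c]) simp
qed

text \<open>An equation for \<open>b\<close> over the field generated by the rest, with denominators
  cleared and coefficients expanded, is a non-trivial polynomial relation among the elements of
  \<open>B\<close>.\<close>

lemma algebraically_independent_notin_acl:
  assumes F: "subfield F R" and B: "finite B" "B \<subseteq> carrier R" and ind: "algebraically_independent R F B" and b: "b \<in> B"
  shows "b \<notin> acl (F \<union> (B - {b}))"
proof
  assume "b \<in> acl (F \<union> (B - {b}))"
  then have alg: "b \<in> carrier R" "(algebraic over generate_field R (F \<union> (B - {b}))) b"
    by (auto simp: acl_def)
  obtain xs where xs: "set xs = B - {b}" "distinct xs"
    using finite_distinct_list[of "B - {b}"] B(1) by auto
  note Fr = subfieldE(1)[OF F]
  have xc: "set xs \<subseteq> carrier R"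
    using xs(1) B(2) by auto
  have S: "subring (finite_extension F xs) R" "F \<union> (B - {b}) \<subseteq> finite_extension F xs"
    using finite_extension_is_subring[OF Fr xc] finite_extension_incl[OF subringE(1)[OF Fr] xc]
      finite_extension_mem[OF Fr xc] xs(1) by auto
  obtain p where p: "set p \<subseteq> finite_extension F xs" "\<exists>x\<in>set p. x \<noteq> \<zero>" "eval p b = \<zero>"
    using algebraic_clear_denominators[OF S alg] by blast
  have entries: "\<forall>z\<in>set p. \<exists>E c. finite E \<and> (\<forall>m\<in>E. set_mset m \<subseteq> set xs \<and> c m \<in> F) \<and> z = combination E c"
  proof
    fix z assume "z \<in> set p"
    then show "\<exists>E c. finite E \<and> (\<forall>m\<in>E. set_mset m \<subseteq> set xs \<and> c m \<in> F) \<and> z = combination E c"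
      using p(1) by (intro finite_extension_combination[OF Fr xc xs(2)]) blast
  qed
  have "b \<notin> set xs"
    by (simp add: xs(1))
  from eval_combinations[OF subringE(1)[OF Fr] xc alg(1) this entries]
  obtain E c where E: "finite E \<and> (\<forall>m\<in>E. set_mset m \<subseteq> insert b (set xs) \<and> count m b < length p \<and> c m \<in> F) \<and>
      eval p b = combination E c \<and> ((\<exists>x\<in>set p. x \<noteq> \<zero>) \<longrightarrow> (\<exists>m\<in>E. c m \<noteq> \<zero>))"
    by (elim exE)
  have "insert b (set xs) = B"
    using xs(1) b by auto
  then have "finite E \<and> (\<forall>m\<in>E. set_mset m \<subseteq> B \<and> c m \<in> F) \<and>
      (\<Oplus>m\<in>E. c m \<otimes> (\<Otimes>b\<in>set_mset m. b [^] count m b)) = \<zero>"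
    using E p(3) by (simp add: combination_def monomial_def)
  then have "\<forall>m\<in>E. c m = \<zero>"
    by (rule ind[unfolded algebraically_independent_def, THEN spec, THEN spec, THEN mp])
  then show False
    using E p(2) by blast
qed

end

section \<open>Algebraic closure over a base field as a pregeometry\<close>

context field
begin

lemma acl_pregeometry:
  assumes "F \<subseteq> carrier R"
  shows "pregeometry (carrier R) (\<lambda>S. acl (F \<union> S))"
proof
  fix S T x y
  show "acl (F \<union> S) \<subseteq> carrier R"
    by (rule acl_carrier)
  show "S \<subseteq> acl (F \<union> S)" if "S \<subseteq> carrier R"
    using subset_acl[of "F \<union> S"] assms that by blast
  show "acl (F \<union> S) \<subseteq> acl (F \<union> T)" if "S \<subseteq> acl (F \<union> T)" "T \<subseteq> carrier R"
    using subset_acl[of "F \<union> T"] assms that by (intro acl_least) auto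
  show "x \<in> acl (F \<union> insert y S)"
    if "S \<subseteq> carrier R" "x \<in> carrier R" "y \<in> acl (F \<union> insert x S)" "y \<notin> acl (F \<union> S)"
    using acl_exchange[of "F \<union> S" x y] assms that by simp
qed

text \<open>\<open>acl_inter\<close> relative to \<open>F\<close>: both closures contain
  \<open>F\<close>, so adjoining it to their intersection changes nothing.\<close>

lemma acl_meet:
  assumes "F \<subseteq> carrier R" "S \<subseteq> carrier R" "T \<subseteq> carrier R" "e \<in> carrier R" "e \<notin> acl (F \<union> (S \<union> T))"
    and "f \<in> acl (F \<union> insert e S)" "f \<in> acl (F \<union> insert e T)"
  shows "f \<in> acl (F \<union> insert e (acl (F \<union> S) \<inter> acl (F \<union> T)))"
proof -
  have "(F \<union> S) \<union> (F \<union> T) = F \<union> (S \<union> T)"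
    by auto
  then have "f \<in> acl (insert e (acl (F \<union> S) \<inter> acl (F \<union> T)))"
    using acl_inter[of "F \<union> S" "F \<union> T" e f] assms by simp
  moreover have "F \<subseteq> acl (F \<union> S)" "F \<subseteq> acl (F \<union> T)"
    using subset_acl[of "F \<union> S"] subset_acl[of "F \<union> T"] assms by auto
  then have "insert e (acl (F \<union> S) \<inter> acl (F \<union> T)) = F \<union> insert e (acl (F \<union> S) \<inter> acl (F \<union> T))"
    by auto
  ultimately show ?thesis
    by simp
qed

text \<open>A transcendence basis is independent and spans \<open>S\<close>;
  \<open>rk_eq_card\<close> asks only that it lie in the closure of \<open>S\<close>.\<close>

lemma transcendence_degree_eq_rk:
  assumes F: "subfield F R" and S: "S \<subseteq> carrier R"
    and deg: "has_transcendence_degree R F (generate_field R (F \<union> S)) n"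
  shows "pregeometry.rk (carrier R) (\<lambda>S. acl (F \<union> S)) S = n"
proof -
  interpret pregeometry "carrier R" "\<lambda>S. acl (F \<union> S)"
    using acl_pregeometry[OF subfieldE(3)[OF F]] .
  let ?L = "generate_field R (F \<union> S)"
  have FS: "F \<union> S \<subseteq> carrier R"
    using S subfieldE(3)[OF F] by blast
  obtain B where B: "B \<subseteq> ?L" "algebraically_independent R F B" "\<And>y. y \<in> ?L \<Longrightarrow> algebraic (generate_field R (F \<union> B)) y"
      "finite B" "card B = n"
    using deg by (auto simp: has_transcendence_degree_def transcendence_basis_def)
  have Bc: "B \<subseteq> carrier R"
    using B(1) generate_field_incl[OF FS] by blast
  have "indep B"
    unfolding indep_def using B(4) Bc algebraically_independent_notin_acl[OF F B(4) Bc B(2)] by blast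
  moreover have "B \<subseteq> acl (F \<union> S)"
    using B(1) generate_subset_acl[OF FS] by blast
  moreover have "S \<subseteq> acl (F \<union> B)"
  proof
    fix y assume y: "y \<in> S"
    then have "y \<in> ?L"
      by (auto intro: generate_field.incl)
    then show "y \<in> acl (F \<union> B)"
      using B(3) y S by (auto simp: acl_def over_def)
  qed
  ultimately show ?thesis
    using rk_eq_card B(5) by blast
qed

end

theorem vamos_not_algebraic:
  fixes F :: "'k ring"
  assumes "field F" "finite Q" "vamos_configuration Q r m I A1 A2 A3 A4"
  shows "\<not> algebraic_over TYPE('l) F Q r"
proof
  assume "algebraic_over TYPE('l) F Q r"
  then obtain K :: "'l ring" and \<phi> v where K: "field K" and \<phi>: "\<phi> \<in> ring_hom F K" and v: "v \<in> Q \<rightarrow> carrier K"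
    and deg: "\<forall>A. A \<subseteq> Q \<longrightarrow> (\<exists>n. has_transcendence_degree K (\<phi> ` carrier F)
        (generate_field K (\<phi> ` carrier F \<union> v ` A)) n \<and> r A = real n)"
    unfolding algebraic_over_def by blast
  interpret K: field K
    by (rule K)
  interpret F: field F
    by fact
  interpret \<phi>: ring_hom_ring F K \<phi>
    using ring_hom_ringI2[OF F.ring_axioms K.ring_axioms \<phi>] .
  let ?F = "\<phi> ` carrier F"
  have F: "subfield ?F K"
    using \<phi>.img_is_subfield(2)[OF F.carrier_is_subfield] by simp
  have Fc: "?F \<subseteq> carrier K"
    using subfieldE(3)[OF F] .
  interpret pregeometry "carrier K" "\<lambda>S. K.acl (?F \<union> S)"
    using K.acl_pregeometry[OF Fc] .
  have vA: "v ` A \<subseteq> carrier K" "finite (v ` A)" if "A \<subseteq> Q" for A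
    using that v finite_subset[OF that assms(2)] by auto
  have r: "r A = real (rk (v ` A))" if "A \<subseteq> Q" for A
    using deg that K.transcendence_degree_eq_rk[OF F vA(1)[OF that]] by metis
  have sub: "A1 \<subseteq> Q" "A2 \<subseteq> Q" "A3 \<subseteq> Q" "A4 \<subseteq> Q" "I \<subseteq> A1" "I \<subseteq> A2" "I \<subseteq> A3" "I \<subseteq> A4" "I \<subseteq> Q"
    using assms(3) by (auto simp: vamos_configuration_def)
  \<comment> \<open>\<open>v\<close> may identify elements, but the configuration involves only
    inclusions and unions, which images preserve.\<close>
  have rk: "rk (v ` A) = n" if "A \<subseteq> Q" "r A = real n" for A n
    using r[OF that(1)] that(2) by simp
  have rk2: "rk (v ` A \<union> v ` B) = n" if "A \<subseteq> Q" "B \<subseteq> Q" "r (A \<union> B) = real n" for A B n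
    using rk[of "A \<union> B" n] that by (simp add: image_Un)
  have rk3: "rk (v ` A \<union> v ` B \<union> v ` C) = n" if "A \<subseteq> Q" "B \<subseteq> Q" "C \<subseteq> Q" "r (A \<union> B \<union> C) = real n" for A B C n
    using rk[of "A \<union> B \<union> C" n] that by (simp add: image_Un)
  note V = assms(3)[unfolded vamos_configuration_def]
  show False
  proof (rule no_vamos[where ?A1.0 = "v ` A1" and ?A2.0 = "v ` A2" and ?A3.0 = "v ` A3" and ?A4.0 = "v ` A4"
        and I = "v ` I" and m = m])
    show "f \<in> K.acl (?F \<union> insert e (K.acl (?F \<union> S) \<inter> K.acl (?F \<union> T)))"
      if "S \<subseteq> carrier K" "T \<subseteq> carrier K" "e \<in> carrier K" "e \<notin> K.acl (?F \<union> (S \<union> T))"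
        "f \<in> K.acl (?F \<union> insert e S)" "f \<in> K.acl (?F \<union> insert e T)" for S T e f
      using K.acl_meet[OF Fc that] .
  qed (use V in \<open>simp_all add: vA sub rk rk2 rk3 image_mono\<close>)
qed

theorem mainTheorem1:
  fixes Q :: "'a set" and r :: "'a set \<Rightarrow> real"
  assumes "sparse_paving Q r"
    and "\<not> ingleton_compliant Q r"
  shows "\<not> ZY_compliant Q r
    \<and> \<not> almost_entropic TYPE('w) TYPE('v) Q r
    \<and> (\<forall>F :: 'k ring. field F \<longrightarrow> \<not> algebraic_over TYPE('l) F Q r)"
proof -
  interpret matroid Q r
    using assms(1) by (simp add: sparse_paving_def paving_def)
  obtain m I A1 A2 A3 A4 where vamos: "vamos_configuration Q r m I A1 A2 A3 A4"
    using sparse_paving_ingleton_violation[OF assms] .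
  have "\<not> ZY_compliant Q r"
    using vamos_not_ZY_compliant[OF vamos f_empty] .
  then show ?thesis
    using almost_entropic_ZY_compliant[OF finite_ground] vamos_not_algebraic[OF _ finite_ground vamos] by blast
qed

end
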